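(* Let $w\ge 1$, $m\ge 1$ and $n\ge 3$ be natural numbers, and let $G$ be a connected graph with $\operatorname{Spec}_L(G)=\operatorname{Spec}_L(K_w\bigtriangledown mC_n)$. Then $G$ and its complement $\overline{G}$ are perfect if and only if $n$ is even or $n=3$.
   Context: All graphs are finite, simple and undirected. $K_w$ is the complete graph on $w$ vertices, $C_n$ is the cycle on $n$ vertices, $mC_n$ is the disjoint union of $m$ copies of $C_n$, and the join $G\bigtriangledown H$ is obtained from the disjoint union of $G$ and $H$ by joining every vertex of $G$ to every vertex of $H$. $\operatorname{Spec}_L(G)$ denotes the multiset of eigenvalues (with multiplicities) of the Laplacian matrix $L(G)=D(G)-A(G)$, where $A(G)$ is the adjacency matrix and $D(G)$ the diagonal matrix of vertex degrees. A graph is perfect if every induced subgraph has chromatic number equal to its clique number; equivalently, it contains neither an odd cycle of length at least $5$ nor the complement of such a cycle as an induced subgraph. *)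

theory Defs
  imports
    Complex_Main
    "Graph_Theory.Pair_Digraph"
    "Graph_Theory.Digraph_Component"
    "Jordan_Normal_Form.Char_Poly"
    "HOL-Computational_Algebra.Fundamental_Theorem_Algebra"
begin

text \<open>
  Finite simple undirected graphs are the graphs of the locale \<open>pair_graph\<close>: finite, loopfree,
  and with a symmetric arc relation \<open>parcs\<close>, so that an edge \<open>uv\<close> is the pair of arcs
  \<open>(u, v)\<close> and \<open>(v, u)\<close>.
\<close>

definition complement_graph :: "'a pair_pre_digraph \<Rightarrow> 'a pair_pre_digraph" where
  "complement_graph G = \<lparr> pverts = pverts G,
     parcs = {(u, v). u \<in> pverts G \<and> v \<in> pverts G \<and> u \<noteq> v \<and> (u, v) \<notin> parcs G} \<rparr>"

definition complete_graph :: "nat \<Rightarrow> nat pair_pre_digraph" where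
  "complete_graph w = \<lparr> pverts = {..<w}, parcs = {(u, v). u < w \<and> v < w \<and> u \<noteq> v} \<rparr>"

text \<open>For \<open>n < 3\<close> the following is not a cycle (for \<open>n = 1\<close> it even has a loop).\<close>

definition cycle_graph :: "nat \<Rightarrow> nat pair_pre_digraph" where
  "cycle_graph n = \<lparr> pverts = {..<n},
     parcs = {(u, v). u < n \<and> v < n \<and> (v = Suc u mod n \<or> u = Suc v mod n)} \<rparr>"

definition graph_copies :: "nat \<Rightarrow> 'a pair_pre_digraph \<Rightarrow> (nat \<times> 'a) pair_pre_digraph" where
  "graph_copies m G = \<lparr> pverts = {..<m} \<times> pverts G,
     parcs = {((i, u), (j, v)) | i j u v. i < m \<and> i = j \<and> (u, v) \<in> parcs G} \<rparr>"

definition graph_join ::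
  "'a pair_pre_digraph \<Rightarrow> 'b pair_pre_digraph \<Rightarrow> ('a + 'b) pair_pre_digraph" where
  "graph_join G H = \<lparr> pverts = pverts G <+> pverts H,
     parcs = {(Inl u, Inl v) | u v. (u, v) \<in> parcs G}
           \<union> {(Inr x, Inr y) | x y. (x, y) \<in> parcs H}
           \<union> {(Inl u, Inr x) | u x. u \<in> pverts G \<and> x \<in> pverts H}
           \<union> {(Inr x, Inl u) | x u. x \<in> pverts H \<and> u \<in> pverts G} \<rparr>"

text \<open>Matrices are indexed by natural numbers, so an enumeration \<open>vs\<close> of the vertices is needed.\<close>

definition adjacency_matrix :: "'a pair_pre_digraph \<Rightarrow> 'a list \<Rightarrow> real mat" where
  "adjacency_matrix G vs = mat (length vs) (length vs)
     (\<lambda>(i, j). if (vs ! i, vs ! j) \<in> parcs G then 1 else 0)"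

definition degree_matrix :: "'a pair_pre_digraph \<Rightarrow> 'a list \<Rightarrow> real mat" where
  "degree_matrix G vs = mat (length vs) (length vs)
     (\<lambda>(i, j). if i = j then real (out_degree (with_proj G) (vs ! i)) else 0)"

definition laplacian_matrix :: "'a pair_pre_digraph \<Rightarrow> 'a list \<Rightarrow> real mat" where
  "laplacian_matrix G vs = degree_matrix G vs - adjacency_matrix G vs"

definition vertex_enum :: "'a pair_pre_digraph \<Rightarrow> 'a list" where
  "vertex_enum G = (SOME vs. distinct vs \<and> set vs = pverts G)"

text \<open>
  The eigenvalues are the roots of the characteristic polynomial, counted with multiplicity. They
  are taken in the complex numbers, although all of them are real because the matrix is symmetric.
\<close>

definition matrix_spectrum :: "real mat \<Rightarrow> complex multiset" where
  "matrix_spectrum A = proots (char_poly (map_mat complex_of_real A))"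

definition laplacian_spectrum :: "'a pair_pre_digraph \<Rightarrow> complex multiset" where
  "laplacian_spectrum G = matrix_spectrum (laplacian_matrix G (vertex_enum G))"

text \<open>The Laplacian spectrum does not depend on the chosen enumeration of the vertices.\<close>

lemma char_poly_reindex:
  fixes A :: "'a :: field mat"
  assumes A: "A \<in> carrier_mat n n" and p: "bij_betw p {..<n} {..<n}"
  shows "char_poly (mat n n (\<lambda>(i, j). A $$ (p i, p j))) = char_poly A"
proof -
  define P where "P = mat n n (\<lambda>(i, j). if j = p i then 1 else (0 :: 'a))"
  define Q where "Q = mat n n (\<lambda>(i, j). if i = p j then 1 else (0 :: 'a))"
  have lt: "p i < n" if "i < n" for i
    using p that by (auto simp: bij_betw_def)
  have inj: "p i = p j \<longleftrightarrow> i = j" if "i < n" "j < n" for i j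
    using p that by (auto simp: bij_betw_def inj_on_def)
  have c: "P \<in> carrier_mat n n" "Q \<in> carrier_mat n n"
    by (auto simp: P_def Q_def)
  have PQ: "P * Q = 1\<^sub>m n"
    by (rule eq_matI) (auto simp: P_def Q_def scalar_prod_def lt inj if_distrib[of "\<lambda>x. x * _"] cong: if_cong)
  hence QP: "Q * P = 1\<^sub>m n"
    by (rule mat_mult_left_right_inverse[OF c])
  have PA: "P * A = mat n n (\<lambda>(i, j). A $$ (p i, j))"
    using A by (intro eq_matI)
      (auto simp: P_def scalar_prod_def lt if_distrib[of "\<lambda>x. x * _"] cong: if_cong)
  have "mat n n (\<lambda>(i, j). A $$ (p i, p j)) = P * A * Q"
    unfolding PA by (intro eq_matI)
      (auto simp: Q_def scalar_prod_def lt if_distrib[of "\<lambda>x. _ * x"] cong: if_cong)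
  hence "similar_mat_wit (mat n n (\<lambda>(i, j). A $$ (p i, p j))) A P Q"
    using A c PQ QP by (intro similar_mat_witI) auto
  thus ?thesis
    by (intro char_poly_similar) (auto simp: similar_mat_def)
qed

lemma laplacian_spectrum_enum:
  assumes "distinct vs" "set vs = pverts G"
  shows "laplacian_spectrum G = matrix_spectrum (laplacian_matrix G vs)"
proof -
  define us where "us = vertex_enum G"
  have us: "distinct us" "set us = pverts G"
    using someI[of "\<lambda>vs. distinct vs \<and> set vs = pverts G" vs] assms
    by (auto simp: us_def vertex_enum_def)
  define n where "n = length vs"
  have len: "length us = n"
    using us assms distinct_card[of us] distinct_card[of vs] by (simp add: n_def)
  obtain p where p: "bij_betw p {..<n} {..<n}" and vu: "\<And>i. i < n \<Longrightarrow> us ! i = vs ! p i"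
  proof -
    have 1: "bij_betw ((!) vs) {..<n} (pverts G)" and 2: "bij_betw ((!) us) {..<n} (pverts G)"
      using assms us len by (auto simp: n_def intro!: bij_betw_nth)
    show thesis
    proof (rule that)
      show "bij_betw (inv_into {..<n} ((!) vs) \<circ> (!) us) {..<n} {..<n}"
        by (rule bij_betw_trans[OF 2 bij_betw_inv_into[OF 1]])
      show "us ! i = vs ! (inv_into {..<n} ((!) vs) \<circ> (!) us) i" if "i < n" for i
        using bij_betw_apply[OF 2, of i] bij_betw_imp_surj_on[OF 1] that
        by (simp add: f_inv_into_f)
    qed
  qed
  have lt: "p i < n" if "i < n" for i
    using p that by (auto simp: bij_betw_def)
  have inj: "p i = p j \<longleftrightarrow> i = j" if "i < n" "j < n" for i j
    using p that by (auto simp: bij_betw_def inj_on_def)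
  let ?L = "map_mat complex_of_real (laplacian_matrix G vs)"
  have L: "?L \<in> carrier_mat n n"
    by (intro carrier_matI)
      (simp_all add: laplacian_matrix_def degree_matrix_def adjacency_matrix_def n_def)
  have "map_mat complex_of_real (laplacian_matrix G us) = mat n n (\<lambda>(i, j). ?L $$ (p i, p j))"
    by (rule eq_matI)
      (auto simp: laplacian_matrix_def degree_matrix_def adjacency_matrix_def len
        n_def[symmetric] lt inj vu)
  thus ?thesis
    unfolding laplacian_spectrum_def matrix_spectrum_def us_def[symmetric]
    using char_poly_reindex[OF L p] by simp
qed

definition proper_coloring :: "'a pair_pre_digraph \<Rightarrow> ('a \<Rightarrow> nat) \<Rightarrow> bool" where
  "proper_coloring G c \<longleftrightarrow> (\<forall>(u, v) \<in> parcs G. c u \<noteq> c v)"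

definition chromatic_number :: "'a pair_pre_digraph \<Rightarrow> nat" where
  "chromatic_number G = (LEAST k. \<exists>c. proper_coloring G c \<and> c ` pverts G \<subseteq> {..<k})"

definition is_clique :: "'a pair_pre_digraph \<Rightarrow> 'a set \<Rightarrow> bool" where
  "is_clique G K \<longleftrightarrow> K \<subseteq> pverts G \<and> (\<forall>u \<in> K. \<forall>v \<in> K. u \<noteq> v \<longrightarrow> (u, v) \<in> parcs G)"

definition clique_number :: "'a pair_pre_digraph \<Rightarrow> nat" where
  "clique_number G = Max {card K | K. is_clique G K}"

definition perfect_graph :: "'a pair_pre_digraph \<Rightarrow> bool" where
  "perfect_graph G \<longleftrightarrow> (\<forall>H :: 'a pair_pre_digraph.
     induced_subgraph (with_proj H) (with_proj G) \<longrightarrow> chromatic_number H = clique_number H)"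

end

theory Submission
  imports
    Defs
    "Jordan_Normal_Form.Jordan_Normal_Form_Existence"
    "Jordan_Normal_Form.Jordan_Normal_Form_Uniqueness"
    "HOL-Combinatorics.List_Permutation"
begin

text \<open>
  Let \<open>F\<close> be the join of \<open>K\<^sub>w\<close> with \<open>m\<close> disjoint copies of \<open>C\<^sub>n\<close>, and put \<open>N = w + m n\<close>. Two real
  symmetric matrices with the same characteristic polynomial are similar, so the Laplacian
  spectrum of \<open>G\<close> yields the dimensions of all eigenspaces of \<open>L(G)\<close> and the traces of \<open>L(G)\<close> and
  \<open>L(G)\<^sup>2\<close>, that is, the sums of the degrees and of their squares. These data are collected in the
  locale \<open>cospectral\<close>.

  An eigenfunction of \<open>G\<close> with eigenvalue \<open>l \<noteq> 0\<close> is an eigenfunction of the complement \<open>D\<close> of \<open>G\<close>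
  with eigenvalue \<open>N - l\<close>. Since \<open>N\<close> has multiplicity at least \<open>w\<close>, the graph \<open>D\<close> has at least \<open>w + 1\<close>
  components. On the other hand \<open>G\<close> has a small nonzero eigenvalue, namely \<open>w\<close> if \<open>m \<ge> 2\<close> and
  \<open>w + 2 - 2 cos (2 pi / n)\<close> if \<open>m = 1\<close>. So \<open>D\<close> has a large eigenvalue, and a Laplacian eigenvalue is
  never larger than the order of a suitable component. If \<open>m \<ge> 2\<close> or \<open>n \<ge> 7\<close>, this gives a component
  \<open>C\<close> with \<open>m n\<close> vertices, and the count of components forces the other \<open>w\<close> vertices to be isolated in
  \<open>D\<close>. Hence \<open>G\<close> is the join of \<open>K\<^sub>w\<close> and the graph \<open>H\<close> induced on \<open>C\<close> (lemma
  \<open>cone_of_large_component\<close>). The degree sums make \<open>H\<close> regular of degree two, the multiplicity of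
  \<open>w\<close> shows that \<open>H\<close> has as many components as \<open>m C\<^sub>n\<close>, and the eigenvalue \<open>w + 4\<close>, which corresponds to
  the eigenvalue \<open>4\<close> of \<open>H\<close>, detects the bipartite components of \<open>H\<close>.

  \<^item> If \<open>n\<close> is even, all \<open>m\<close> components of \<open>H\<close> are bipartite, and a bipartite graph of maximum degree
    two is perfect together with its complement; joining a complete graph preserves this.
  \<^item> If \<open>n = 3\<close>, the \<open>m\<close> components share \<open>3 m\<close> vertices and have at least three each, so they are
    triangles.
  \<^item> If \<open>n \<ge> 5\<close> is odd, no component of \<open>H\<close> is bipartite, and one of them has more than three vertices.
    It has clique number two but is not 2-colourable, so \<open>G\<close> is not perfect.

  The bound on the component is too weak for \<open>m = 1\<close> and \<open>n \<le> 6\<close>. If \<open>n \<le> 4\<close>, then \<open>D\<close> has at most two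
  edges, which is enough. For \<open>n = 5\<close> the structure is as above, because otherwise the degree sums
  are wrong or \<open>w + 3\<close> is an eigenvalue. For \<open>n = 6\<close> it can really fail: with the join symbol
  \<open>\<nabla>\<close>, the graph \<open>2K\<^sub>1 \<nabla> (2K\<^sub>2 \<union> K\<^sub>1)\<close> has the same Laplacian spectrum as \<open>K\<^sub>1 \<nabla> C\<^sub>6\<close>. But then \<open>G\<close> is the join
  of a graph with at most two edges and the complement of such a graph, and it is perfect
  together with its complement (lemma \<open>hexagon_biperfect\<close>).
\<close>

section \<open>Cospectral symmetric real matrices are similar\<close>

definition mtrace :: "real mat \<Rightarrow> real" where
  "mtrace A = (\<Sum>i<dim_row A. A $$ (i, i))"

lemma mtrace_comm:
  assumes "A \<in> carrier_mat n n" "B \<in> carrier_mat n n"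
  shows "mtrace (A * B) = mtrace (B * A)"
proof -
  have "mtrace (A * B) = (\<Sum>i<n. \<Sum>j<n. A $$ (i, j) * B $$ (j, i))"
    using assms by (auto simp: mtrace_def scalar_prod_def atLeast0LessThan intro!: sum.cong)
  also have "\<dots> = (\<Sum>j<n. \<Sum>i<n. B $$ (j, i) * A $$ (i, j))"
    by (subst sum.swap) (simp add: mult.commute)
  also have "\<dots> = mtrace (B * A)"
    using assms by (auto simp: mtrace_def scalar_prod_def atLeast0LessThan intro!: sum.cong)
  finally show ?thesis .
qed

lemma mtrace_similar:
  assumes "similar_mat_wit A B P Q"
  shows "mtrace A = mtrace B" "mtrace (A * A) = mtrace (B * B)"
proof -
  define n where "n = dim_row A"
  have c: "A \<in> carrier_mat n n" "B \<in> carrier_mat n n" "P \<in> carrier_mat n n" "Q \<in> carrier_mat n n"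
    and PQ: "P * Q = 1\<^sub>m n" "Q * P = 1\<^sub>m n" and A: "A = P * B * Q"
    using similar_mat_witD[OF n_def assms] by simp_all
  have tr: "mtrace (P * C * Q) = mtrace C" if C: "C \<in> carrier_mat n n" for C
  proof -
    have "mtrace (P * C * Q) = mtrace (Q * (P * C))"
      using c C by (intro mtrace_comm[where n = n]) auto
    also have "Q * (P * C) = Q * P * C"
      using c C by (simp add: assoc_mult_mat[of Q n n P n C n])
    finally show ?thesis using PQ C by simp
  qed
  show "mtrace A = mtrace B" unfolding A using tr c by blast
  have "A * A = P * (B * B) * Q"
  proof -
    have PB: "P * B \<in> carrier_mat n n" and BQ: "B * Q \<in> carrier_mat n n" and BBQ: "B * (B * Q) \<in> carrier_mat n n"
      using c by auto
    have "A * A = P * B * Q * (P * (B * Q))"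
      unfolding A using assoc_mult_mat[OF c(3) c(2) c(4)] by simp
    also have "\<dots> = P * B * (Q * (P * (B * Q)))"
      by (rule assoc_mult_mat[OF PB c(4)]) (use c BQ in auto)
    also have "Q * (P * (B * Q)) = Q * P * (B * Q)"
      by (rule assoc_mult_mat[OF c(4,3) BQ, symmetric])
    also have "\<dots> = B * Q" using PQ left_mult_one_mat[OF BQ] by simp
    also have "P * B * (B * Q) = P * (B * (B * Q))"
      by (rule assoc_mult_mat[OF c(3,2) BQ])
    also have "B * (B * Q) = B * B * Q"
      by (rule assoc_mult_mat[OF c(2,2,4), symmetric])
    also have "P * (B * B * Q) = P * (B * B) * Q"
      by (rule assoc_mult_mat[OF c(3) _ c(4), symmetric]) (use c in auto)
    finally show ?thesis .
  qed
  thus "mtrace (A * A) = mtrace (B * B)" using tr[of "B * B"] c by simp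
qed

text \<open>
  For an eigenvector \<open>v\<close>, the number \<open>v\<^sup>* A v\<close> equals its own conjugate by symmetry, and it is
  \<open>e\<close> times the positive number \<open>v\<^sup>* v\<close>.
\<close>

lemma symmetric_eigenvalue_real:
  fixes A :: "real mat"
  assumes A: "A \<in> carrier_mat n n" and sym: "\<And>i j. i < n \<Longrightarrow> j < n \<Longrightarrow> A $$ (i, j) = A $$ (j, i)"
    and ev: "eigenvalue (map_mat complex_of_real A) e"
  shows "e \<in> \<real>"
proof -
  obtain v where v: "v \<in> carrier_vec n" "v \<noteq> 0\<^sub>v n"
      and eq: "map_mat complex_of_real A *\<^sub>v v = e \<cdot>\<^sub>v v"
    using ev A unfolding eigenvalue_def eigenvector_def by auto
  have row: "(\<Sum>j<n. complex_of_real (A $$ (i, j)) * v $ j) = e * v $ i" if "i < n" for i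
    using arg_cong[OF eq, of "\<lambda>w. w $ i"] that A v
    by (simp add: scalar_prod_def atLeast0LessThan)
  define S where "S = (\<Sum>i<n. \<Sum>j<n. cnj (v $ i) * (complex_of_real (A $$ (i, j)) * v $ j))"
  define q where "q = (\<Sum>i<n. (cmod (v $ i))\<^sup>2)"
  have "cnj S = (\<Sum>i<n. \<Sum>j<n. v $ i * (complex_of_real (A $$ (i, j)) * cnj (v $ j)))"
    by (simp add: S_def)
  also have "\<dots> = (\<Sum>j<n. \<Sum>i<n. v $ i * (complex_of_real (A $$ (i, j)) * cnj (v $ j)))"
    by (rule sum.swap)
  also have "\<dots> = S"
    unfolding S_def by (intro sum.cong refl) (simp add: sym)
  finally have "S \<in> \<real>" by (simp add: complex_is_Real_iff complex_eq_iff)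
  moreover have "S = e * complex_of_real q"
  proof -
    have "S = (\<Sum>i<n. cnj (v $ i) * (e * v $ i))"
      unfolding S_def by (simp add: sum_distrib_left[symmetric] row)
    also have "\<dots> = e * (\<Sum>i<n. v $ i * cnj (v $ i))"
      by (simp add: sum_distrib_left mult_ac)
    also have "(\<Sum>i<n. v $ i * cnj (v $ i)) = complex_of_real q"
      by (simp add: q_def complex_norm_square[symmetric])
    finally show ?thesis .
  qed
  moreover have "q \<noteq> 0"
  proof
    assume "q = 0"
    hence "\<forall>i<n. v $ i = 0" by (auto simp: q_def sum_nonneg_eq_0_iff)
    hence "v = 0\<^sub>v n" using v by (intro eq_vecI) auto
    thus False using v by simp
  qed
  ultimately have "e = S / complex_of_real q" by simp
  thus ?thesis using \<open>S \<in> \<real>\<close> by (simp add: Reals_divide)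
qed

lemma map_poly_of_real_linear_factors:
  "map_poly complex_of_real (\<Prod>e\<leftarrow>es. [:- e, 1:]) = (\<Prod>e\<leftarrow>map complex_of_real es. [:- e, 1:])"
proof -
  interpret mh: map_poly_inj_comm_ring_hom complex_of_real ..
  show ?thesis by (induction es) (simp_all add: hom_distribs del: mult_pCons_left)
qed

lemma symmetric_char_poly_splits:
  fixes A :: "real mat"
  assumes A: "A \<in> carrier_mat n n" and sym: "\<And>i j. i < n \<Longrightarrow> j < n \<Longrightarrow> A $$ (i, j) = A $$ (j, i)"
  obtains es where "char_poly A = (\<Prod>e\<leftarrow>es. [:- e, 1:])"
proof -
  interpret mh: map_poly_inj_comm_ring_hom complex_of_real ..
  let ?C = "map_mat complex_of_real A"
  have C: "?C \<in> carrier_mat n n" using A by simp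
  obtain as where as: "char_poly ?C = (\<Prod>a\<leftarrow>as. [:- a, 1:])"
    using char_poly_factorized[OF C] by blast
  have "a \<in> \<real>" if "a \<in> set as" for a
  proof (rule symmetric_eigenvalue_real[OF A sym])
    have "poly (char_poly ?C) a = 0"
      unfolding as using that by (induction as) auto
    thus "eigenvalue ?C a" using eigenvalue_root_char_poly[OF C] by simp
  qed
  hence as': "as = map complex_of_real (map Re as)"
    by (simp add: map_idI)
  have "map_poly complex_of_real (char_poly A) = char_poly ?C"
    by (simp add: of_real_hom.char_poly_hom[OF A])
  also have "\<dots> = map_poly complex_of_real (\<Prod>e\<leftarrow>map Re as. [:- e, 1:])"
    unfolding as map_poly_of_real_linear_factors by (subst as') (rule refl)
  finally have "char_poly A = (\<Prod>e\<leftarrow>map Re as. [:- e, 1:])"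
    by simp
  thus thesis by (rule that)
qed

text \<open>
  If \<open>C\<^sup>2 v = 0\<close>, then \<open>Cv \<bullet> Cv = v \<bullet> C\<^sup>2 v = 0\<close>. This excludes generalised eigenvectors of a
  symmetric matrix, so that its Jordan form is diagonal.
\<close>

lemma mat_kernel_square_symmetric:
  fixes C :: "real mat"
  assumes C: "C \<in> carrier_mat n n" and sym: "\<And>i j. i < n \<Longrightarrow> j < n \<Longrightarrow> C $$ (i, j) = C $$ (j, i)"
  shows "mat_kernel (C * C) = mat_kernel C"
proof -
  have T: "transpose_mat C = C" using C sym by (intro eq_matI) auto
  have "C *\<^sub>v v = 0\<^sub>v n" if v: "v \<in> carrier_vec n" and 0: "C * C *\<^sub>v v = 0\<^sub>v n" for v
  proof -
    have Cv: "C *\<^sub>v v \<in> carrier_vec n" using C v by simp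
    have "(C *\<^sub>v v) \<bullet> (C *\<^sub>v v) = v \<bullet> (C *\<^sub>v (C *\<^sub>v v))"
      using transpose_vec_mult_scalar[OF C v Cv] comm_scalar_prod[of "C *\<^sub>v (C *\<^sub>v v)" n v] v Cv C
      by (simp add: T)
    also have "C *\<^sub>v (C *\<^sub>v v) = 0\<^sub>v n" using 0 C v by simp
    finally have "(C *\<^sub>v v) \<bullet> (C *\<^sub>v v) = 0" using v by simp
    hence "(\<Sum>i<n. ((C *\<^sub>v v) $ i)\<^sup>2) = 0"
      using C by (simp add: scalar_prod_def atLeast0LessThan power2_eq_square)
    hence "\<forall>i<n. (C *\<^sub>v v) $ i = 0" by (simp add: sum_nonneg_eq_0_iff)
    thus ?thesis using C by (intro eq_vecI) auto
  qed
  thus ?thesis using C unfolding mat_kernel_def by (auto simp: assoc_mult_mat_vec[of C n n C n])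
qed

text \<open>
  Each Jordan block of size \<open>k\<close> for \<open>e\<close> contributes \<open>min j k\<close> to the dimension of the kernel of
  \<open>(A - e)\<^sup>j\<close>. The kernels for \<open>j = 1\<close> and \<open>j = 2\<close> coincide.
\<close>

lemma symmetric_jordan_blocks:
  fixes A :: "real mat"
  assumes A: "A \<in> carrier_mat n n" and sym: "\<And>i j. i < n \<Longrightarrow> j < n \<Longrightarrow> A $$ (i, j) = A $$ (j, i)"
    and jnf: "jordan_nf A n_as"
  shows "\<forall>(k, e) \<in> set n_as. k = 1"
proof safe
  fix k e assume ke: "(k, e) \<in> set n_as"
  let ?C = "char_matrix A e"
  let ?ks = "map fst [(n, e')\<leftarrow>n_as. e' = e]"
  have C: "?C \<in> carrier_mat n n" using A by simp
  have "?C $$ (i, j) = ?C $$ (j, i)" if "i < n" "j < n" for i j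
    using that A sym[OF that] by (auto simp: char_matrix_def)
  hence "mat_kernel (?C * ?C) = mat_kernel ?C"
    by (rule mat_kernel_square_symmetric[OF C])
  hence "kernel_dim (?C * ?C) = kernel_dim ?C"
    using C by (simp add: kernel_dim_def)
  moreover have "?C ^\<^sub>m 1 = ?C" "?C ^\<^sub>m 2 = ?C * ?C"
    using C by (simp_all add: numeral_2_eq_2)
  ultimately have "dim_gen_eigenspace A e 2 = dim_gen_eigenspace A e 1"
    by (simp add: dim_gen_eigenspace_def)
  hence eq: "(\<Sum>n\<leftarrow>?ks. min 2 n) = (\<Sum>n\<leftarrow>?ks. min 1 n)"
    unfolding dim_gen_eigenspace[OF jnf] .
  have k: "k \<in> set ?ks" using ke by force
  have "k \<noteq> 0" using jnf ke by (force simp: jordan_nf_def)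
  have le1: "\<forall>k\<in>set ks. k \<le> 1"
    if "(\<Sum>n\<leftarrow>ks. min 2 n) = (\<Sum>n\<leftarrow>ks. min 1 n)" for ks :: "nat list"
    using that
  proof (induction ks)
    case (Cons a ks)
    have "(\<Sum>n\<leftarrow>ks. min 1 n) \<le> (\<Sum>n\<leftarrow>ks. min 2 n)"
      by (rule sum_list_mono) simp
    with Cons.prems have "min 2 a \<le> min 1 a" "(\<Sum>n\<leftarrow>ks. min 2 n) = (\<Sum>n\<leftarrow>ks. min 1 n)"
      by (simp_all add: min_def split: if_splits)
    with Cons.IH show ?case by (simp add: min_def split: if_splits)
  qed auto
  from le1[OF eq] k \<open>k \<noteq> 0\<close> show "k = 1" by (metis le_antisym less_one not_le)
qed

definition diagonal :: "real list \<Rightarrow> real mat" where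
  "diagonal es = mat (length es) (length es) (\<lambda>(i, j). if i = j then es ! i else 0)"

lemma jordan_matrix_eq_diagonal:
  assumes "\<forall>(k, e) \<in> set n_as. k = 1"
  shows "jordan_matrix n_as = diagonal (map snd n_as)"
  using assms
proof (induction n_as)
  case Nil
  show ?case by (auto simp: jordan_matrix_def diagonal_def)
next
  case (Cons a n_as)
  obtain e where a: "a = (1, e)" using Cons.prems by (cases a) auto
  have len: "sum_list (map fst n_as) = length n_as"
    using Cons.prems by (induction n_as) auto
  have dim: "dim_row (jordan_matrix n_as) = length n_as" "dim_col (jordan_matrix n_as) = length n_as"
    by (simp_all add: len)
  have "jordan_matrix (a # n_as) = four_block_mat (jordan_block 1 e) (0\<^sub>m 1 (length n_as))
      (0\<^sub>m (length n_as) 1) (jordan_matrix n_as)"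
    using dim by (simp add: jordan_matrix_def a Let_def)
  also have "\<dots> = diagonal (map snd (a # n_as))"
    using Cons by (intro eq_matI) (auto simp: diagonal_def a nth_Cons' len)
  finally show ?case .
qed

text \<open>
  Conjugation by a permutation matrix. It is needed because Jordan forms of two matrices may list
  the common eigenvalues in different orders.
\<close>

lemma similar_diagonal_permute:
  assumes "mset es = mset fs"
  shows "similar_mat (diagonal es) (diagonal fs)"
proof -
  define n where "n = length es"
  have len: "length fs = n" using assms by (metis n_def size_mset)
  obtain p where p: "bij_betw p {..<n} {..<n}" and ef: "\<And>i. i < n \<Longrightarrow> es ! i = fs ! p i"
    using permutation_Ex_bij[OF assms] len n_def by auto
  have lt: "p i < n" if "i < n" for i
    using p that by (auto simp: bij_betw_def)
  have inj: "p i = p j \<longleftrightarrow> i = j" if "i < n" "j < n" for i j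
    using p that by (auto simp: bij_betw_def inj_on_def)
  define P where "P = mat n n (\<lambda>(i, j). if j = p i then 1 else (0 :: real))"
  define Q where "Q = mat n n (\<lambda>(i, j). if i = p j then 1 else (0 :: real))"
  have c: "P \<in> carrier_mat n n" "Q \<in> carrier_mat n n" "diagonal es \<in> carrier_mat n n"
      "diagonal fs \<in> carrier_mat n n"
    by (auto simp: P_def Q_def diagonal_def n_def len[unfolded n_def])
  have PQ: "P * Q = 1\<^sub>m n"
    by (rule eq_matI) (auto simp: P_def Q_def scalar_prod_def lt inj if_distrib[of "\<lambda>x. x * _"] cong: if_cong)
  hence QP: "Q * P = 1\<^sub>m n"
    by (rule mat_mult_left_right_inverse[OF c(1,2)])
  have PA: "P * diagonal fs = mat n n (\<lambda>(i, j). if p i = j then fs ! j else 0)"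
    by (intro eq_matI)
      (auto simp: P_def diagonal_def len scalar_prod_def lt if_distrib[of "\<lambda>x. x * _"] cong: if_cong)
  have "diagonal es = P * diagonal fs * Q"
    unfolding PA by (intro eq_matI)
      (auto simp: Q_def diagonal_def n_def[symmetric] ef inj scalar_prod_def lt if_distrib[of "\<lambda>x. _ * x"] cong: if_cong)
  hence "similar_mat_wit (diagonal es) (diagonal fs) P Q"
    using c PQ QP by (intro similar_mat_witI) auto
  thus ?thesis by (auto simp: similar_mat_def)
qed

lemma symmetric_similar_diagonal:
  fixes A :: "real mat"
  assumes A: "A \<in> carrier_mat n n" and sym: "\<And>i j. i < n \<Longrightarrow> j < n \<Longrightarrow> A $$ (i, j) = A $$ (j, i)"
  obtains es where "similar_mat A (diagonal es)" "char_poly A = (\<Prod>e\<leftarrow>es. [:- e, 1:])"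
proof -
  obtain as where "char_poly A = (\<Prod>e\<leftarrow>as. [:- e, 1:])"
    using symmetric_char_poly_splits[OF A sym] by blast
  then obtain n_as where jnf: "jordan_nf A n_as"
    using jordan_nf_exists[OF A] by blast
  have 1: "\<forall>(k, e) \<in> set n_as. k = 1"
    by (rule symmetric_jordan_blocks[OF A sym jnf])
  have "char_poly A = (\<Prod>(k, e)\<leftarrow>n_as. [:- e, 1:] ^ k)"
    by (rule jordan_nf_char_poly[OF jnf])
  also have "(\<lambda>(k, e). [:- e, 1:] ^ k) x = [:- snd x, 1:]" if "x \<in> set n_as" for x
    using 1 that by auto
  hence "(\<Prod>(k, e)\<leftarrow>n_as. [:- e, 1:] ^ k) = (\<Prod>e\<leftarrow>map snd n_as. [:- e, 1:])"
    by (simp add: o_def cong: map_cong)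
  finally show thesis
    using that[of "map snd n_as"] jnf jordan_matrix_eq_diagonal[OF 1] by (simp add: jordan_nf_def)
qed

lemma symmetric_cospectral_similar:
  fixes A B :: "real mat"
  assumes A: "A \<in> carrier_mat n n" and symA: "\<And>i j. i < n \<Longrightarrow> j < n \<Longrightarrow> A $$ (i, j) = A $$ (j, i)"
    and B: "B \<in> carrier_mat k k" and symB: "\<And>i j. i < k \<Longrightarrow> j < k \<Longrightarrow> B $$ (i, j) = B $$ (j, i)"
    and spec: "matrix_spectrum A = matrix_spectrum B"
  shows "similar_mat A B"
proof -
  obtain es where es: "similar_mat A (diagonal es)" "char_poly A = (\<Prod>e\<leftarrow>es. [:- e, 1:])"
    using symmetric_similar_diagonal[OF A symA] .
  obtain fs where fs: "similar_mat B (diagonal fs)" "char_poly B = (\<Prod>e\<leftarrow>fs. [:- e, 1:])"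
    using symmetric_similar_diagonal[OF B symB] .
  have roots: "matrix_spectrum C = image_mset complex_of_real (mset gs)"
    if C: "C \<in> carrier_mat l l" and gs: "char_poly C = (\<Prod>e\<leftarrow>gs. [:- e, 1:])" for C l gs
  proof -
    have "char_poly (map_mat complex_of_real C) = (\<Prod>e\<leftarrow>map complex_of_real gs. [:- e, 1:])"
      by (simp only: of_real_hom.char_poly_hom[OF C] gs map_poly_of_real_linear_factors)
    hence "matrix_spectrum C = proots (\<Prod>e\<leftarrow>map complex_of_real gs. [:- e, 1:])"
      by (simp add: matrix_spectrum_def)
    also have "\<dots> = mset (map complex_of_real gs)"
    proof (induction gs)
      case (Cons g gs)
      have "(\<Prod>e\<leftarrow>map complex_of_real gs. [:- e, 1:]) \<noteq> 0"
        by (auto simp: prod_list_zero_iff)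
      with Cons show ?case by (simp add: proots_mult del: mult_pCons_left)
    qed simp
    finally show ?thesis by simp
  qed
  have "mset es = mset fs"
    using spec roots[OF A es(2)] roots[OF B fs(2)] multiset.inj_map[of complex_of_real]
    by (auto simp: inj_def)
  hence "similar_mat (diagonal es) (diagonal fs)" by (rule similar_diagonal_permute)
  thus ?thesis using es(1) fs(1) by (meson similar_mat_sym similar_mat_trans)
qed

section \<open>Graph invariants determined by the Laplacian spectrum\<close>

locale simple_graph =
  fixes V :: "'a set" and E :: "('a \<times> 'a) set"
  assumes finite_V: "finite V"
    and E_sub: "E \<subseteq> V \<times> V"
    and E_sym: "(u, v) \<in> E \<Longrightarrow> (v, u) \<in> E"
    and E_irrefl: "(u, u) \<notin> E"
begin

lemma finite_nbrs [simp]: "finite (E `` {u})"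
  by (rule finite_subset[OF _ finite_V]) (use E_sub in auto)

lemma finite_E [simp]: "finite E"
  using finite_subset[OF E_sub] finite_V by simp

lemma E_in: "(u, v) \<in> E \<Longrightarrow> u \<in> V" "(u, v) \<in> E \<Longrightarrow> v \<in> V"
  using E_sub by auto

end

definition deg :: "('a \<times> 'a) set \<Rightarrow> 'a \<Rightarrow> nat" where
  "deg E u = card (E `` {u})"

text \<open>
  The Laplacian as an operator on functions on the vertices, without an enumeration of them.
\<close>

definition lap :: "('a \<times> 'a) set \<Rightarrow> ('a \<Rightarrow> real) \<Rightarrow> 'a \<Rightarrow> real" where
  "lap E x u = (\<Sum>v\<in>E `` {u}. x u - x v)"

definition eigenfunction :: "'a set \<Rightarrow> ('a \<times> 'a) set \<Rightarrow> real \<Rightarrow> ('a \<Rightarrow> real) \<Rightarrow> bool" where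
  "eigenfunction V E l x \<longleftrightarrow> (\<forall>u\<in>V. lap E x u = l * x u)"

definition independent_on :: "'a set \<Rightarrow> nat \<Rightarrow> (nat \<Rightarrow> 'a \<Rightarrow> real) \<Rightarrow> bool" where
  "independent_on V k x \<longleftrightarrow> (\<forall>c. (\<forall>u\<in>V. (\<Sum>i<k. c i * x i u) = 0) \<longrightarrow> (\<forall>i<k. c i = 0))"

text \<open>
  A lower bound for the dimension of an eigenspace, which for a symmetric matrix is the multiplicity
  of the eigenvalue as a root of the characteristic polynomial. Stated with explicit families of
  functions, it can be transported along a similarity of matrices and compared between graphs with
  different types of vertices.
\<close>

definition multiplicity_ge :: "'a set \<Rightarrow> ('a \<times> 'a) set \<Rightarrow> real \<Rightarrow> nat \<Rightarrow> bool" where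
  "multiplicity_ge V E l k \<longleftrightarrow> (\<exists>x. (\<forall>i<k. eigenfunction V E l (x i)) \<and> independent_on V k x)"

lemma pair_graph_simple_graph:
  assumes "pair_graph G"
  shows "simple_graph (pverts G) (parcs G)"
proof -
  interpret pair_graph G by fact
  show ?thesis
  proof
    show "(v, u) \<in> parcs G" if "(u, v) \<in> parcs G" for u v
      using pair_sym_arcs that by (auto simp: symmetric_def symD)
  qed (auto simp: pair_finite_verts dest: in_arcsD1 in_arcsD2 no_loops')
qed

lemma out_degree_eq_deg: "out_degree (with_proj G) u = deg (parcs G) u"
proof -
  have "out_arcs (with_proj G) u = Pair u ` (parcs G `` {u})"
    by (auto simp: out_arcs_def)
  thus ?thesis
    by (simp add: out_degree_def deg_def card_image inj_on_def)
qed

lemma vertex_enum: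
  assumes "finite (pverts G)"
  shows "distinct (vertex_enum G)" "set (vertex_enum G) = pverts G"
proof -
  have "\<exists>vs. distinct vs \<and> set vs = pverts G"
    using finite_distinct_list[OF assms] by blast
  hence "distinct (vertex_enum G) \<and> set (vertex_enum G) = pverts G"
    unfolding vertex_enum_def by (rule someI_ex)
  thus "distinct (vertex_enum G)" "set (vertex_enum G) = pverts G" by simp_all
qed

lemma laplacian_matrix_carrier [simp]:
  "laplacian_matrix G vs \<in> carrier_mat (length vs) (length vs)"
  "dim_row (laplacian_matrix G vs) = length vs" "dim_col (laplacian_matrix G vs) = length vs"
  by (auto simp: laplacian_matrix_def degree_matrix_def adjacency_matrix_def intro!: carrier_matI)

lemma laplacian_matrix_nth:
  assumes "i < length vs" "j < length vs"
  shows "laplacian_matrix G vs $$ (i, j) =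
    (if i = j then real (deg (parcs G) (vs ! i)) else 0) - (if (vs ! i, vs ! j) \<in> parcs G then 1 else 0)"
  using assms
  by (simp add: laplacian_matrix_def degree_matrix_def adjacency_matrix_def out_degree_eq_deg)

context
  fixes G :: "'a pair_pre_digraph" and vs :: "'a list"
  assumes G: "simple_graph (pverts G) (parcs G)"
    and vs: "distinct vs" "set vs = pverts G"
begin

interpretation simple_graph "pverts G" "parcs G" by (rule G)

lemma sum_enum: "(\<Sum>i<length vs. f (vs ! i)) = (\<Sum>u\<in>pverts G. f u)"
  by (rule sum.reindex_bij_betw[OF bij_betw_nth[OF vs(1) refl vs(2)[symmetric]]])

lemma sum_nbrs: "(\<Sum>v\<in>pverts G. if (u, v) \<in> parcs G then f v else 0) = (\<Sum>v\<in>parcs G `` {u}. f v)"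
  for f :: "'a \<Rightarrow> real"
proof -
  have "parcs G `` {u} = {v \<in> pverts G. (u, v) \<in> parcs G}"
    using E_in by auto
  thus ?thesis by (simp add: sum.inter_filter[OF finite_V])
qed

lemma laplacian_matrix_symmetric:
  assumes "i < length vs" "j < length vs"
  shows "laplacian_matrix G vs $$ (i, j) = laplacian_matrix G vs $$ (j, i)"
  using E_sym by (auto simp: laplacian_matrix_nth assms)

lemma laplacian_matrix_row:
  assumes "i < length vs"
  shows "(\<Sum>j<length vs. laplacian_matrix G vs $$ (i, j) * x (vs ! j)) = lap (parcs G) x (vs ! i)"
proof -
  have mem: "vs ! i \<in> pverts G" using nth_mem[OF assms] vs(2) by simp
  have "(\<Sum>j<length vs. laplacian_matrix G vs $$ (i, j) * x (vs ! j))
      = (\<Sum>j<length vs. (if vs ! i = vs ! j then real (deg (parcs G) (vs ! i)) * x (vs ! j) else 0)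
          - (if (vs ! i, vs ! j) \<in> parcs G then x (vs ! j) else 0))"
    using assms vs by (intro sum.cong) (auto simp: laplacian_matrix_nth nth_eq_iff_index_eq algebra_simps)
  also have "\<dots> = (\<Sum>v\<in>pverts G. (if vs ! i = v then real (deg (parcs G) (vs ! i)) * x v else 0)
          - (if (vs ! i, v) \<in> parcs G then x v else 0))"
    by (rule sum_enum)
  also have "\<dots> = real (deg (parcs G) (vs ! i)) * x (vs ! i) - (\<Sum>v\<in>parcs G `` {vs ! i}. x v)"
    using mem by (simp add: sum_subtractf finite_V sum_nbrs)
  also have "\<dots> = lap (parcs G) x (vs ! i)"
    by (simp add: lap_def sum_subtractf deg_def)
  finally show ?thesis .
qed

text \<open>
  The off-diagonal entries of \<open>L\<close> contribute one for each arc to the trace of \<open>L\<^sup>2\<close>.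
\<close>

lemma laplacian_matrix_trace:
  "mtrace (laplacian_matrix G vs) = real (\<Sum>u\<in>pverts G. deg (parcs G) u)"
  "mtrace (laplacian_matrix G vs * laplacian_matrix G vs)
     = real (\<Sum>u\<in>pverts G. (deg (parcs G) u)\<^sup>2 + deg (parcs G) u)"
proof -
  let ?L = "laplacian_matrix G vs" and ?n = "length vs"
  show "mtrace ?L = real (\<Sum>u\<in>pverts G. deg (parcs G) u)"
    by (simp add: mtrace_def laplacian_matrix_nth E_irrefl sum_enum[of "\<lambda>u. real (deg (parcs G) u)"])
  have "mtrace (?L * ?L) = (\<Sum>i<?n. \<Sum>j<?n. ?L $$ (i, j) * ?L $$ (j, i))"
    by (auto simp: mtrace_def scalar_prod_def atLeast0LessThan intro!: sum.cong)
  also have "\<dots> = (\<Sum>i<?n. real ((deg (parcs G) (vs ! i))\<^sup>2 + deg (parcs G) (vs ! i)))"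
  proof (rule sum.cong)
    fix i assume "i \<in> {..<?n}"
    hence i: "i < ?n" by simp
    have mem: "vs ! i \<in> pverts G" using nth_mem[OF i] vs(2) by simp
    have "(\<Sum>j<?n. ?L $$ (i, j) * ?L $$ (j, i)) =
       (\<Sum>j<?n. (if vs ! i = vs ! j then real (deg (parcs G) (vs ! i)) ^ 2 else 0)
          + (if (vs ! i, vs ! j) \<in> parcs G then 1 else 0))"
      using i vs E_sym
      by (intro sum.cong) (auto simp: laplacian_matrix_nth nth_eq_iff_index_eq E_irrefl power2_eq_square)
    also have "\<dots> = (\<Sum>v\<in>pverts G. (if vs ! i = v then real (deg (parcs G) (vs ! i)) ^ 2 else 0)
          + (if (vs ! i, v) \<in> parcs G then 1 else 0))"
      by (rule sum_enum)
    also have "\<dots> = real ((deg (parcs G) (vs ! i))\<^sup>2 + deg (parcs G) (vs ! i))"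
      using mem by (simp add: sum.distrib finite_V sum_nbrs deg_def)
    finally show "(\<Sum>j<?n. ?L $$ (i, j) * ?L $$ (j, i)) = real ((deg (parcs G) (vs ! i))\<^sup>2 + deg (parcs G) (vs ! i))" .
  qed simp
  also have "\<dots> = real (\<Sum>u\<in>pverts G. (deg (parcs G) u)\<^sup>2 + deg (parcs G) u)"
    unfolding of_nat_sum by (rule sum_enum)
  finally show "mtrace (?L * ?L) = real (\<Sum>u\<in>pverts G. (deg (parcs G) u)\<^sup>2 + deg (parcs G) u)" .
qed

end

lemma cospectral_similar:
  assumes G: "simple_graph (pverts G) (parcs G)" and H: "simple_graph (pverts H) (parcs H)"
    and spec: "laplacian_spectrum G = laplacian_spectrum H"
  shows "similar_mat (laplacian_matrix G (vertex_enum G)) (laplacian_matrix H (vertex_enum H))"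
  using spec unfolding laplacian_spectrum_def
  by (intro symmetric_cospectral_similar[where n = "length (vertex_enum G)" and k = "length (vertex_enum H)"])
     (auto intro!: laplacian_matrix_symmetric[OF G] laplacian_matrix_symmetric[OF H]
       vertex_enum simple_graph.finite_V[OF G] simple_graph.finite_V[OF H])

lemma cospectral_invariants:
  assumes G: "simple_graph (pverts G) (parcs G)" and H: "simple_graph (pverts H) (parcs H)"
    and spec: "laplacian_spectrum G = laplacian_spectrum H"
  shows "card (pverts G) = card (pverts H)"
    and "(\<Sum>u\<in>pverts G. deg (parcs G) u) = (\<Sum>u\<in>pverts H. deg (parcs H) u)"
    and "(\<Sum>u\<in>pverts G. (deg (parcs G) u)\<^sup>2) = (\<Sum>u\<in>pverts H. (deg (parcs H) u)\<^sup>2)"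
proof -
  let ?g = "vertex_enum G" and ?h = "vertex_enum H"
  note g = vertex_enum[OF simple_graph.finite_V[OF G]] and h = vertex_enum[OF simple_graph.finite_V[OF H]]
  obtain P Q where wit: "similar_mat_wit (laplacian_matrix G ?g) (laplacian_matrix H ?h) P Q"
    using cospectral_similar[OF G H spec] by (auto simp: similar_mat_def)
  have "length ?h = length ?g"
    using carrier_matD(1)[OF similar_mat_witD(5)[OF refl wit]] by simp
  thus "card (pverts G) = card (pverts H)"
    using distinct_card[OF g(1)] distinct_card[OF h(1)] g(2) h(2) by simp
  show 1: "(\<Sum>u\<in>pverts G. deg (parcs G) u) = (\<Sum>u\<in>pverts H. deg (parcs H) u)"
    using mtrace_similar(1)[OF wit]
    unfolding laplacian_matrix_trace(1)[OF G g] laplacian_matrix_trace(1)[OF H h] of_nat_eq_iff .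
  show "(\<Sum>u\<in>pverts G. (deg (parcs G) u)\<^sup>2) = (\<Sum>u\<in>pverts H. (deg (parcs H) u)\<^sup>2)"
    using mtrace_similar(2)[OF wit] 1
    unfolding laplacian_matrix_trace(2)[OF G g] laplacian_matrix_trace(2)[OF H h] of_nat_eq_iff sum.distrib
    by linarith
qed

text \<open>
  If \<open>L(G) = P L(H) P\<^sup>-\<^sup>1\<close>, then \<open>P\<close> maps a family of independent eigenvectors of \<open>L(H)\<close> to such a
  family for \<open>L(G)\<close>. In the proof \<open>z\<close>, \<open>y\<close> are these vectors and \<open>Y\<close> the resulting functions on the
  vertices of \<open>G\<close>.
\<close>

lemma cospectral_multiplicity_ge:
  assumes G: "simple_graph (pverts G) (parcs G)" and H: "simple_graph (pverts H) (parcs H)"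
    and spec: "laplacian_spectrum G = laplacian_spectrum H"
    and mult: "multiplicity_ge (pverts H) (parcs H) l k"
  shows "multiplicity_ge (pverts G) (parcs G) l k"
proof -
  define g where "g = vertex_enum G"
  define h where "h = vertex_enum H"
  have g: "distinct g" "set g = pverts G" and h: "distinct h" "set h = pverts H"
    using vertex_enum[of G] vertex_enum[of H] simple_graph.finite_V[OF G] simple_graph.finite_V[OF H]
    by (auto simp: g_def h_def)
  define A where "A = laplacian_matrix G g"
  define B where "B = laplacian_matrix H h"
  define n where "n = length g"
  obtain P Q where wit: "similar_mat_wit A B P Q"
    using cospectral_similar[OF G H spec] by (auto simp: similar_mat_def A_def B_def g_def h_def)
  have dim: "n = dim_row A" by (simp add: A_def n_def)
  have c: "A \<in> carrier_mat n n" "B \<in> carrier_mat n n" "P \<in> carrier_mat n n" "Q \<in> carrier_mat n n"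
    and PQ: "P * Q = 1\<^sub>m n" "Q * P = 1\<^sub>m n" and A: "A = P * B * Q"
    using similar_mat_witD[OF dim wit] by simp_all
  have len: "length h = n" using carrier_matD(1)[OF c(2)] by (simp add: B_def)
  obtain x where x: "\<And>i. i < k \<Longrightarrow> eigenfunction (pverts H) (parcs H) l (x i)"
    and ind: "independent_on (pverts H) k x"
    using mult by (auto simp: multiplicity_ge_def)
  define z where "z i = vec n (\<lambda>b. x i (h ! b))" for i
  have z: "z i \<in> carrier_vec n" for i by (simp add: z_def)
  have Bz: "B *\<^sub>v z i = l \<cdot>\<^sub>v z i" if "i < k" for i
  proof (rule eq_vecI)
    fix b assume "b < dim_vec (l \<cdot>\<^sub>v z i)"
    hence b: "b < length h" by (simp add: z_def len)
    have "(B *\<^sub>v z i) $ b = lap (parcs H) (x i) (h ! b)"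
      using laplacian_matrix_row[OF H h b, of "x i"] c(2) b len
      by (simp add: scalar_prod_def z_def atLeast0LessThan B_def)
    also have "\<dots> = l * x i (h ! b)"
      using x[OF that] b h(2) by (auto simp: eigenfunction_def)
    finally show "(B *\<^sub>v z i) $ b = (l \<cdot>\<^sub>v z i) $ b" using b by (simp add: z_def len)
  qed (use c in \<open>simp add: z_def\<close>)
  define y where "y i = P *\<^sub>v z i" for i
  have y: "y i \<in> carrier_vec n" for i using c by (simp add: y_def carrier_vecI)
  have QA: "A * P = P * B"
  proof -
    have "A * P = P * B * (Q * P)"
      unfolding A by (rule assoc_mult_mat[where n\<^sub>4 = n]) (use c in auto)
    thus ?thesis using PQ c right_mult_one_mat[of "P * B" n n] by simp
  qed
  have Ay: "A *\<^sub>v y i = l \<cdot>\<^sub>v y i" if "i < k" for i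
  proof -
    have "A *\<^sub>v y i = (A * P) *\<^sub>v z i"
      unfolding y_def using c z by (simp add: assoc_mult_mat_vec[of A n n P n])
    also have "\<dots> = P *\<^sub>v (B *\<^sub>v z i)"
      unfolding QA using c z by (simp add: assoc_mult_mat_vec[of P n n B n])
    also have "\<dots> = l \<cdot>\<^sub>v y i"
      unfolding Bz[OF that] y_def using c z by (simp add: mult_mat_vec[of P n n])
    finally show ?thesis .
  qed
  define idx where "idx = inv_into {..<n} ((!) g)"
  have idx: "idx (g ! a) = a" if "a < n" for a
    unfolding idx_def using that g(1) by (intro inv_into_f_f) (auto simp: n_def inj_on_nth)
  define Y where "Y i u = y i $ idx u" for i u
  have Y: "Y i (g ! a) = y i $ a" if "a < n" for i a
    using idx[OF that] by (simp add: Y_def)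
  have eig: "eigenfunction (pverts G) (parcs G) l (Y i)" if "i < k" for i
    unfolding eigenfunction_def
  proof
    fix u assume "u \<in> pverts G"
    then obtain a where a: "a < n" "u = g ! a"
      unfolding g(2)[symmetric] n_def by (auto simp: in_set_conv_nth)
    have "lap (parcs G) (Y i) u = (\<Sum>b<n. A $$ (a, b) * y i $ b)"
      using laplacian_matrix_row[OF G g, of a "Y i"] a by (simp add: n_def A_def Y)
    also have "\<dots> = (A *\<^sub>v y i) $ a"
      using c a y[of i] by (simp add: scalar_prod_def atLeast0LessThan)
    also have "\<dots> = l * Y i u"
      unfolding Ay[OF that] using a y[of i] by (simp add: Y)
    finally show "lap (parcs G) (Y i) u = l * Y i u" .
  qed
  have "independent_on (pverts G) k Y"
    unfolding independent_on_def
  proof (rule allI, rule impI)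
    fix d assume 0: "\<forall>u\<in>pverts G. (\<Sum>i<k. d i * Y i u) = 0"
    define s where "s = vec n (\<lambda>b. \<Sum>i<k. d i * x i (h ! b))"
    have "P *\<^sub>v s = 0\<^sub>v n"
    proof (rule eq_vecI)
      fix a assume "a < dim_vec (0\<^sub>v n)"
      hence a: "a < n" by simp
      have "(P *\<^sub>v s) $ a = (\<Sum>b<n. P $$ (a, b) * (\<Sum>i<k. d i * x i (h ! b)))"
        using c a by (simp add: s_def scalar_prod_def atLeast0LessThan)
      also have "\<dots> = (\<Sum>i<k. d i * (\<Sum>b<n. P $$ (a, b) * x i (h ! b)))"
        by (simp add: sum_distrib_left mult_ac) (rule sum.swap)
      also have "\<dots> = (\<Sum>i<k. d i * Y i (g ! a))"
        using c a by (intro sum.cong refl) (simp add: Y y_def z_def scalar_prod_def atLeast0LessThan)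
      also have "\<dots> = 0" using 0 a g(2) by (auto simp: n_def)
      finally show "(P *\<^sub>v s) $ a = 0\<^sub>v n $ a" using a by simp
    qed (use c in simp)
    moreover have "Q *\<^sub>v (P *\<^sub>v s) = s"
      using c PQ by (simp add: assoc_mult_mat_vec[symmetric, of Q n n P n] s_def)
    moreover have "Q *\<^sub>v 0\<^sub>v n = 0\<^sub>v n"
      using c by (intro eq_vecI) (auto simp: scalar_prod_def)
    ultimately have "s = 0\<^sub>v n" by simp
    hence "(\<Sum>i<k. d i * x i (h ! b)) = 0" if "b < n" for b
      using that by (simp add: s_def vec_eq_iff)
    hence "\<forall>u\<in>pverts H. (\<Sum>i<k. d i * x i u) = 0"
      unfolding h(2)[symmetric] by (auto simp: in_set_conv_nth len)
    thus "\<forall>i<k. d i = 0" using ind by (auto simp: independent_on_def)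
  qed
  with eig show ?thesis by (auto simp: multiplicity_ge_def)
qed

section \<open>Eigenfunctions of the Laplacian\<close>

text \<open>
  A homogeneous system with fewer equations \<open>S\<close> than unknowns \<open>I\<close>, solved by Gaussian elimination:
  the equation \<open>s\<close> is used to eliminate an unknown \<open>p\<close> with nonzero coefficient.
\<close>

lemma homogeneous_system_nontrivial:
  fixes a :: "'i \<Rightarrow> 's \<Rightarrow> real"
  assumes "finite S" "finite I" "card S < card I"
  shows "\<exists>c. (\<exists>i\<in>I. c i \<noteq> 0) \<and> (\<forall>s\<in>S. (\<Sum>i\<in>I. c i * a i s) = 0)"
  using assms
proof (induction S arbitrary: I a rule: finite_induct)
  case empty
  hence "I \<noteq> {}" by auto
  thus ?case by (intro exI[of _ "\<lambda>_. 1"]) auto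
next
  case (insert s S)
  show ?case
  proof (cases "\<forall>i\<in>I. a i s = 0")
    case True
    thus ?thesis using insert.IH[of I a] insert.prems insert.hyps by auto
  next
    case False
    then obtain p where p: "p \<in> I" "a p s \<noteq> 0" by blast
    let ?J = "I - {p}"
    define b where "b i t = a i t - a i s / a p s * a p t" for i t
    have "card S < card ?J" using insert p by simp
    then obtain c where c: "\<exists>i\<in>?J. c i \<noteq> 0" "\<And>t. t \<in> S \<Longrightarrow> (\<Sum>i\<in>?J. c i * b i t) = 0"
      using insert.IH[of ?J b] insert.prems by auto
    define q where "q = - (\<Sum>i\<in>?J. c i * a i s) / a p s"
    define d where "d = c(p := q)"
    have split: "(\<Sum>i\<in>I. d i * a i t) = q * a p t + (\<Sum>i\<in>?J. c i * a i t)" for t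
      using sum.remove[OF insert.prems(1) p(1), of "\<lambda>i. d i * a i t"] by (simp add: d_def)
    have s: "(\<Sum>i\<in>I. d i * a i s) = 0"
      unfolding split q_def using p by simp
    have t: "(\<Sum>i\<in>I. d i * a i t) = 0" if "t \<in> S" for t
    proof -
      have "(\<Sum>i\<in>?J. c i * a i t) = (\<Sum>i\<in>?J. c i * b i t + c i * a i s * (a p t / a p s))"
        by (intro sum.cong refl) (simp add: b_def algebra_simps)
      also have "\<dots> = (\<Sum>i\<in>?J. c i * a i s) * (a p t / a p s)"
        using c(2)[OF that] by (simp only: sum.distrib sum_distrib_right)
      finally show ?thesis unfolding split q_def by simp
    qed
    have "\<exists>i\<in>I. d i \<noteq> 0" using c(1) by (auto simp: d_def)
    with s t show ?thesis by auto
  qed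
qed

lemma lap_cmult: "lap E (\<lambda>u. c * x u) u = c * lap E x u"
  by (simp add: lap_def sum_distrib_left right_diff_distrib)

lemma lap_sum: "lap E (\<lambda>u. \<Sum>i\<in>I. x i u) u = (\<Sum>i\<in>I. lap E (x i) u)"
  unfolding lap_def by (subst sum.swap) (simp add: sum_subtractf)

text \<open>
  More independent eigenfunctions than points of \<open>R\<close> would have a nontrivial linear combination
  that vanishes on \<open>R\<close>. All upper bounds for multiplicities are obtained in this way, with a set \<open>R\<close>
  whose values determine an eigenfunction.
\<close>

lemma multiplicity_le:
  assumes mult: "multiplicity_ge V E l k" and R: "finite R"
    and zero: "\<And>x. eigenfunction V E l x \<Longrightarrow> \<forall>r\<in>R. x r = 0 \<Longrightarrow> \<forall>u\<in>V. x u = 0"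
  shows "k \<le> card R"
proof (rule ccontr)
  assume "\<not> k \<le> card R"
  obtain x where x: "\<And>i. i < k \<Longrightarrow> eigenfunction V E l (x i)" and ind: "independent_on V k x"
    using mult by (auto simp: multiplicity_ge_def)
  obtain c where c: "\<exists>i<k. c i \<noteq> 0" "\<forall>r\<in>R. (\<Sum>i<k. c i * x i r) = 0"
    using homogeneous_system_nontrivial[OF R, of "{..<k}" x] \<open>\<not> k \<le> card R\<close> by auto
  have "eigenfunction V E l (\<lambda>u. \<Sum>i<k. c i * x i u)"
    using x by (auto simp: eigenfunction_def lap_sum lap_cmult sum_distrib_left mult_ac intro!: sum.cong)
  from zero[OF this c(2)] c(1) ind show False by (auto simp: independent_on_def)
qed

text \<open>
  The points \<open>p i\<close> witness independence, because the matrix of the values \<open>x i (p j)\<close> is diagonal with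
  nonzero diagonal.
\<close>

lemma multiplicity_geI:
  assumes "\<And>i. i < k \<Longrightarrow> eigenfunction V E l (x i)"
    and "\<And>i. i < k \<Longrightarrow> p i \<in> V" "\<And>i. i < k \<Longrightarrow> x i (p i) \<noteq> 0"
    and "\<And>i j. i < k \<Longrightarrow> j < k \<Longrightarrow> i \<noteq> j \<Longrightarrow> x i (p j) = 0"
  shows "multiplicity_ge V E l k"
  unfolding multiplicity_ge_def independent_on_def
proof (intro exI conjI allI impI)
  fix c i assume 0: "\<forall>u\<in>V. (\<Sum>i<k. c i * x i u) = 0" and i: "i < k"
  have "(\<Sum>j<k. c j * x j (p i)) = (\<Sum>j<k. if j = i then c i * x i (p i) else 0)"
    using assms(4) i by (intro sum.cong) auto
  hence "c i * x i (p i) = 0" using 0 assms(2)[OF i] i by simp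
  thus "c i = 0" using assms(3)[OF i] by simp
qed (use assms(1) in blast)

context simple_graph
begin

lemma sum_arcs: "(\<Sum>u\<in>V. \<Sum>v\<in>E `` {u}. f u v) = (\<Sum>(u, v)\<in>E. f u v)"
proof -
  have "(\<Sum>u\<in>V. \<Sum>v\<in>E `` {u}. f u v) = (\<Sum>(u, v)\<in>Sigma V (\<lambda>u. E `` {u}). f u v)"
    by (rule sum.Sigma) (auto simp: finite_V)
  also have "Sigma V (\<lambda>u. E `` {u}) = E" using E_in by auto
  finally show ?thesis .
qed

lemma sum_arcs_swap: "(\<Sum>(u, v)\<in>E. f u v) = (\<Sum>(u, v)\<in>E. f v u)"
  by (rule sum.reindex_bij_witness[of _ prod.swap prod.swap]) (use E_sym in auto)

lemma sum_lap: "(\<Sum>u\<in>V. lap E x u) = 0"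
proof -
  have "(\<Sum>u\<in>V. lap E x u) = (\<Sum>(u, v)\<in>E. x u - x v)"
    unfolding lap_def by (rule sum_arcs)
  moreover have "\<dots> = (\<Sum>(u, v)\<in>E. x v - x u)" by (rule sum_arcs_swap)
  moreover have "\<dots> = - (\<Sum>(u, v)\<in>E. x u - x v)"
    by (simp add: sum_negf[symmetric] case_prod_unfold)
  ultimately show ?thesis by linarith
qed

lemma dirichlet_form: "2 * (\<Sum>u\<in>V. x u * lap E x u) = (\<Sum>(u, v)\<in>E. (x u - x v)\<^sup>2)"
proof -
  have 1: "(\<Sum>u\<in>V. x u * lap E x u) = (\<Sum>(u, v)\<in>E. x u * (x u - x v))"
    unfolding lap_def sum_distrib_left by (rule sum_arcs)
  have "2 * (\<Sum>u\<in>V. x u * lap E x u) = (\<Sum>(u, v)\<in>E. x u * (x u - x v)) + (\<Sum>(u, v)\<in>E. x v * (x v - x u))"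
    using sum_arcs_swap[of "\<lambda>u v. x u * (x u - x v)"] 1 by simp
  also have "\<dots> = (\<Sum>(u, v)\<in>E. (x u - x v)\<^sup>2)"
    unfolding sum.distrib[symmetric]
    by (intro sum.cong) (auto simp: power2_eq_square algebra_simps)
  finally show ?thesis .
qed

lemma eigenfunction_0_iff: "eigenfunction V E 0 x \<longleftrightarrow> (\<forall>(u, v)\<in>E. x u = x v)"
proof
  assume "eigenfunction V E 0 x"
  hence "(\<Sum>(u, v)\<in>E. (x u - x v)\<^sup>2) = 0"
    by (simp add: dirichlet_form[symmetric] eigenfunction_def)
  hence "\<forall>e\<in>E. (case e of (u, v) \<Rightarrow> (x u - x v)\<^sup>2) = 0"
    by (subst (asm) sum_nonneg_eq_0_iff) auto
  thus "\<forall>(u, v)\<in>E. x u = x v" by auto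
qed (auto simp: eigenfunction_def lap_def intro!: sum.neutral)

lemma eigenfunction_sum_0:
  assumes "eigenfunction V E l x" "l \<noteq> 0"
  shows "(\<Sum>u\<in>V. x u) = 0"
proof -
  have "l * (\<Sum>u\<in>V. x u) = (\<Sum>u\<in>V. lap E x u)"
    using assms(1) by (simp add: sum_distrib_left eigenfunction_def)
  thus ?thesis using assms(2) sum_lap by simp
qed

text \<open>
  For a graph that is regular of degree two, the sum of \<open>(x u + x v)\<^sup>2\<close> over all arcs is twice the
  quadratic form of \<open>4 - L\<close>, which vanishes on eigenfunctions for \<open>4\<close>. Thus the eigenvalue \<open>4\<close> belongs
  to the bipartite components.
\<close>

lemma eigenfunction_4_alternates:
  assumes reg: "\<And>u. u \<in> V \<Longrightarrow> deg E u = 2"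
    and x: "eigenfunction V E 4 x" and uv: "(u, v) \<in> E"
  shows "x v = - x u"
proof -
  have 1: "(\<Sum>v\<in>E `` {u}. x u * (x u + x v)) = 0" if "u \<in> V" for u
  proof -
    have "(\<Sum>v\<in>E `` {u}. x u * (x u + x v)) = x u * (\<Sum>v\<in>E `` {u}. 2 * x u - (x u - x v))"
      unfolding sum_distrib_left by (intro sum.cong) auto
    also have "(\<Sum>v\<in>E `` {u}. 2 * x u - (x u - x v)) = 4 * x u - lap E x u"
      using reg[OF that] unfolding lap_def sum_subtractf[of "\<lambda>_. 2 * x u"] by (simp add: deg_def)
    finally show ?thesis using x that by (simp add: eigenfunction_def)
  qed
  have "(\<Sum>(u, v)\<in>E. (x u + x v)\<^sup>2) = (\<Sum>(u, v)\<in>E. x u * (x u + x v)) + (\<Sum>(u, v)\<in>E. x v * (x v + x u))"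
    unfolding sum.distrib[symmetric]
    by (intro sum.cong) (auto simp: power2_eq_square algebra_simps)
  also have "\<dots> = 2 * (\<Sum>(u, v)\<in>E. x u * (x u + x v))"
    using sum_arcs_swap[of "\<lambda>u v. x u * (x u + x v)"] by simp
  also have "(\<Sum>(u, v)\<in>E. x u * (x u + x v)) = 0"
    unfolding sum_arcs[symmetric] using 1 by simp
  finally have "\<forall>e\<in>E. (case e of (u, v) \<Rightarrow> (x u + x v)\<^sup>2) = 0"
    by (subst (asm) mult_zero_right, subst (asm) sum_nonneg_eq_0_iff) auto
  with uv show ?thesis by fastforce
qed

lemma alternating_eigenfunction:
  assumes reg: "\<And>u. u \<in> V \<Longrightarrow> deg E u = 2"
    and alt: "\<And>u v. (u, v) \<in> E \<Longrightarrow> x v = - x u"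
  shows "eigenfunction V E 4 x"
  unfolding eigenfunction_def
proof
  fix u assume "u \<in> V"
  have "lap E x u = (\<Sum>v\<in>E `` {u}. 2 * x u)"
    unfolding lap_def using alt by (intro sum.cong) auto
  thus "lap E x u = 4 * x u" using reg[OF \<open>u \<in> V\<close>] by (simp add: deg_def)
qed

lemma induced_simple_graph: "C \<subseteq> V \<Longrightarrow> simple_graph C (E \<inter> C \<times> C)"
  by unfold_locales (use E_sym E_irrefl finite_subset[OF _ finite_V] in auto)

lemma lap_restrict_closed:
  assumes "E `` C \<subseteq> C" "u \<in> C"
  shows "lap (E \<inter> C \<times> C) x u = lap E x u"
proof -
  have "(E \<inter> C \<times> C) `` {u} = E `` {u}" using assms by auto
  thus ?thesis by (simp add: lap_def)
qed

text \<open>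
  On a union \<open>C\<close> of components the Dirichlet form is at most that of the complete graph on \<open>C\<close>, whose
  largest eigenvalue is the number of vertices.
\<close>

lemma eigenvalue_le_card_closed:
  assumes x: "eigenfunction V E l x" and C: "C \<subseteq> V" "E `` C \<subseteq> C"
    and u: "u \<in> C" "x u \<noteq> 0"
  shows "l \<le> real (card C)"
proof -
  interpret C: simple_graph C "E \<inter> C \<times> C" by (rule induced_simple_graph[OF C(1)])
  let ?q = "\<Sum>u\<in>C. (x u)\<^sup>2"
  have "2 * l * ?q = 2 * (\<Sum>u\<in>C. x u * lap (E \<inter> C \<times> C) x u)"
    using x C by (auto simp: lap_restrict_closed[OF C(2)] eigenfunction_def sum_distrib_left power2_eq_square mult_ac
      intro!: sum.cong)
  also have "\<dots> = (\<Sum>(u, v)\<in>E \<inter> C \<times> C. (x u - x v)\<^sup>2)" by (rule C.dirichlet_form)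
  also have "\<dots> \<le> (\<Sum>(u, v)\<in>C \<times> C. (x u - x v)\<^sup>2)"
    using C.finite_V by (intro sum_mono2) auto
  also have "\<dots> = (\<Sum>u\<in>C. \<Sum>v\<in>C. (x u)\<^sup>2 + (x v)\<^sup>2 - 2 * (x u * x v))"
    by (simp add: sum.cartesian_product[symmetric] power2_diff mult_ac)
  also have "\<dots> = 2 * card C * ?q - 2 * (\<Sum>u\<in>C. x u)\<^sup>2"
    by (simp add: sum.distrib sum_subtractf sum_distrib_left[symmetric] sum_distrib_right[symmetric]
        power2_eq_square)
  also have "\<dots> \<le> 2 * card C * ?q" by simp
  finally have "l * ?q \<le> card C * ?q" by simp
  moreover have "?q > 0"
    using u C.finite_V by (intro sum_pos2[of C u]) auto
  ultimately show ?thesis by simp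
qed

end

definition compl_arcs :: "'a set \<Rightarrow> ('a \<times> 'a) set \<Rightarrow> ('a \<times> 'a) set" where
  "compl_arcs V E = {(u, v). u \<in> V \<and> v \<in> V \<and> u \<noteq> v \<and> (u, v) \<notin> E}"

context simple_graph
begin

lemma compl_simple_graph: "simple_graph V (compl_arcs V E)"
  by unfold_locales (use E_sym finite_V in \<open>auto simp: compl_arcs_def\<close>)

lemma compl_compl: "compl_arcs V (compl_arcs V E) = E"
  using E_in E_irrefl by (auto simp: compl_arcs_def)

lemma nbrs_split:
  assumes "u \<in> V"
  shows "E `` {u} \<inter> compl_arcs V E `` {u} = {}" "E `` {u} \<union> compl_arcs V E `` {u} = V - {u}"
  using E_in E_irrefl assms by (auto simp: compl_arcs_def)

text \<open>
  The two Laplacians add up to that of the complete graph.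
\<close>

lemma lap_compl:
  assumes "u \<in> V"
  shows "lap E x u + lap (compl_arcs V E) x u = real (card V) * x u - (\<Sum>v\<in>V. x v)"
proof -
  interpret D: simple_graph V "compl_arcs V E" by (rule compl_simple_graph)
  have "lap E x u + lap (compl_arcs V E) x u = (\<Sum>v\<in>V - {u}. x u - x v)"
    unfolding lap_def nbrs_split(2)[OF assms, symmetric]
    by (rule sum.union_disjoint[symmetric]) (use nbrs_split(1)[OF assms] in auto)
  also have "\<dots> = (\<Sum>v\<in>V. x u - x v)"
    using finite_V assms by (simp add: sum.remove[of V u])
  finally show ?thesis by (simp add: sum_subtractf)
qed

lemma deg_compl:
  assumes "u \<in> V"
  shows "deg E u + deg (compl_arcs V E) u = card V - 1"
proof -
  interpret D: simple_graph V "compl_arcs V E" by (rule compl_simple_graph)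
  show ?thesis
    using card_Un_disjoint[OF finite_nbrs D.finite_nbrs nbrs_split(1)[OF assms]] finite_V assms
    by (simp add: deg_def nbrs_split(2)[OF assms])
qed

lemma eigenfunction_compl:
  assumes "eigenfunction V E l x" "l \<noteq> 0"
  shows "eigenfunction V (compl_arcs V E) (real (card V) - l) x"
  using lap_compl[of _ x] eigenfunction_sum_0[OF assms] assms(1)
  by (auto simp: eigenfunction_def algebra_simps)

lemma sum_deg: "(\<Sum>u\<in>V. deg E u) = card E"
  using sum_arcs[of "\<lambda>_ _. 1::nat"] by (simp add: deg_def case_prod_unfold)

end

text \<open>
  The graph is the join of the complete graph on \<open>W\<close> and the graph \<open>H\<close> induced on \<open>C\<close>. Up to the
  eigenvalues \<open>0\<close> and \<open>card V\<close>, its eigenfunctions are those of \<open>H\<close> with sum zero, extended by zero, and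
  the eigenvalues are shifted by \<open>card W\<close>.
\<close>

locale cone = simple_graph +
  fixes W C :: "'a set"
  assumes V_eq: "V = W \<union> C" and WC: "W \<inter> C = {}"
    and universal: "\<And>u v. u \<in> W \<Longrightarrow> v \<in> V \<Longrightarrow> u \<noteq> v \<Longrightarrow> (u, v) \<in> E"
begin

abbreviation "H \<equiv> E \<inter> C \<times> C"

sublocale H: simple_graph C H
  by (rule induced_simple_graph) (simp add: V_eq)

lemma finite_W: "finite W"
  using finite_V V_eq by simp

lemma lap_W: "u \<in> W \<Longrightarrow> lap E x u = real (card V) * x u - (\<Sum>v\<in>V. x v)"
proof -
  assume u: "u \<in> W"
  hence "compl_arcs V E `` {u} = {}" using universal by (auto simp: compl_arcs_def)
  thus ?thesis using lap_compl[of u x] u V_eq by (simp add: lap_def)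
qed

lemma nbrs_C:
  assumes "u \<in> C"
  shows "E `` {u} = H `` {u} \<union> W" "H `` {u} \<inter> W = {}"
  using assms universal E_sym E_in V_eq WC by blast+

lemma lap_C: "u \<in> C \<Longrightarrow> lap E x u = lap H x u + real (card W) * x u - (\<Sum>v\<in>W. x v)"
  unfolding lap_def
  by (subst nbrs_C(1), assumption, subst sum.union_disjoint)
     (auto simp: sum_subtractf finite_W dest: nbrs_C(2))

lemma deg_C: "u \<in> C \<Longrightarrow> deg E u = deg H u + card W"
  using card_Un_disjoint[OF H.finite_nbrs finite_W nbrs_C(2)] by (simp add: deg_def nbrs_C(1))

lemma deg_W: "u \<in> W \<Longrightarrow> deg E u = card V - 1"
proof -
  assume u: "u \<in> W"
  hence "E `` {u} = V - {u}" using universal E_in E_irrefl V_eq by blast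
  thus ?thesis using u V_eq finite_V by (simp add: deg_def)
qed

lemma eigenfunction_cone:
  assumes x: "eigenfunction V E l x" and l: "l \<noteq> 0" "l \<noteq> real (card V)"
  shows "\<And>u. u \<in> W \<Longrightarrow> x u = 0" "(\<Sum>u\<in>C. x u) = 0" "eigenfunction C H (l - real (card W)) x"
proof -
  have 0: "(\<Sum>u\<in>V. x u) = 0" by (rule eigenfunction_sum_0[OF x l(1)])
  show W: "x u = 0" if "u \<in> W" for u
    using lap_W[OF that, of x] x that l(2) 0 V_eq by (auto simp: eigenfunction_def)
  show "(\<Sum>u\<in>C. x u) = 0"
    using 0 W H.finite_V finite_W WC unfolding V_eq by (simp add: sum.union_disjoint)
  show "eigenfunction C H (l - real (card W)) x"
    using x W V_eq lap_C[of _ x] by (auto simp: eigenfunction_def algebra_simps)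
qed

lemma eigenfunction_coneI:
  assumes "eigenfunction C H l x" "(\<Sum>u\<in>C. x u) = 0" "\<And>u. u \<in> W \<Longrightarrow> x u = 0"
  shows "eigenfunction V E (real (card W) + l) x"
proof -
  have "(\<Sum>u\<in>V. x u) = 0"
    using assms(2,3) H.finite_V finite_W WC unfolding V_eq by (simp add: sum.union_disjoint)
  thus ?thesis
    using assms lap_W[of _ x] lap_C[of _ x] V_eq by (auto simp: eigenfunction_def algebra_simps)
qed

end

section \<open>Perfection of a graph and its complement\<close>

text \<open>
  A clique \<open>K\<close> together with a proper colouring by \<open>card K\<close> colours certifies that clique number and
  chromatic number of the graph induced on \<open>S\<close> agree.
\<close>

definition chi_eq_omega :: "('a \<times> 'a) set \<Rightarrow> 'a set \<Rightarrow> bool" where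
  "chi_eq_omega E S \<longleftrightarrow> (\<exists>K c. K \<subseteq> S \<and> (\<forall>u\<in>K. \<forall>v\<in>K. u \<noteq> v \<longrightarrow> (u, v) \<in> E) \<and>
     (\<forall>u\<in>S. c u < card K) \<and> (\<forall>u\<in>S. \<forall>v\<in>S. (u, v) \<in> E \<longrightarrow> c u \<noteq> (c v :: nat)))"

lemma chi_eq_omegaI:
  assumes "K \<subseteq> S" "\<And>u v. u \<in> K \<Longrightarrow> v \<in> K \<Longrightarrow> u \<noteq> v \<Longrightarrow> (u, v) \<in> E"
    "\<And>u. u \<in> S \<Longrightarrow> c u < card K" "\<And>u v. u \<in> S \<Longrightarrow> v \<in> S \<Longrightarrow> (u, v) \<in> E \<Longrightarrow> c u \<noteq> (c v :: nat)"
  shows "chi_eq_omega E S"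
  unfolding chi_eq_omega_def using assms by (intro exI[of _ K] exI[of _ c]) simp

lemma chi_eq_omega_cong:
  assumes "\<And>u v. u \<in> S \<Longrightarrow> v \<in> S \<Longrightarrow> (u, v) \<in> E \<longleftrightarrow> (u, v) \<in> E'"
  shows "chi_eq_omega E S \<longleftrightarrow> chi_eq_omega E' S"
proof -
  have imp: "chi_eq_omega E' S" if g: "chi_eq_omega E S" and eq: "\<And>u v. u \<in> S \<Longrightarrow> v \<in> S \<Longrightarrow> (u, v) \<in> E \<longleftrightarrow> (u, v) \<in> E'" for E E'
  proof -
    obtain K c where "K \<subseteq> S" "\<forall>u\<in>K. \<forall>v\<in>K. u \<noteq> v \<longrightarrow> (u, v) \<in> E"
      "\<forall>u\<in>S. c u < card K" "\<forall>u\<in>S. \<forall>v\<in>S. (u, v) \<in> E \<longrightarrow> c u \<noteq> (c v :: nat)"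
      using g unfolding chi_eq_omega_def by blast
    thus ?thesis using eq by (intro chi_eq_omegaI[of K S E' c]) blast+
  qed
  show ?thesis
  proof
    show "chi_eq_omega E' S" if "chi_eq_omega E S" using that assms by (rule imp)
    show "chi_eq_omega E S" if "chi_eq_omega E' S" using that assms[symmetric] by (rule imp)
  qed
qed

lemma induced_good_iff:
  assumes G: "simple_graph S (parcs G)" "pverts G = S"
  shows "chromatic_number G = clique_number G \<longleftrightarrow> chi_eq_omega (parcs G) S"
proof -
  interpret simple_graph S "parcs G" by fact
  let ?cols = "\<lambda>k. \<exists>c. proper_coloring G c \<and> c ` pverts G \<subseteq> {..<k}"
  let ?sizes = "{card K | K. is_clique G K}"
  have "?sizes \<subseteq> {..card S}"
    using card_mono[OF finite_V] by (auto simp: is_clique_def G(2))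
  hence fin: "finite ?sizes" by (rule finite_subset) simp
  have ne: "?sizes \<noteq> {}" by (auto simp: is_clique_def intro!: exI[of _ "{}"])
  have "?cols (card S)"
  proof -
    obtain c where c: "bij_betw c S {0..<card S}" using ex_bij_betw_finite_nat[OF finite_V] by blast
    have "proper_coloring G c"
      unfolding proper_coloring_def
    proof (safe, goal_cases)
      case (1 u v)
      hence "u = v" using bij_betw_imp_inj_on[OF c] E_in by (meson inj_onD)
      thus ?case using 1 E_irrefl by simp
    qed
    moreover have "c ` pverts G \<subseteq> {..<card S}" using c by (auto simp: bij_betw_def G(2))
    ultimately show ?thesis by blast
  qed
  hence chi: "?cols (chromatic_number G)" unfolding chromatic_number_def by (rule LeastI)
  have "clique_number G \<in> ?sizes" unfolding clique_number_def using fin ne by (rule Max_in)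
  then obtain K0 where K0: "is_clique G K0" "card K0 = clique_number G" by auto
  have le: "card K \<le> k" if K: "is_clique G K" and k: "?cols k" for K k
  proof -
    obtain c where c: "proper_coloring G c" "c ` pverts G \<subseteq> {..<k}" using k by blast
    have "inj_on c K" 
      using K c(1) unfolding inj_on_def is_clique_def proper_coloring_def by blast
    moreover have "c ` K \<subseteq> {..<k}" using K c(2) by (auto simp: is_clique_def)
    ultimately show ?thesis using card_inj_on_le[of c K "{..<k}"] by simp
  qed
  show ?thesis
  proof
    assume eq: "chromatic_number G = clique_number G"
    obtain c where c: "proper_coloring G c" "c ` pverts G \<subseteq> {..<chromatic_number G}" using chi by blast
    show "chi_eq_omega (parcs G) S"
    proof (rule chi_eq_omegaI)
      show "K0 \<subseteq> S" using K0(1) by (simp add: is_clique_def G(2))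
    qed (use K0 c eq in \<open>auto simp: is_clique_def proper_coloring_def G(2)\<close>)
  next
    assume "chi_eq_omega (parcs G) S"
    then obtain K c where K: "K \<subseteq> S" "\<forall>u\<in>K. \<forall>v\<in>K. u \<noteq> v \<longrightarrow> (u, v) \<in> parcs G"
      and c: "\<forall>u\<in>S. c u < card K" "\<forall>u\<in>S. \<forall>v\<in>S. (u, v) \<in> parcs G \<longrightarrow> c u \<noteq> (c v :: nat)"
      by (auto simp: chi_eq_omega_def)
    have clique: "is_clique G K" using K by (simp add: is_clique_def G(2))
    have "?cols (card K)"
      using c E_in by (intro exI[of _ c]) (auto simp: proper_coloring_def G(2))
    hence "chromatic_number G \<le> card K" unfolding chromatic_number_def by (rule Least_le)
    moreover have "card K \<le> clique_number G"
      unfolding clique_number_def using fin clique by (intro Max_ge) auto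
    moreover have "clique_number G \<le> chromatic_number G" using le[OF K0(1) chi] K0(2) by simp
    ultimately show "chromatic_number G = clique_number G" by simp
  qed
qed

lemma perfect_graph_iff:
  assumes "simple_graph (pverts G) (parcs G)"
  shows "perfect_graph G \<longleftrightarrow> (\<forall>S\<subseteq>pverts G. chi_eq_omega (parcs G) S)"
proof -
  interpret simple_graph "pverts G" "parcs G" by fact
  have ind: "chromatic_number H = clique_number H \<longleftrightarrow> chi_eq_omega (parcs G) (pverts H)"
    if "pverts H \<subseteq> pverts G" "parcs H = parcs G \<inter> pverts H \<times> pverts H" for H
  proof -
    have "chromatic_number H = clique_number H \<longleftrightarrow> chi_eq_omega (parcs H) (pverts H)"
      by (rule induced_good_iff[OF _ refl]) (simp add: that(2) induced_simple_graph[OF that(1)])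
    also have "\<dots> \<longleftrightarrow> chi_eq_omega (parcs G) (pverts H)"
      by (rule chi_eq_omega_cong) (simp add: that(2))
    finally show ?thesis .
  qed
  have wf: "wf_digraph (with_proj H)" if "parcs H \<subseteq> pverts H \<times> pverts H" for H :: "'a pair_pre_digraph"
    using that by unfold_locales auto
  show ?thesis
  proof
    assume perf: "perfect_graph G"
    show "\<forall>S\<subseteq>pverts G. chi_eq_omega (parcs G) S"
    proof safe
      fix S assume S: "S \<subseteq> pverts G"
      define H where "H = \<lparr>pverts = S, parcs = parcs G \<inter> S \<times> S\<rparr>"
      have "induced_subgraph (with_proj H) (with_proj G)"
        using S wf[of H] wf[of G] E_sub
        by (auto simp: induced_subgraph_def subgraph_def compatible_def H_def)
      hence "chromatic_number H = clique_number H" using perf by (simp add: perfect_graph_def)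
      thus "chi_eq_omega (parcs G) S" using ind[of H] S by (simp add: H_def)
    qed
  next
    assume chi_eq_omega: "\<forall>S\<subseteq>pverts G. chi_eq_omega (parcs G) S"
    show "perfect_graph G"
      unfolding perfect_graph_def
    proof safe
      fix H :: "'a pair_pre_digraph" assume "induced_subgraph (with_proj H) (with_proj G)"
      hence "pverts H \<subseteq> pverts G" "parcs H = parcs G \<inter> pverts H \<times> pverts H"
        by (auto simp: induced_subgraph_def subgraph_def)
      thus "chromatic_number H = clique_number H" using ind chi_eq_omega by blast
    qed
  qed
qed

text \<open>
  The complement is taken within the whole type, so that it does not depend on the vertex set and can
  be restricted to any subset afterwards.
\<close>

definition non_arcs :: "('a \<times> 'a) set \<Rightarrow> ('a \<times> 'a) set" where
  "non_arcs E = {(u, v). u \<noteq> v \<and> (u, v) \<notin> E}"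

definition biperfect :: "('a \<times> 'a) set \<Rightarrow> 'a set \<Rightarrow> bool" where
  "biperfect E V \<longleftrightarrow> (\<forall>S\<subseteq>V. chi_eq_omega E S \<and> chi_eq_omega (non_arcs E) S)"

lemma perfect_complement_iff_biperfect:
  assumes "simple_graph (pverts G) (parcs G)"
  shows "perfect_graph G \<and> perfect_graph (complement_graph G) \<longleftrightarrow> biperfect (parcs G) (pverts G)"
proof -
  interpret simple_graph "pverts G" "parcs G" by fact
  have c: "pverts (complement_graph G) = pverts G" "parcs (complement_graph G) = compl_arcs (pverts G) (parcs G)"
    by (simp_all add: complement_graph_def compl_arcs_def)
  have "chi_eq_omega (compl_arcs (pverts G) (parcs G)) S \<longleftrightarrow> chi_eq_omega (non_arcs (parcs G)) S" if "S \<subseteq> pverts G" for S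
    using that by (intro chi_eq_omega_cong) (auto simp: compl_arcs_def non_arcs_def)
  thus ?thesis
    using perfect_graph_iff[OF assms] perfect_graph_iff[of "complement_graph G"] compl_simple_graph
    unfolding c biperfect_def by blast
qed

lemma biperfect_cong:
  assumes "\<And>u v. u \<in> V \<Longrightarrow> v \<in> V \<Longrightarrow> (u, v) \<in> E \<longleftrightarrow> (u, v) \<in> E'"
  shows "biperfect E V \<longleftrightarrow> biperfect E' V"
proof -
  have "chi_eq_omega E S \<longleftrightarrow> chi_eq_omega E' S" "chi_eq_omega (non_arcs E) S \<longleftrightarrow> chi_eq_omega (non_arcs E') S" if "S \<subseteq> V" for S
    using that assms by (auto intro!: chi_eq_omega_cong simp: non_arcs_def subset_iff)
  thus ?thesis unfolding biperfect_def by blast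
qed

lemma biperfect_non_arcs:
  assumes "irrefl E"
  shows "biperfect (non_arcs E) V \<longleftrightarrow> biperfect E V"
proof -
  have "non_arcs (non_arcs E) = E" using assms by (auto simp: non_arcs_def irrefl_def)
  thus ?thesis by (auto simp: biperfect_def)
qed

text \<open>
  Cliques and colourings of the two parts are combined with disjoint sets of colours.
\<close>

lemma chi_eq_omega_join:
  assumes A: "chi_eq_omega E A" and B: "chi_eq_omega E B" and fin: "finite A" "finite B" and disj: "A \<inter> B = {}"
    and AB: "\<And>a b. a \<in> A \<Longrightarrow> b \<in> B \<Longrightarrow> (a, b) \<in> E \<and> (b, a) \<in> E"
  shows "chi_eq_omega E (A \<union> B)"
proof -
  obtain K c where K: "K \<subseteq> A" "\<forall>u\<in>K. \<forall>v\<in>K. u \<noteq> v \<longrightarrow> (u, v) \<in> E"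
    and c: "\<forall>u\<in>A. c u < card K" "\<forall>u\<in>A. \<forall>v\<in>A. (u, v) \<in> E \<longrightarrow> c u \<noteq> (c v :: nat)"
    using A by (auto simp: chi_eq_omega_def)
  obtain L d where L: "L \<subseteq> B" "\<forall>u\<in>L. \<forall>v\<in>L. u \<noteq> v \<longrightarrow> (u, v) \<in> E"
    and d: "\<forall>u\<in>B. d u < card L" "\<forall>u\<in>B. \<forall>v\<in>B. (u, v) \<in> E \<longrightarrow> d u \<noteq> (d v :: nat)"
    using B by (auto simp: chi_eq_omega_def)
  have card: "card (K \<union> L) = card K + card L"
    using K(1) L(1) fin disj by (intro card_Un_disjoint) (auto intro: finite_subset)
  have nB: "u \<notin> A" if "u \<in> B" for u using that disj by auto
  show ?thesis
  proof (rule chi_eq_omegaI[where K = "K \<union> L" and c = "\<lambda>u. if u \<in> A then c u else card K + d u"])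
    fix u v assume uv: "u \<in> A \<union> B" "v \<in> A \<union> B" "(u, v) \<in> E"
    have "c a < card K + d b" if "a \<in> A" for a b
      using c(1) that by (auto intro: trans_less_add1)
    hence "c a \<noteq> card K + d b" "card K + d b \<noteq> c a" if "a \<in> A" for a b
      using that by (metis less_irrefl)+
    moreover have "u \<in> A \<Longrightarrow> v \<in> A \<Longrightarrow> c u \<noteq> c v" "u \<in> B \<Longrightarrow> v \<in> B \<Longrightarrow> d u \<noteq> d v"
      using c(2) d(2) uv(3) by blast+
    ultimately show "(if u \<in> A then c u else card K + d u) \<noteq> (if v \<in> A then c v else card K + d v)"
      using uv(1,2) by auto
  next
    fix u assume "u \<in> A \<union> B"
    thus "(if u \<in> A then c u else card K + d u) < card (K \<union> L)"
      using c(1) d(1) card by (auto intro: trans_less_add1)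
  next
    fix u v assume "u \<in> K \<union> L" "v \<in> K \<union> L" "u \<noteq> v"
    thus "(u, v) \<in> E" using K L AB by blast
  qed (use K(1) L(1) in blast)
qed

text \<open>
  The two parts share their colours, and the larger of the two cliques is kept.
\<close>

lemma chi_eq_omega_disjoint_union:
  assumes A: "chi_eq_omega E A" and B: "chi_eq_omega E B" and disj: "A \<inter> B = {}"
    and AB: "\<And>a b. a \<in> A \<Longrightarrow> b \<in> B \<Longrightarrow> (a, b) \<notin> E \<and> (b, a) \<notin> E"
  shows "chi_eq_omega E (A \<union> B)"
proof -
  obtain K c where K: "K \<subseteq> A" "\<forall>u\<in>K. \<forall>v\<in>K. u \<noteq> v \<longrightarrow> (u, v) \<in> E"
    and c: "\<forall>u\<in>A. c u < card K" "\<forall>u\<in>A. \<forall>v\<in>A. (u, v) \<in> E \<longrightarrow> c u \<noteq> (c v :: nat)"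
    using A by (auto simp: chi_eq_omega_def)
  obtain L d where L: "L \<subseteq> B" "\<forall>u\<in>L. \<forall>v\<in>L. u \<noteq> v \<longrightarrow> (u, v) \<in> E"
    and d: "\<forall>u\<in>B. d u < card L" "\<forall>u\<in>B. \<forall>v\<in>B. (u, v) \<in> E \<longrightarrow> d u \<noteq> (d v :: nat)"
    using B by (auto simp: chi_eq_omega_def)
  have nB: "u \<notin> A" if "u \<in> B" for u using that disj by auto
  show ?thesis
  proof (rule chi_eq_omegaI[where K = "if card K \<le> card L then L else K" and c = "\<lambda>u. if u \<in> A then c u else d u"])
    fix u v assume uv: "u \<in> A \<union> B" "v \<in> A \<union> B" "(u, v) \<in> E"
    have "u \<in> A \<Longrightarrow> v \<in> A \<Longrightarrow> c u \<noteq> c v" "u \<in> B \<Longrightarrow> v \<in> B \<Longrightarrow> d u \<noteq> d v"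
      using c(2) d(2) uv(3) by blast+
    moreover have "u \<in> A \<longleftrightarrow> v \<in> A" using AB uv disj by blast
    ultimately show "(if u \<in> A then c u else d u) \<noteq> (if v \<in> A then c v else d v)"
      using uv(1,2) by auto
  next
    fix u assume "u \<in> A \<union> B"
    thus "(if u \<in> A then c u else d u) < card (if card K \<le> card L then L else K)"
      using c(1) d(1) nB by (auto intro: less_le_trans)
  qed (use K L in \<open>auto split: if_splits\<close>)
qed

text \<open>
  In the complement a join becomes a disjoint union, so both previous lemmas are used at once.
\<close>

lemma biperfect_join:
  assumes A: "biperfect E A" and B: "biperfect E B" and fin: "finite A" "finite B" and disj: "A \<inter> B = {}"
    and AB: "\<And>a b. a \<in> A \<Longrightarrow> b \<in> B \<Longrightarrow> (a, b) \<in> E \<and> (b, a) \<in> E"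
  shows "biperfect E (A \<union> B)"
  unfolding biperfect_def
proof (rule allI, rule impI)
  fix S assume "S \<subseteq> A \<union> B"
  hence S: "S = (S \<inter> A) \<union> (S \<inter> B)" by auto
  have "chi_eq_omega E (S \<inter> A)" "chi_eq_omega E (S \<inter> B)" "chi_eq_omega (non_arcs E) (S \<inter> A)" "chi_eq_omega (non_arcs E) (S \<inter> B)"
    using A B by (simp_all add: biperfect_def)
  thus "chi_eq_omega E S \<and> chi_eq_omega (non_arcs E) S"
    by (subst (1 2) S) (intro conjI chi_eq_omega_join chi_eq_omega_disjoint_union; use fin disj AB in \<open>auto simp: non_arcs_def\<close>)
qed

lemma biperfect_disjoint_union:
  assumes A: "biperfect E A" and B: "biperfect E B" and fin: "finite A" "finite B" and disj: "A \<inter> B = {}"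
    and irr: "irrefl E" and AB: "\<And>a b. a \<in> A \<Longrightarrow> b \<in> B \<Longrightarrow> (a, b) \<notin> E \<and> (b, a) \<notin> E"
  shows "biperfect E (A \<union> B)"
proof -
  have "biperfect (non_arcs E) (A \<union> B)"
    by (rule biperfect_join)
       (use A B fin disj AB in \<open>simp_all add: biperfect_non_arcs[OF irr], auto simp: non_arcs_def\<close>)
  thus ?thesis by (simp add: biperfect_non_arcs[OF irr])
qed

lemma biperfect_complete:
  assumes fin: "finite V" and irr: "irrefl E"
    and complete: "\<And>u v. u \<in> V \<Longrightarrow> v \<in> V \<Longrightarrow> u \<noteq> v \<Longrightarrow> (u, v) \<in> E"
  shows "biperfect E V"
  using fin complete
proof (induction V rule: finite_induct)
  case empty
  have "chi_eq_omega E {}" "chi_eq_omega (non_arcs E) {}" for E :: "('a \<times> 'a) set" by (auto simp: chi_eq_omega_def)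
  thus ?case by (simp add: biperfect_def)
next
  case (insert v V)
  have "biperfect E {v}"
    unfolding biperfect_def
  proof (rule allI, rule impI)
    fix S assume "S \<subseteq> {v}"
    thus "chi_eq_omega E S \<and> chi_eq_omega (non_arcs E) S"
      by (intro conjI chi_eq_omegaI[where K = S and c = "\<lambda>_. 0"])
         (use irr in \<open>auto simp: irrefl_def non_arcs_def subset_singleton_iff\<close>)
  qed
  hence "biperfect E ({v} \<union> V)"
    by (rule biperfect_join) (use insert in auto)
  thus ?case by simp
qed

section \<open>Bipartite graphs of maximum degree two\<close>

text \<open>
  Induction step for the complement of a graph \<open>E\<close>: a clique \<open>T\<close> of \<open>E\<close> can be given one new colour, and
  this is paid for by an independent set \<open>K\<close> of \<open>E\<close> with one vertex more than the old colours.
\<close>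

lemma chi_eq_omega_non_arcs_extend:
  assumes fin: "finite S" and T: "T \<subseteq> S" and adj: "\<And>u v. u \<in> T \<Longrightarrow> v \<in> T \<Longrightarrow> u \<noteq> v \<Longrightarrow> (u, v) \<in> E"
    and K: "K \<subseteq> S" "\<And>u v. u \<in> K \<Longrightarrow> v \<in> K \<Longrightarrow> u \<noteq> v \<Longrightarrow> (u, v) \<notin> E" "card K = Suc k"
    and c: "\<forall>u\<in>S - T. c u < k" "\<forall>u\<in>S - T. \<forall>v\<in>S - T. (u, v) \<in> non_arcs E \<longrightarrow> c u \<noteq> (c v :: nat)"
  shows "chi_eq_omega (non_arcs E) S"
proof (rule chi_eq_omegaI[where K = K and c = "\<lambda>u. if u \<in> T then k else c u"])
  fix u v assume uv: "u \<in> S" "v \<in> S" "(u, v) \<in> non_arcs E"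
  have "u \<notin> T \<Longrightarrow> c u < k" "v \<notin> T \<Longrightarrow> c v < k" "u \<notin> T \<Longrightarrow> v \<notin> T \<Longrightarrow> c u \<noteq> c v"
    using c uv by auto
  moreover have "\<not> (u \<in> T \<and> v \<in> T)" using uv(3) adj by (auto simp: non_arcs_def)
  ultimately show "(if u \<in> T then k else c u) \<noteq> (if v \<in> T then k else c v)"
    by auto
next
  fix u assume "u \<in> S"
  thus "(if u \<in> T then k else c u) < card K" using c(1) K(3) by (auto intro: less_SucI)
qed (use K in \<open>auto simp: non_arcs_def\<close>)

text \<open>
  Koenig's theorem for bipartite graphs of maximum degree two: the vertices can be covered by as many
  vertices and edges as there are vertices in some independent set. A vertex of degree at most one
  is removed together with its neighbour. If all degrees are two, remove an edge \<open>va\<close> and let \<open>K\<close> be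
  the independent set for the remaining graph. The \<open>2 card K\<close> edges at \<open>K\<close> all end outside \<open>K\<close>, and
  the edge \<open>va\<close> is not among them, so \<open>K\<close> contains less than half of the vertices. Therefore one of the
  two colour classes is an independent set with more vertices than \<open>K\<close>.
\<close>

lemma konig_max_degree_2:
  fixes f :: "'a \<Rightarrow> bool"
  assumes fin: "finite S" and sym: "\<And>u v. (u, v) \<in> E \<Longrightarrow> (v, u) \<in> E" and irr: "irrefl E"
    and bip: "\<And>u v. u \<in> S \<Longrightarrow> v \<in> S \<Longrightarrow> (u, v) \<in> E \<Longrightarrow> f u \<noteq> f v"
    and deg: "\<And>u. u \<in> S \<Longrightarrow> card (E `` {u} \<inter> S) \<le> 2"
  shows "chi_eq_omega (non_arcs E) S"
  using fin bip deg
proof (induction "card S" arbitrary: S rule: less_induct)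
  case less
  note bip = less.prems(2) and deg = less.prems(3)
  have fin: "finite S" by fact
  have IH: "\<exists>K c. K \<subseteq> S - T \<and> (\<forall>u\<in>K. \<forall>v\<in>K. u \<noteq> v \<longrightarrow> (u, v) \<notin> E) \<and> (\<forall>u\<in>S - T. c u < card K) \<and>
      (\<forall>u\<in>S - T. \<forall>v\<in>S - T. (u, v) \<in> non_arcs E \<longrightarrow> c u \<noteq> (c v :: nat))"
    if "T \<noteq> {}" "T \<subseteq> S" for T
  proof -
    have "chi_eq_omega (non_arcs E) (S - T)"
    proof (rule less.hyps)
      show "finite (S - T)" using fin by simp
      show "f u \<noteq> f v" if "u \<in> S - T" "v \<in> S - T" "(u, v) \<in> E" for u v
        using bip that by simp
      show "card (S - T) < card S" using that fin by (intro psubset_card_mono) auto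
      show "card (E `` {u} \<inter> (S - T)) \<le> 2" if "u \<in> S - T" for u
      proof (rule order_trans[OF card_mono deg])
        show "u \<in> S" using that by simp
      qed (use fin in auto)
    qed
    then obtain K c where "K \<subseteq> S - T" "\<forall>u\<in>K. \<forall>v\<in>K. u \<noteq> v \<longrightarrow> (u, v) \<in> non_arcs E"
      "\<forall>u\<in>S - T. c u < card K" "\<forall>u\<in>S - T. \<forall>v\<in>S - T. (u, v) \<in> non_arcs E \<longrightarrow> c u \<noteq> (c v :: nat)"
      unfolding chi_eq_omega_def by blast
    thus ?thesis by (intro exI[of _ K] exI[of _ c]) (simp add: non_arcs_def)
  qed
  show ?case
  proof (cases "\<exists>v\<in>S. card (E `` {v} \<inter> S) \<le> 1")
    case True
    then obtain v where v: "v \<in> S" "card (E `` {v} \<inter> S) \<le> 1" by blast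
    define T where "T = insert v (E `` {v} \<inter> S)"
    have T: "T \<noteq> {}" "T \<subseteq> S" using v by (auto simp: T_def)
    have single: "a = b" if "a \<in> E `` {v} \<inter> S" "b \<in> E `` {v} \<inter> S" for a b
      using v(2) that fin card_le_Suc0_iff_eq[of "E `` {v} \<inter> S"] by simp
    obtain K c where K: "K \<subseteq> S - T" "\<forall>u\<in>K. \<forall>v\<in>K. u \<noteq> v \<longrightarrow> (u, v) \<notin> E"
      and c: "\<forall>u\<in>S - T. c u < card K" "\<forall>u\<in>S - T. \<forall>v\<in>S - T. (u, v) \<in> non_arcs E \<longrightarrow> c u \<noteq> (c v :: nat)"
      using IH[OF T] by (elim exE conjE)
    show ?thesis
    proof (rule chi_eq_omega_non_arcs_extend[OF fin T(2) _ _ _ _ c])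
      show "card (insert v K) = Suc (card K)"
        using K(1) finite_subset[OF K(1)] fin by (subst card_insert_disjoint) (auto simp: T_def)
      show "(a, b) \<in> E" if "a \<in> T" "b \<in> T" "a \<noteq> b" for a b
      proof -
        have "(v, x) \<in> E \<and> (x, v) \<in> E" if "x \<in> T" "x \<noteq> v" for x
          using that sym[of v x] by (simp add: T_def)
        moreover have "a = v \<or> b = v" using that single[of a b] by (auto simp: T_def)
        ultimately show ?thesis using that by blast
      qed
      show "(a, b) \<notin> E" if ab: "a \<in> insert v K" "b \<in> insert v K" "a \<noteq> b" for a b
      proof
        assume "(a, b) \<in> E"
        moreover have "(v, x) \<notin> E" if "x \<in> K" for x using that K(1) by (auto simp: T_def)
        ultimately show False using ab K(2) sym by blast
      qed
      show "insert v K \<subseteq> S" using v(1) K(1) by auto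
    qed
  next
    case False
    hence two: "card (E `` {v} \<inter> S) = 2" if "v \<in> S" for v
      using deg[OF that] that by fastforce
    show ?thesis
    proof (cases "S = {}")
      case True
      thus ?thesis by (simp add: chi_eq_omega_def)
    next
      case False
      then obtain v where v: "v \<in> S" by blast
      have "E `` {v} \<inter> S \<noteq> {}" using two[OF v] by auto
      then obtain a where a: "a \<in> S" "(v, a) \<in> E" by auto
      have va: "v \<noteq> a" using a irr by (auto simp: irrefl_def)
      define T where "T = {v, a}"
      have T: "T \<noteq> {}" "T \<subseteq> S" using v a by (auto simp: T_def)
      obtain K c where K: "K \<subseteq> S - T" "\<forall>u\<in>K. \<forall>v\<in>K. u \<noteq> v \<longrightarrow> (u, v) \<notin> E"
        and c: "\<forall>u\<in>S - T. c u < card K" "\<forall>u\<in>S - T. \<forall>v\<in>S - T. (u, v) \<in> non_arcs E \<longrightarrow> c u \<noteq> (c v :: nat)"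
        using IH[OF T] by (elim exE conjE)
      have KS: "K \<subseteq> S" using K(1) by auto
      hence finK: "finite K" using fin by (rule finite_subset)
      let ?R = "S - K"
      have "2 * card K = (\<Sum>u\<in>K. card (E `` {u} \<inter> ?R))"
      proof -
        have "E `` {u} \<inter> ?R = E `` {u} \<inter> S" if "u \<in> K" for u
        proof -
          have "x \<notin> K" if ux: "(u, x) \<in> E" for x
          proof -
            have "u \<noteq> x" using ux irr by (auto simp: irrefl_def)
            thus ?thesis using K(2) \<open>u \<in> K\<close> ux by blast
          qed
          thus ?thesis by auto
        qed
        thus ?thesis using two KS by (simp add: subset_iff)
      qed
      also have "\<dots> = card (SIGMA u:K. E `` {u} \<inter> ?R)"
        using finK fin by (subst card_SigmaI) auto
      also have "\<dots> = card (SIGMA w:?R. E `` {w} \<inter> K)"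
        by (rule bij_betw_same_card[of prod.swap], rule bij_betwI[where g = prod.swap])
           (auto intro: sym)
      also have "\<dots> = (\<Sum>w\<in>?R. card (E `` {w} \<inter> K))"
        using finK fin by (subst card_SigmaI) auto
      (* The inequality is strict because \<open>v\<close> has the neighbour \<open>a\<close> outside \<open>K\<close>. *)
      also have "\<dots> < (\<Sum>w\<in>?R. 2)"
      proof (rule sum_strict_mono_ex1)
        show "\<forall>w\<in>?R. card (E `` {w} \<inter> K) \<le> 2"
        proof
          fix w assume "w \<in> ?R"
          hence "card (E `` {w} \<inter> K) \<le> card (E `` {w} \<inter> S)"
            using KS fin by (intro card_mono) auto
          thus "card (E `` {w} \<inter> K) \<le> 2" using two \<open>w \<in> ?R\<close> by simp
        qed
        have "card (E `` {v} \<inter> K) < card (E `` {v} \<inter> S)"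
          using KS fin a K(1) by (intro psubset_card_mono) (auto simp: T_def)
        thus "\<exists>w\<in>?R. card (E `` {w} \<inter> K) < 2"
          using two[OF v] v K(1) by (auto simp: T_def intro!: bexI[of _ v])
      qed (use fin in simp)
      finally have lt: "card K < card ?R" by simp
      have "card S = card K + card ?R"
        using KS fin finK by (simp add: card_Diff_subset card_mono)
      moreover have "card S = card {u\<in>S. f u} + card {u\<in>S. \<not> f u}"
        using fin by (subst card_Un_disjoint[symmetric]) (auto intro!: arg_cong[of _ _ card])
      ultimately have "Suc (card K) \<le> card {u\<in>S. f u} \<or> Suc (card K) \<le> card {u\<in>S. \<not> f u}"
        using lt by linarith
      hence "\<exists>g. Suc (card K) \<le> card {u\<in>S. f u = g}"
        by (elim disjE) (rule exI[of _ True], simp, rule exI[of _ False], simp)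
      then obtain g where g: "Suc (card K) \<le> card {u\<in>S. f u = g}" ..
      obtain L where L: "L \<subseteq> {u\<in>S. f u = g}" "card L = Suc (card K)"
        by (rule obtain_subset_with_card_n[OF g])
      show ?thesis
      proof (rule chi_eq_omega_non_arcs_extend[OF fin T(2) _ _ _ L(2) c])
        show "(x, y) \<in> E" if "x \<in> T" "y \<in> T" "x \<noteq> y" for x y
          using that a(2) sym[OF a(2)] by (auto simp: T_def)
        show "(x, y) \<notin> E" if "x \<in> L" "y \<in> L" "x \<noteq> y" for x y
          using that L(1) bip by blast
        show "L \<subseteq> S" using L(1) by auto
      qed
    qed
  qed
qed

lemma chi_eq_omega_bipartite:
  fixes f :: "'a \<Rightarrow> bool"
  assumes "irrefl E" and sym: "\<And>u v. (u, v) \<in> E \<Longrightarrow> (v, u) \<in> E"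
    and bip: "\<And>u v. u \<in> S \<Longrightarrow> v \<in> S \<Longrightarrow> (u, v) \<in> E \<Longrightarrow> f u \<noteq> f v"
  shows "chi_eq_omega E S"
proof (cases "E \<inter> S \<times> S = {}")
  case True
  show ?thesis
  proof (cases "S = {}")
    case False
    then obtain s where "s \<in> S" by blast
    thus ?thesis using True by (intro chi_eq_omegaI[where K = "{s}" and c = "\<lambda>_. 0"]) auto
  qed (simp add: chi_eq_omega_def)
next
  case False
  then obtain u v where uv: "u \<in> S" "v \<in> S" "(u, v) \<in> E" by auto
  have "u \<noteq> v" using uv assms(1) by (auto simp: irrefl_def)
  show ?thesis
  proof (rule chi_eq_omegaI[where K = "{u, v}" and c = "\<lambda>u. if f u then 1 else 0"])
    show "(a, b) \<in> E" if "a \<in> {u, v}" "b \<in> {u, v}" "a \<noteq> b" for a b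
      using that uv(3) sym[OF uv(3)] by auto
    show "(if f a then 1 else 0) \<noteq> (if f b then 1 else 0 :: nat)" if "a \<in> S" "b \<in> S" "(a, b) \<in> E" for a b
      using bip[OF that] by auto
  qed (use uv(1,2) \<open>u \<noteq> v\<close> in auto)
qed

lemma biperfect_bipartite_max_degree_2:
  fixes f :: "'a \<Rightarrow> bool"
  assumes fin: "finite V" and irr: "irrefl E" and sym: "\<And>u v. (u, v) \<in> E \<Longrightarrow> (v, u) \<in> E"
    and bip: "\<And>u v. u \<in> V \<Longrightarrow> v \<in> V \<Longrightarrow> (u, v) \<in> E \<Longrightarrow> f u \<noteq> f v"
    and deg: "\<And>u. u \<in> V \<Longrightarrow> card (E `` {u} \<inter> V) \<le> 2"
  shows "biperfect E V"
  unfolding biperfect_def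
proof (intro allI impI conjI)
  fix S assume S: "S \<subseteq> V"
  have bipS: "f u \<noteq> f v" if "u \<in> S" "v \<in> S" "(u, v) \<in> E" for u v
    using bip that S by blast
  show "chi_eq_omega E S"
    by (rule chi_eq_omega_bipartite[OF irr sym bipS])
  show "chi_eq_omega (non_arcs E) S"
  proof (rule konig_max_degree_2[of S E f])
    show "card (E `` {u} \<inter> S) \<le> 2" if "u \<in> S" for u
    proof (rule order_trans[OF card_mono deg])
      show "u \<in> V" using that S by blast
    qed (use fin S in auto)
  qed (use finite_subset[OF S fin] irr sym bipS in blast)+
qed

text \<open>
  The bound \<open>4\<close> means two edges, since an edge consists of two arcs.
\<close>

lemma biperfect_few_arcs:
  assumes fin: "finite V" and irr: "irrefl E" and sym: "\<And>u v. (u, v) \<in> E \<Longrightarrow> (v, u) \<in> E"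
    and few: "card (E \<inter> V \<times> V) \<le> 4"
  shows "biperfect E V"
proof -
  define A where "A = E \<inter> V \<times> V"
  have finA: "finite A" and irrA: "(u, u) \<notin> A" for u
    using fin irr by (auto simp: A_def irrefl_def)
  have symA: "(v, u) \<in> A" if "(u, v) \<in> A" for u v
    using that sym[of u v] by (simp add: A_def)
  have deg: "card (E `` {u} \<inter> V) \<le> 2" if "u \<in> V" for u
  proof -
    let ?N = "E `` {u} \<inter> V"
    have N: "finite ?N" "u \<notin> ?N" using fin irr by (auto simp: irrefl_def)
    have sub: "Pair u ` ?N \<union> (\<lambda>v. (v, u)) ` ?N \<subseteq> A"
    proof -
      have "(u, v) \<in> A" if "v \<in> ?N" for v using that \<open>u \<in> V\<close> by (simp add: A_def)
      thus ?thesis using symA by blast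
    qed
    have "2 * card ?N = card (Pair u ` ?N) + card ((\<lambda>v. (v, u)) ` ?N)"
      by (simp add: card_image inj_on_def)
    also have "\<dots> = card (Pair u ` ?N \<union> (\<lambda>v. (v, u)) ` ?N)"
      using N by (intro card_Un_disjoint[symmetric]) auto
    also have "\<dots> \<le> card A" by (rule card_mono[OF finA sub])
    finally show ?thesis using few by (simp add: A_def)
  qed
  have "\<exists>f :: 'a \<Rightarrow> bool. \<forall>(u, v)\<in>A. f u \<noteq> f v"
  proof (cases "A = {}")
    case False
    then obtain a b where ab: "(a, b) \<in> A" by auto
    have ne: "a \<noteq> b" using ab irrA by blast
    define B where "B = A - {(a, b), (b, a)}"
    have cB: "card B \<le> 2"
    proof -
      have "card B = card A - card {(a, b), (b, a)}"
        unfolding B_def using ab symA[OF ab] by (intro card_Diff_subset) auto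
      thus ?thesis using few ne by (simp add: A_def)
    qed
    show ?thesis
    proof (cases "B = {}")
      case True
      hence "A \<subseteq> {(a, b), (b, a)}" by (auto simp: B_def)
      thus ?thesis using ne by (intro exI[of _ "\<lambda>u. u = a"]) auto
    next
      case False
      then obtain c d where cd: "(c, d) \<in> B" by auto
      have dc: "(d, c) \<in> B" using cd symA[of c d] by (auto simp: B_def)
      have ne': "c \<noteq> d" using cd irrA by (auto simp: B_def)
      have "{(c, d), (d, c)} = B"
      proof (rule card_seteq)
        show "finite B" using finA by (simp add: B_def)
        show "card B \<le> card {(c, d), (d, c)}" using cB ne' by simp
      qed (use cd dc in auto)
      hence A: "A \<subseteq> {(a, b), (b, a), (c, d), (d, c)}" by (auto simp: B_def)
      have diff: "\<not> (c = a \<and> d = b)" "\<not> (c = b \<and> d = a)" using cd by (auto simp: B_def)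
      (* An endpoint shared by the two edges alone forms one colour class; otherwise take one endpoint of each. *)
      consider "c = a \<or> d = a" | "c = b \<or> d = b" | "a \<noteq> c" "a \<noteq> d" "b \<noteq> c" "b \<noteq> d" by blast
      thus ?thesis
      proof cases
        case 1
        thus ?thesis using A ne ne' by (intro exI[of _ "\<lambda>u. u = a"]) auto
      next
        case 2
        thus ?thesis using A ne ne' by (intro exI[of _ "\<lambda>u. u = b"]) auto
      next
        case 3
        thus ?thesis using A ne ne' by (intro exI[of _ "\<lambda>u. u = a \<or> u = c"]) auto
      qed
    qed
  qed auto
  then obtain f :: "'a \<Rightarrow> bool" where f: "\<forall>(u, v)\<in>A. f u \<noteq> f v" ..
  show ?thesis
  proof (rule biperfect_bipartite_max_degree_2[OF fin irr sym _ deg])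
    show "f u \<noteq> f v" if "u \<in> V" "v \<in> V" "(u, v) \<in> E" for u v
      using f that by (auto simp: A_def)
  qed
qed

text \<open>
  Adjacency is transitive up to loops, so a vertex and its neighbours form a complete component,
  which is split off.
\<close>

lemma biperfect_disjoint_cliques:
  assumes fin: "finite V" and irr: "irrefl E" and sym: "\<And>u v. (u, v) \<in> E \<Longrightarrow> (v, u) \<in> E"
    and trans: "\<And>u v x. u \<in> V \<Longrightarrow> v \<in> V \<Longrightarrow> x \<in> V \<Longrightarrow> (u, v) \<in> E \<Longrightarrow> (v, x) \<in> E \<Longrightarrow> u \<noteq> x \<Longrightarrow> (u, x) \<in> E"
  shows "biperfect E V"
  using fin trans
proof (induction "card V" arbitrary: V rule: less_induct)
  case less
  have fin: "finite V" and trans: "\<And>u v x. u \<in> V \<Longrightarrow> v \<in> V \<Longrightarrow> x \<in> V \<Longrightarrow> (u, v) \<in> E \<Longrightarrow> (v, x) \<in> E \<Longrightarrow> u \<noteq> x \<Longrightarrow> (u, x) \<in> E"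
    by fact+
  show ?case
  proof (cases "V = {}")
    case True
    show ?thesis unfolding True by (rule biperfect_complete[OF _ irr]) auto
  next
    case False
    then obtain v where v: "v \<in> V" by blast
    let ?A = "insert v (E `` {v} \<inter> V)" and ?B = "V - insert v (E `` {v} \<inter> V)"
    have "biperfect E ?A"
    proof (rule biperfect_complete[OF _ irr])
      show "(a, b) \<in> E" if "a \<in> ?A" "b \<in> ?A" "a \<noteq> b" for a b
      proof -
        have va: "a \<noteq> v \<Longrightarrow> (a, v) \<in> E" using that(1) sym[of v a] by auto
        have vb: "b \<noteq> v \<Longrightarrow> (v, b) \<in> E" using that(2) by auto
        have ab: "a \<in> V" "b \<in> V" using that v by auto
        show ?thesis
          using va vb that(3) trans[OF ab(1) v ab(2)] by (cases "a = v"; cases "b = v") auto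
      qed
    qed (use fin in simp)
    moreover have "biperfect E ?B"
    proof (rule less.hyps)
      show "card ?B < card V" using v fin by (intro psubset_card_mono) auto
      show "(u, x) \<in> E" if "u \<in> ?B" "v \<in> ?B" "x \<in> ?B" "(u, v) \<in> E" "(v, x) \<in> E" "u \<noteq> x" for u v x
        using that by (intro trans[of u v x]) auto
    qed (use fin in simp)
    ultimately have "biperfect E (?A \<union> ?B)"
    proof (rule biperfect_disjoint_union)
      show "(a, b) \<notin> E \<and> (b, a) \<notin> E" if ab: "a \<in> ?A" "b \<in> ?B" for a b
      proof -
        have "(a, b) \<notin> E"
        proof
          assume e: "(a, b) \<in> E"
          show False
          proof (cases "a = v")
            case True
            thus False using ab e by auto
          next
            case False
            hence "(v, b) \<in> E" using ab v e by (intro trans[of v a b]) auto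
            thus False using ab by auto
          qed
        qed
        thus ?thesis using sym[of b a] by blast
      qed
    qed (use fin irr in auto)
    moreover have "?A \<union> ?B = V" using v by auto
    ultimately show ?thesis by simp
  qed
qed

section \<open>The join of a complete graph and disjoint cycles\<close>

text \<open>
  The graph \<open>F\<close> with whose spectrum the given one is compared, \<open>W\<close> being the complete part and \<open>C\<close> the
  cycles. The functions \<open>nxt\<close> and \<open>prv\<close> step around a cycle.
\<close>

locale cycle_cone =
  fixes w m n :: nat
  assumes w: "w \<ge> 1" and m: "m \<ge> 1" and n: "n \<ge> 3"
begin

definition "F = graph_join (complete_graph w) (graph_copies m (cycle_graph n))"

definition W :: "(nat + nat \<times> nat) set" where "W = Inl ` {..<w}"
definition C :: "(nat + nat \<times> nat) set" where "C = Inr ` ({..<m} \<times> {..<n})"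

definition nxt :: "nat \<Rightarrow> nat" where "nxt i = (if Suc i = n then 0 else Suc i)"
definition prv :: "nat \<Rightarrow> nat" where "prv i = (if i = 0 then n - 1 else i - 1)"

lemma Suc_mod: "i < n \<Longrightarrow> Suc i mod n = nxt i"
  by (simp add: nxt_def)

lemma nxt_prv:
  assumes "i < n"
  shows "nxt i < n" "prv i < n" "nxt i \<noteq> prv i" "nxt i \<noteq> i" "j < n \<Longrightarrow> i = nxt j \<longleftrightarrow> j = prv i"
  using assms n by (auto simp: nxt_def prv_def)

lemma pverts_F: "pverts F = W \<union> C"
  by (auto simp: F_def W_def C_def graph_join_def complete_graph_def graph_copies_def cycle_graph_def)

lemma parcs_F:
  "(Inl u, Inl v) \<in> parcs F \<longleftrightarrow> u < w \<and> v < w \<and> u \<noteq> v"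
  "(Inl u, Inr (b, j)) \<in> parcs F \<longleftrightarrow> u < w \<and> b < m \<and> j < n"
  "(Inr (a, i), Inl v) \<in> parcs F \<longleftrightarrow> v < w \<and> a < m \<and> i < n"
  "(Inr (a, i), Inr (b, j)) \<in> parcs F \<longleftrightarrow> a = b \<and> a < m \<and> i < n \<and> j < n \<and> (j = nxt i \<or> i = nxt j)"
  by (auto simp: F_def graph_join_def complete_graph_def graph_copies_def cycle_graph_def Suc_mod)

lemma W_C: "W \<inter> C = {}" "finite W" "finite C" "card W = w" "card C = m * n"
  by (auto simp: W_def C_def card_image card_cartesian_product)

sublocale cone "pverts F" "parcs F" W C
proof
  show "finite (pverts F)" by (simp add: pverts_F W_C)
  show "parcs F \<subseteq> pverts F \<times> pverts F"
  proof
    fix e assume e: "e \<in> parcs F"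
    obtain x y where xy: "e = (x, y)" by (cases e)
    show "e \<in> pverts F \<times> pverts F"
      using e unfolding xy pverts_F W_def C_def
      by (cases x; cases y) (auto simp: parcs_F split: prod.splits)
  qed
  show "(v, u) \<in> parcs F" if "(u, v) \<in> parcs F" for u v
    using that by (cases u; cases v) (auto simp: parcs_F)
  show "(u, u) \<notin> parcs F" for u
    using nxt_prv(4)[symmetric] by (cases u) (auto simp: parcs_F)
  show "(u, v) \<in> parcs F" if "u \<in> W" "v \<in> pverts F" "u \<noteq> v" for u v
    using that by (auto simp: W_def C_def pverts_F parcs_F)
qed (use pverts_F W_C in auto)

lemma card_F: "card (pverts F) = w + m * n"
  using W_C by (simp add: pverts_F card_Un_disjoint)

lemma nbrs_cycle:
  assumes "a < m" "i < n"
  shows "H `` {Inr (a, i)} = {Inr (a, nxt i), Inr (a, prv i)}"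
proof -
  have "(Inr (a, i), u) \<in> H \<longleftrightarrow> u = Inr (a, nxt i) \<or> u = Inr (a, prv i)" for u
  proof (cases u)
    case (Inr p)
    then obtain b j where "u = Inr (b, j)" by (cases p) auto
    thus ?thesis
      using assms nxt_prv[OF assms(2)] by (auto simp: parcs_F C_def)
  qed (auto simp: C_def)
  thus ?thesis by auto
qed

lemma lap_cycle:
  assumes "a < m" "i < n"
  shows "lap H x (Inr (a, i)) = 2 * x (Inr (a, i)) - x (Inr (a, nxt i)) - x (Inr (a, prv i))"
  unfolding lap_def nbrs_cycle[OF assms] using nxt_prv(3)[OF assms(2)] by simp

lemma deg_cycle: "u \<in> C \<Longrightarrow> deg H u = 2"
proof -
  assume "u \<in> C"
  then obtain a i where u: "a < m" "i < n" "u = Inr (a, i)" by (auto simp: C_def)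
  show "deg H u = 2"
    unfolding deg_def u(3) nbrs_cycle[OF u(1,2)] using nxt_prv(3)[OF u(2)] by simp
qed

lemma deg_F: "u \<in> W \<Longrightarrow> deg (parcs F) u = w + m * n - 1" "u \<in> C \<Longrightarrow> deg (parcs F) u = w + 2"
  using deg_W deg_C deg_cycle by (auto simp: card_F W_C)

lemma sum_deg_F:
  "(\<Sum>u\<in>pverts F. deg (parcs F) u) = w * (w + m * n - 1) + m * n * (w + 2)"
  "(\<Sum>u\<in>pverts F. (deg (parcs F) u)\<^sup>2) = w * (w + m * n - 1)\<^sup>2 + m * n * (w + 2)\<^sup>2"
  unfolding pverts_F using W_C by (simp_all add: sum.union_disjoint deg_F)

text \<open>
  The complement of \<open>F\<close> has at least \<open>w + 1\<close> components: the \<open>w\<close> vertices of \<open>W\<close> and the rest. The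
  eigenfunctions are constant on them and have sum zero.
\<close>

lemma mult_full: "multiplicity_ge (pverts F) (parcs F) (real (w + m * n)) w"
proof (rule multiplicity_geI[where p = Inl])
  (* The value \<open>m n\<close> at one vertex is balanced by \<open>-1\<close> at each of the \<open>m n\<close> vertices of the cycles. *)
  fix i assume i: "i < w"
  let ?x = "\<lambda>u. if u = Inl i then real (m * n) else if u \<in> C then -1 else 0"
  have iW: "Inl i \<in> W" "Inl i \<notin> C" using i by (auto simp: W_def C_def)
  have sW: "(\<Sum>u\<in>W. ?x u) = real (m * n)"
  proof -
    have "(\<Sum>u\<in>W. ?x u) = (\<Sum>u\<in>W. if u = Inl i then real (m * n) else 0)"
      using W_C by (intro sum.cong) auto
    thus ?thesis using iW W_C by simp
  qed
  have "(\<Sum>u\<in>C. ?x u) = (\<Sum>u\<in>C. -1)" using iW by (intro sum.cong) auto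
  hence sC: "(\<Sum>u\<in>C. ?x u) = - real (m * n)" using W_C by simp
  have s: "(\<Sum>u\<in>pverts F. ?x u) = 0"
    unfolding pverts_F sum.union_disjoint[OF W_C(2,3,1)] sW sC by simp
  show "eigenfunction (pverts F) (parcs F) (real (w + m * n)) ?x"
    unfolding eigenfunction_def
  proof
    fix u assume "u \<in> pverts F"
    then consider "u \<in> W" | "u \<in> C" by (auto simp: pverts_F)
    thus "lap (parcs F) ?x u = real (w + m * n) * ?x u"
    proof cases
      case 1
      thus ?thesis using lap_W[of u ?x] s by (simp add: card_F)
    next
      case 2
      have "lap H ?x u = 0" unfolding lap_def using iW 2 by (intro sum.neutral) auto
      thus ?thesis using lap_C[OF 2, of ?x] sW iW 2 by (auto simp: W_C)
    qed
  qed
  show "Inl i \<in> pverts F" using iW by (simp add: pverts_F)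
  show "?x (Inl i) \<noteq> 0" using m n by simp
  show "?x (Inl j) = 0" if "i \<noteq> j" for j using that by (auto simp: C_def)
qed

lemma sum_C: "(\<Sum>u\<in>C. f u) = (\<Sum>a<m. \<Sum>i<n. f (Inr (a, i)))"
  unfolding C_def by (subst sum.reindex) (auto simp: sum.cartesian_product)

lemma eigenfunction_F:
  assumes "eigenfunction C H l x" "(\<Sum>u\<in>C. x u) = 0" "\<And>i. x (Inl i) = 0"
  shows "eigenfunction (pverts F) (parcs F) (real w + l) x"
proof -
  have "x u = 0" if "u \<in> W" for u using that assms(3) by (auto simp: W_def)
  thus ?thesis using eigenfunction_coneI[OF assms(1,2)] by (simp add: W_C)
qed

text \<open>
  Functions that are constant on the cycles and have sum zero; cycle \<open>m - 1\<close> compensates for cycle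
  \<open>a\<close>.
\<close>

lemma mult_components: "multiplicity_ge (pverts F) (parcs F) (real w) (m - 1)"
proof (rule multiplicity_geI[where p = "\<lambda>a. Inr (a, 0)"])
  fix a assume a: "a < m - 1"
  let ?c = "\<lambda>b. if b = a then 1 else if b = m - 1 then -1 else (0::real)"
  let ?x = "\<lambda>u. case u of Inl _ \<Rightarrow> 0 | Inr (b, j) \<Rightarrow> ?c b"
  have "(\<Sum>b<m. ?c b) = 0"
  proof -
    have "(\<Sum>b<m. ?c b) = (\<Sum>b<m. (if b = a then 1 else 0) - (if b = m - 1 then 1 else 0))"
      using a by (intro sum.cong) auto
    thus ?thesis using a m by (simp add: sum_subtractf)
  qed
  hence "(\<Sum>u\<in>C. ?x u) = 0" unfolding sum_C by (simp add: sum_distrib_left[symmetric])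
  moreover have "eigenfunction C H 0 ?x"
    unfolding H.eigenfunction_0_iff by (auto simp: C_def parcs_F)
  ultimately show "eigenfunction (pverts F) (parcs F) (real w) ?x"
    using eigenfunction_F[of 0 ?x] by simp
  show "Inr (a, 0) \<in> pverts F" using a n by (auto simp: pverts_F C_def)
  show "?x (Inr (a, 0)) \<noteq> 0" by simp
  show "?x (Inr (b, 0)) = 0" if "b < m - 1" "a \<noteq> b" for b using that by simp
qed

lemma cycle_constant:
  assumes "\<And>i. Suc i < n \<Longrightarrow> y (Suc i) = (y i :: real)" "i < n"
  shows "y i = y 0"
  using assms(2) by (induction i) (simp_all add: assms(1))

text \<open>
  Such an eigenfunction vanishes on \<open>W\<close> and is constant on the cycles, and its sum is zero. So its
  values on all cycles but one determine it.
\<close>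

lemma mult_components_le:
  assumes "multiplicity_ge (pverts F) (parcs F) (real w) k"
  shows "k \<le> m - 1"
proof -
  let ?R = "(\<lambda>a. Inr (a, 0) :: nat + nat \<times> nat) ` {..<m - 1}"
  have "k \<le> card ?R"
  proof (rule multiplicity_le[OF assms])
    fix x assume x: "eigenfunction (pverts F) (parcs F) (real w) x" and R: "\<forall>r\<in>?R. x r = 0"
    have l: "real w \<noteq> 0" "real w \<noteq> real (card (pverts F))" using w m n by (auto simp: card_F)
    note xW = eigenfunction_cone(1)[OF x l] and sum = eigenfunction_cone(2)[OF x l]
    have "eigenfunction C H 0 x" using eigenfunction_cone(3)[OF x l] by (simp add: W_C)
    hence "x (Inr (a, Suc i)) = x (Inr (a, i))" if "a < m" "Suc i < n" for a i
      using that unfolding H.eigenfunction_0_iff by (fastforce simp: parcs_F C_def nxt_def)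
    hence const: "x (Inr (a, i)) = x (Inr (a, 0))" if "a < m" "i < n" for a i
      using that cycle_constant[of "\<lambda>i. x (Inr (a, i))" i] by blast
    have "(\<Sum>a<m. \<Sum>i<n. x (Inr (a, i))) = (\<Sum>a<m. if a = m - 1 then real n * x (Inr (a, 0)) else 0)"
    proof (rule sum.cong)
      fix a assume a: "a \<in> {..<m}"
      have "(\<Sum>i<n. x (Inr (a, i))) = (\<Sum>i<n. x (Inr (a, 0)))"
        using a by (intro sum.cong refl const) auto
      also have "\<dots> = real n * x (Inr (a, 0))" by simp
      also have "\<dots> = (if a = m - 1 then real n * x (Inr (a, 0)) else 0)"
        using R a by auto
      finally show "(\<Sum>i<n. x (Inr (a, i))) = (if a = m - 1 then real n * x (Inr (a, 0)) else 0)" .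
    qed simp
    hence "x (Inr (m - 1, 0)) = 0" using sum m n unfolding sum_C by simp
    with R have "x (Inr (a, 0)) = 0" if "a < m" for a
      using that by (cases "a = m - 1") auto
    with const xW show "\<forall>u\<in>pverts F. x u = 0" by (auto simp: pverts_F C_def)
  qed simp
  thus ?thesis by (simp add: card_image inj_on_def)
qed

lemma mult_even:
  assumes "even n"
  shows "multiplicity_ge (pverts F) (parcs F) (real w + 4) m"
proof (rule multiplicity_geI[where p = "\<lambda>a. Inr (a, 0)"])
  fix a assume a: "a < m"
  let ?x = "\<lambda>u :: nat + nat \<times> nat. case u of Inl _ \<Rightarrow> 0 | Inr (b, j) \<Rightarrow> if b = a then (-1) ^ j else (0::real)"
  have nxt: "(-1) ^ nxt j = - ((-1) ^ j :: real)" for j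
    using assms by (auto simp: nxt_def)
  have "eigenfunction C H 4 ?x"
  proof (rule H.alternating_eigenfunction[OF deg_cycle])
    show "?x v = - ?x u" if "(u, v) \<in> H" for u v
      using that nxt by (auto simp: C_def parcs_F)
  qed
  thus "eigenfunction (pverts F) (parcs F) (real w + 4) ?x"
    using eigenfunction_F[of 4 ?x] H.eigenfunction_sum_0[of 4 ?x] by simp
  show "Inr (a, 0) \<in> pverts F" using a n by (auto simp: pverts_F C_def)
qed auto

text \<open>
  On the cycles it is an eigenfunction for \<open>4\<close> and changes its sign along every edge, which is
  impossible around an odd cycle unless it vanishes.
\<close>

lemma odd_no_eigenvalue:
  assumes "odd n" and x: "eigenfunction (pverts F) (parcs F) (real w + 4) x" and u: "u \<in> pverts F"
  shows "x u = 0"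
proof -
  have "m * n \<noteq> 4"
  proof
    assume "m * n = 4"
    hence "n dvd 4" by (metis dvd_triv_right)
    hence "n \<le> 4" by (intro dvd_imp_le) auto
    with n \<open>odd n\<close> have "n = 3" by presburger
    thus False using \<open>m * n = 4\<close> by presburger
  qed
  hence l: "real w + 4 \<noteq> 0" "real w + 4 \<noteq> real (card (pverts F))"
    by (auto simp: card_F simp flip: of_nat_mult)
  have "eigenfunction C H 4 x" using eigenfunction_cone(3)[OF x l] by (simp add: W_C)
  note alt = H.eigenfunction_4_alternates[OF deg_cycle this]
  have step: "x (Inr (a, nxt i)) = - x (Inr (a, i))" if "a < m" "i < n" for a i
    using that nxt_prv(1) by (intro alt) (auto simp: C_def parcs_F)
  have pow: "x (Inr (a, i)) = (-1) ^ i * x (Inr (a, 0))" if "a < m" "i < n" for a i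
    using that(2)
  proof (induction i)
    case (Suc i)
    thus ?case using step[OF that(1), of i] by (simp add: nxt_def)
  qed simp
  have "x (Inr (a, 0)) = 0" if "a < m" for a
  proof -
    have "x (Inr (a, 0)) = - x (Inr (a, n - 1))" using step[OF that, of "n - 1"] n by (simp add: nxt_def)
    thus ?thesis using pow[OF that, of "n - 1"] assms(1) n by simp
  qed
  with pow show ?thesis
    using u eigenfunction_cone(1)[OF x l] by (auto simp: pverts_F C_def)
qed

text \<open>
  One of the eigenfunctions of the cycle for its smallest nonzero eigenvalue, placed on the first
  cycle.
\<close>

lemma cos_eigenvalue:
  "multiplicity_ge (pverts F) (parcs F) (real w + (2 - 2 * cos (2 * pi / n))) 1"
proof -
  define t where "t = 2 * pi / n"
  have nt: "real n * t = 2 * pi" using n by (simp add: t_def)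
  let ?x = "\<lambda>u :: nat + nat \<times> nat. case u of Inl _ \<Rightarrow> 0 | Inr (b, j) \<Rightarrow> if b = 0 then cos (j * t) else 0"
  have nxt: "cos (nxt j * t) = cos (j * t + t)" for j
  proof (cases "Suc j = n")
    case True
    have "j * t + t = real (Suc j) * t" by (simp add: algebra_simps)
    also have "\<dots> = 2 * pi" using nt True by simp
    finally show ?thesis using True by (simp add: nxt_def)
  qed (simp add: nxt_def algebra_simps)
  have prv: "cos (prv j * t) = cos (j * t - t)" for j
  proof (cases j)
    case 0
    have "real (n - 1) * t = 2 * pi - t" using nt n by (simp add: of_nat_diff algebra_simps)
    thus ?thesis using 0 by (simp add: prv_def cos_diff)
  qed (simp add: prv_def algebra_simps)
  have eig: "eigenfunction C H (2 - 2 * cos t) ?x"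
    unfolding eigenfunction_def
  proof
    fix u assume "u \<in> C"
    then obtain a i where u: "a < m" "i < n" "u = Inr (a, i)" by (auto simp: C_def)
    show "lap H ?x u = (2 - 2 * cos t) * ?x u"
      unfolding u(3) lap_cycle[OF u(1,2)] using nxt prv
      by (simp add: cos_add cos_diff algebra_simps)
  qed
  have "0 < t" "t < pi" using n by (auto simp: t_def field_simps)
  hence "cos t < cos 0" by (intro cos_monotone_0_pi) auto
  hence "eigenfunction (pverts F) (parcs F) (real w + (2 - 2 * cos t)) ?x"
    using eigenfunction_F[OF eig] H.eigenfunction_sum_0[OF eig] by simp
  thus ?thesis
    unfolding t_def[symmetric]
    by (intro multiplicity_geI[where x = "\<lambda>_. ?x" and p = "\<lambda>_. Inr (0, 0)"])
       (use m n in \<open>auto simp: pverts_F C_def\<close>)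
qed

text \<open>
  The equations for the eigenvalue \<open>3\<close> of \<open>C\<^sub>5\<close> say that any three consecutive values sum to zero,
  so the values have period three as well as period five; they are constant and therefore zero.
\<close>

lemma pentagon_no_eigenvalue:
  assumes "m = 1" "n = 5" and x: "eigenfunction (pverts F) (parcs F) (real w + 3) x" and u: "u \<in> pverts F"
  shows "x u = 0"
proof -
  have l: "real w + 3 \<noteq> 0" "real w + 3 \<noteq> real (card (pverts F))"
    using assms(1,2) unfolding card_F by auto
  have "eigenfunction C H 3 x" using eigenfunction_cone(3)[OF x l] by (simp add: W_C)
  hence eq: "2 * x (Inr (0, i)) - x (Inr (0, nxt i)) - x (Inr (0, prv i)) = 3 * x (Inr (0, i))" if "i < n" for i
    using that lap_cycle[of 0 i x] m unfolding eigenfunction_def C_def by fastforce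
  have "nxt 0 = 1" "nxt 1 = 2" "nxt 2 = 3" "nxt 3 = 4" "nxt 4 = 0"
    "prv 0 = 4" "prv 1 = 0" "prv 2 = 1" "prv 3 = 2" "prv 4 = 3"
    using assms(2) unfolding nxt_def prv_def by simp_all
  note vals = this and eqs = eq[of 0] eq[of 1] eq[of 2] eq[of 3] eq[of 4]
  have 0: "x (Inr (0, 0)) = 0" "x (Inr (0, 1)) = 0" "x (Inr (0, 2)) = 0" "x (Inr (0, 3)) = 0" "x (Inr (0, 4)) = 0"
    using eqs n unfolding vals unfolding assms(2) by simp_all
  have "i = 0 \<or> i = 1 \<or> i = 2 \<or> i = 3 \<or> i = 4" if "i < 5" for i :: nat using that by presburger
  hence "x (Inr (0, i)) = 0" if "i < 5" for i using 0 that by blast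
  moreover have "u \<in> W \<or> (\<exists>i<5. u = Inr (0, i))"
    using u assms(1,2) unfolding pverts_F C_def by auto
  ultimately show ?thesis using eigenfunction_cone(1)[OF x l] by blast
qed

end

section \<open>The complement of a cospectral graph\<close>

lemma multiplicity_ge_mono:
  assumes "multiplicity_ge V E l k" "k' \<le> k"
  shows "multiplicity_ge V E l k'"
proof -
  obtain x where x: "\<forall>i<k. eigenfunction V E l (x i)" and ind: "independent_on V k x"
    using assms(1) by (auto simp: multiplicity_ge_def)
  have "\<forall>i<k'. c i = 0" if c: "\<forall>u\<in>V. (\<Sum>i<k'. c i * x i u) = 0" for c
  proof -
    let ?d = "\<lambda>i. if i < k' then c i else 0"
    have "(\<Sum>i<k. ?d i * x i u) = (\<Sum>i<k'. c i * x i u)" for u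
      using assms(2) by (intro sum.mono_neutral_cong_right) auto
    moreover have "(\<forall>u\<in>V. (\<Sum>i<k. ?d i * x i u) = 0) \<longrightarrow> (\<forall>i<k. ?d i = 0)"
      using ind unfolding independent_on_def by (rule spec)
    ultimately have "\<forall>i<k. ?d i = 0" using c by simp
    thus ?thesis using assms(2) by (auto split: if_splits)
  qed
  hence "independent_on V k' x" by (simp add: independent_on_def)
  thus ?thesis using x assms(2) unfolding multiplicity_ge_def by (meson less_le_trans)
qed

lemma multiplicity_ge_1_iff:
  "multiplicity_ge V E l 1 \<longleftrightarrow> (\<exists>x. eigenfunction V E l x \<and> (\<exists>u\<in>V. x u \<noteq> 0))"
proof
  assume "multiplicity_ge V E l 1"
  then obtain x where "eigenfunction V E l (x 0)" and ind: "independent_on V 1 x"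
    by (auto simp: multiplicity_ge_def)
  moreover have "\<exists>u\<in>V. x 0 u \<noteq> 0"
  proof (rule ccontr)
    assume "\<not> ?thesis"
    hence "\<forall>u\<in>V. (\<Sum>i<1. 1 * x i u) = 0" by simp
    moreover have "(\<forall>u\<in>V. (\<Sum>i<1. 1 * x i u) = 0) \<longrightarrow> (\<forall>i<1::nat. (1::real) = 0)"
      using ind unfolding independent_on_def by (rule spec[where x = "\<lambda>_. 1"])
    ultimately show False by auto
  qed
  ultimately show "\<exists>x. eigenfunction V E l x \<and> (\<exists>u\<in>V. x u \<noteq> 0)" by blast
next
  assume "\<exists>x. eigenfunction V E l x \<and> (\<exists>u\<in>V. x u \<noteq> 0)"
  then obtain x u where "eigenfunction V E l x" "u \<in> V" "x u \<noteq> 0" by blast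
  thus "multiplicity_ge V E l 1"
    by (intro multiplicity_geI[where x = "\<lambda>_. x" and p = "\<lambda>_. u"]) auto
qed

context simple_graph
begin

definition component :: "'a \<Rightarrow> 'a set" where "component u = E\<^sup>* `` {u}"

lemma component_self: "u \<in> component u"
  by (simp add: component_def)

lemma component_eq: "v \<in> component u \<Longrightarrow> component v = component u"
proof -
  assume v: "v \<in> component u"
  have "sym E" using E_sym by (auto intro: symI)
  hence "sym (E\<^sup>*)" by (rule sym_rtrancl)
  hence "(v, u) \<in> E\<^sup>*" using v by (auto simp: component_def dest: symD)
  thus ?thesis using v by (auto simp: component_def intro: rtrancl_trans)
qed

lemma component_arc: "(u, v) \<in> E \<Longrightarrow> component v = component u"
  by (rule component_eq) (auto simp: component_def)

lemma component_sub: "u \<in> V \<Longrightarrow> component u \<subseteq> V"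
proof -
  assume u: "u \<in> V"
  have "v \<in> V" if "(u, v) \<in> E\<^sup>*" for v
    using that by (induction rule: rtrancl_induct) (use u E_in in auto)
  thus ?thesis by (auto simp: component_def)
qed

lemma component_closed: "E `` component u \<subseteq> component u"
  by (auto simp: component_def intro: rtrancl_into_rtrancl)

lemma constant_on_component:
  assumes "\<And>u v. (u, v) \<in> E \<Longrightarrow> x v = x u" "v \<in> component u"
  shows "x v = x u"
proof -
  have "(u, v) \<in> E\<^sup>*" using assms(2) by (simp add: component_def)
  thus ?thesis by (induction rule: rtrancl_induct) (simp_all add: assms(1))
qed

lemma eigenvalue_le_card_component:
  assumes "multiplicity_ge V E l 1"
  shows "\<exists>u\<in>V. l \<le> real (card (component u))"
proof -
  obtain x u where "eigenfunction V E l x" "u \<in> V" "x u \<noteq> 0"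
    using assms unfolding multiplicity_ge_1_iff by blast
  thus ?thesis
    using eigenvalue_le_card_closed[of l x "component u" u] component_sub[of u] component_closed[of u] component_self[of u]
    by auto
qed

definition rep :: "'a \<Rightarrow> 'a" where "rep u = (SOME v. v \<in> component u)"

definition reps :: "'a set" where "reps = rep ` V"

lemma rep_in_component: "rep u \<in> component u"
  unfolding rep_def by (rule someI[of _ u]) (rule component_self)

lemma component_rep: "component (rep u) = component u"
  by (rule component_eq[OF rep_in_component])

lemma reps_sub: "reps \<subseteq> V"
  using rep_in_component component_sub by (auto simp: reps_def)

lemma finite_reps: "finite reps"
  by (simp add: reps_def finite_V)

lemma rep_of:
  assumes "u \<in> V"
  obtains p where "p \<in> reps" "u \<in> component p"
proof
  show "rep u \<in> reps" using assms by (simp add: reps_def)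
  show "u \<in> component (rep u)" by (simp add: component_rep component_self)
qed

lemma rep_unique:
  assumes "p \<in> reps" "q \<in> reps" "u \<in> component p" "u \<in> component q"
  shows "p = q"
proof -
  obtain v where v: "p = rep v" using assms(1) by (auto simp: reps_def)
  obtain v' where v': "q = rep v'" using assms(2) by (auto simp: reps_def)
  have "component v = component u" "component v' = component u"
    using component_eq[OF assms(3)] component_eq[OF assms(4)] by (simp_all add: v v' component_rep)
  thus ?thesis unfolding v v' rep_def by simp
qed

lemma component_reps: "p \<in> reps \<Longrightarrow> component p \<subseteq> V"
  using component_sub[of p] reps_sub by auto

lemma finite_component: "p \<in> reps \<Longrightarrow> finite (component p)"
  by (rule finite_subset[OF component_reps finite_V])

lemma sum_card_component: "(\<Sum>p\<in>reps. card (component p)) = card V"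
proof -
  have "card (\<Union>p\<in>reps. component p) = (\<Sum>p\<in>reps. card (component p))"
  proof (rule card_UN_disjoint[OF finite_reps])
    show "\<forall>p\<in>reps. finite (component p)" using finite_component by simp
    show "\<forall>p\<in>reps. \<forall>q\<in>reps. p \<noteq> q \<longrightarrow> component p \<inter> component q = {}"
    proof (intro ballI impI equals0I)
      fix p q u assume "p \<in> reps" "q \<in> reps" "p \<noteq> q" "u \<in> component p \<inter> component q"
      thus False using rep_unique[of p q u] by simp
    qed
  qed
  moreover have "(\<Union>p\<in>reps. component p) = V"
  proof
    show "V \<subseteq> (\<Union>p\<in>reps. component p)"
    proof
      fix u assume "u \<in> V"
      then obtain p where "p \<in> reps" "u \<in> component p" by (rule rep_of)
      thus "u \<in> (\<Union>p\<in>reps. component p)" by blast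
    qed
    show "(\<Union>p\<in>reps. component p) \<subseteq> V" using component_reps by (rule UN_least)
  qed
  ultimately show ?thesis by simp
qed

end

text \<open>
  A graph that has the invariants of \<open>F\<close> determined by the Laplacian spectrum: the order, the degree sums and
  the dimensions of the eigenspaces.
\<close>

locale cospectral = simple_graph V E + F: cycle_cone w m n
  for V :: "'a set" and E :: "('a \<times> 'a) set" and w m n :: nat +
  assumes card_V: "card V = w + m * n"
    and sum_deg_V: "(\<Sum>u\<in>V. deg E u) = w * (w + m * n - 1) + m * n * (w + 2)"
      "(\<Sum>u\<in>V. (deg E u)\<^sup>2) = w * (w + m * n - 1)\<^sup>2 + m * n * (w + 2)\<^sup>2"
    and multiplicity_iff: "\<And>l k. multiplicity_ge V E l k \<longleftrightarrow> multiplicity_ge (pverts F.F) (parcs F.F) l k"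
begin

abbreviation "D \<equiv> compl_arcs V E"

sublocale D: simple_graph V D by (rule compl_simple_graph)

lemma w_m_n: "w \<ge> 1" "m \<ge> 1" "n \<ge> 3" "m * n \<ge> 3"
proof -
  show "w \<ge> 1" "m \<ge> 1" "n \<ge> 3" using F.w F.m F.n by auto
  thus "m * n \<ge> 3" using mult_le_mono[of 1 m 3 n] by simp
qed

lemma D_component_ge:
  assumes "multiplicity_ge V E l 1" "l \<noteq> 0"
  shows "\<exists>u\<in>V. real (w + m * n) - l \<le> real (card (D.component u))"
proof (rule D.eigenvalue_le_card_component)
  obtain x u where "eigenfunction V E l x" "u \<in> V" "x u \<noteq> 0"
    using assms(1) unfolding multiplicity_ge_1_iff by blast
  thus "multiplicity_ge V D (real (w + m * n) - l) 1"
    using eigenfunction_compl[of l x] assms(2) unfolding multiplicity_ge_1_iff card_V by blast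
qed

text \<open>
  The eigenfunctions of \<open>G\<close> for \<open>N\<close> are the functions with sum zero that are constant on the components
  of \<open>D\<close>. If every component other than that of \<open>c\<close> meets \<open>R\<close>, they are determined by their values on \<open>R\<close>.
\<close>

lemma D_component_count:
  assumes c: "c \<in> V" and fin: "finite R" and R: "\<And>u. u \<in> V - D.component c \<Longrightarrow> \<exists>r\<in>R. u \<in> D.component r"
  shows "w \<le> card R"
proof (rule multiplicity_le[OF _ fin])
  have "multiplicity_ge (pverts F.F) (parcs F.F) (real (w + m * n)) w" by (rule F.mult_full)
  thus "multiplicity_ge V E (real (w + m * n)) w" by (simp only: multiplicity_iff)
  fix x assume x: "eigenfunction V E (real (w + m * n)) x" and xR: "\<forall>r\<in>R. x r = 0"
  have "w + m * n \<noteq> 0" using w_m_n(1) by simp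
  hence N: "real (w + m * n) \<noteq> 0" by (simp only: of_nat_eq_0_iff not_False_eq_True)
  have "eigenfunction V D 0 x" using eigenfunction_compl[OF x N] by (simp add: card_V)
  hence step: "x v = x u" if "(u, v) \<in> D" for u v using that unfolding D.eigenfunction_0_iff by auto
  have const: "x v = x u" if "v \<in> D.component u" for u v
    using D.constant_on_component[OF step that] .
  have out: "x u = 0" if u: "u \<in> V - D.component c" for u
  proof -
    obtain r where "r \<in> R" "u \<in> D.component r" using R[OF u] by blast
    thus ?thesis using const[of u r] xR by simp
  qed
  have "(\<Sum>u\<in>V. x u) = (\<Sum>u\<in>D.component c. x u)"
    using out by (intro sum.mono_neutral_right finite_V D.component_sub c) auto
  also have "\<dots> = (\<Sum>u\<in>D.component c. x c)"
    using const[of _ c] by (intro sum.cong) auto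
  also have "\<dots> = real (card (D.component c)) * x c" by simp
  finally have "real (card (D.component c)) * x c = 0" using eigenfunction_sum_0[OF x N] by simp
  moreover have "finite (D.component c)"
    by (rule finite_subset[OF D.component_sub[OF c] finite_V])
  hence "card (D.component c) \<noteq> 0" using D.component_self[of c] by auto
  ultimately have "x c = 0" by simp
  show "\<forall>u\<in>V. x u = 0"
  proof
    fix u assume "u \<in> V"
    thus "x u = 0" using out[of u] const[of u c] \<open>x c = 0\<close> by (cases "u \<in> D.component c") auto
  qed
qed

lemma D_component_complement_ge:
  assumes c: "c \<in> V"
  shows "w \<le> card (V - D.component c)"
  by (rule D_component_count[OF c]) (use finite_V D.component_self in auto)

lemma card_D_component:
  assumes c: "c \<in> V"
  shows "card (D.component c) + card (V - D.component c) = w + m * n"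
  using D.component_sub[OF c] finite_V card_V card_mono[OF finite_V D.component_sub[OF c]]
  by (simp add: card_Diff_subset finite_subset)

text \<open>
  If a vertex \<open>u\<close> outside the large component had a neighbour in \<open>D\<close>, then the remaining outside vertices
  would still meet every other component, but there are only \<open>w - 1\<close> of them.
\<close>

lemma cone_of_large_component:
  assumes c: "c \<in> V" and large: "m * n \<le> card (D.component c)"
  shows "cone V E (V - D.component c) (D.component c)" "card (V - D.component c) = w"
    "card (D.component c) = m * n"
proof -
  show w: "card (V - D.component c) = w" and "card (D.component c) = m * n"
    using D_component_complement_ge[OF c] card_D_component[OF c] large by linarith+
  show "cone V E (V - D.component c) (D.component c)"
  proof
    show "(u, v) \<in> E" if u: "u \<in> V - D.component c" and v: "v \<in> V" and uv: "u \<noteq> v" for u v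
    proof (rule ccontr)
      assume "(u, v) \<notin> E"
      hence D: "(u, v) \<in> D" using u v uv by (simp add: compl_arcs_def)
      have same: "D.component v = D.component u" by (rule D.component_arc[OF D])
      have vC: "v \<notin> D.component c"
        using D.component_eq[of v c] same D.component_self[of u] u by auto
      let ?R = "V - D.component c - {u}"
      have "w \<le> card ?R"
      proof (rule D_component_count[OF c])
        fix x assume "x \<in> V - D.component c"
        moreover have "u \<in> D.component v" using same D.component_self[of u] by simp
        ultimately show "\<exists>r\<in>?R. x \<in> D.component r"
          using D.component_self[of x] v vC uv by (cases "x = u") auto
      qed (use finite_V in simp)
      moreover have "card ?R < card (V - D.component c)"
        using u finite_V by (intro psubset_card_mono) auto
      ultimately show False using w by simp
    qed
  qed (use D.component_sub[OF c] in auto)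
qed

text \<open>
  Degrees in \<open>G\<close> and \<open>D\<close> add up to \<open>N - 1\<close>, so the sums agree with those for the complement of \<open>F\<close>, where the \<open>m n\<close> vertices of the cycles have degree \<open>m n - 3\<close> and
  the other vertices are isolated.
\<close>

lemma sum_deg_D:
  "(\<Sum>u\<in>V. real (deg D u)) = real (m * n) * (real (m * n) - 3)"
  "(\<Sum>u\<in>V. (real (deg D u))\<^sup>2) = real (m * n) * (real (m * n) - 3)\<^sup>2"
proof -
  define M where "M = real (m * n)"
  define K where "K = real w + M - 1"
  have K: "real (w + m * n - 1) = K" using w_m_n(1) by (simp add: K_def M_def of_nat_diff)
  have d: "real (deg D u) = K - real (deg E u)" if "u \<in> V" for u
    using deg_compl[OF that] K unfolding card_V by linarith
  have s1: "(\<Sum>u\<in>V. real (deg E u)) = real w * K + M * (real w + 2)"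
    using arg_cong[OF sum_deg_V(1), of real] unfolding of_nat_sum of_nat_add of_nat_mult K M_def by simp
  have s2: "(\<Sum>u\<in>V. (real (deg E u))\<^sup>2) = real w * K\<^sup>2 + M * (real w + 2)\<^sup>2"
    using arg_cong[OF sum_deg_V(2), of real] unfolding of_nat_sum of_nat_add of_nat_mult of_nat_power K M_def by simp
  have N: "real (card V) = real w + M" by (simp add: card_V M_def)
  have "(\<Sum>u\<in>V. real (deg D u)) = (\<Sum>u\<in>V. K - real (deg E u))"
    by (rule sum.cong) (simp_all add: d)
  also have "\<dots> = (real w + M) * K - (real w * K + M * (real w + 2))"
    by (simp add: sum_subtractf s1 N)
  also have "\<dots> = M * (M - 3)" by (simp add: K_def algebra_simps)
  finally show "(\<Sum>u\<in>V. real (deg D u)) = real (m * n) * (real (m * n) - 3)" by (simp add: M_def)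
  have "(\<Sum>u\<in>V. (real (deg D u))\<^sup>2) = (\<Sum>u\<in>V. K\<^sup>2 - 2 * K * real (deg E u) + (real (deg E u))\<^sup>2)"
    by (rule sum.cong) (simp_all add: d power2_diff)
  also have "\<dots> = (real w + M) * K\<^sup>2 - 2 * K * (real w * K + M * (real w + 2)) + (real w * K\<^sup>2 + M * (real w + 2)\<^sup>2)"
    by (simp add: sum_subtractf sum.distrib sum_distrib_left[symmetric] s1 s2 N)
  also have "\<dots> = M * (M - 3)\<^sup>2" by (simp add: K_def power2_eq_square algebra_simps)
  finally show "(\<Sum>u\<in>V. (real (deg D u))\<^sup>2) = real (m * n) * (real (m * n) - 3)\<^sup>2" by (simp add: M_def)
qed

lemma card_D: "real (card D) = real (m * n) * (real (m * n) - 3)"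
  using sum_deg_D(1) arg_cong[OF D.sum_deg, of real] by simp

lemma D_component_ge_multiple:
  assumes "m \<ge> 2"
  shows "\<exists>c\<in>V. m * n \<le> card (D.component c)"
proof -
  have "multiplicity_ge V E (real w) 1"
    using F.mult_components assms by (auto simp: multiplicity_iff intro: multiplicity_ge_mono)
  then obtain c where "c \<in> V" "real (w + m * n) - real w \<le> real (card (D.component c))"
    using D_component_ge[of "real w"] w_m_n(1) by auto
  moreover from this(2) have "m * n \<le> card (D.component c)" by linarith
  ultimately show ?thesis by blast
qed

text \<open>
  The thresholds come from \<open>cos (2 pi / n) > 0\<close> for \<open>n \<ge> 5\<close> and \<open>cos (2 pi / n) > 1 / 2\<close> for \<open>n \<ge> 7\<close>.
\<close>

lemma D_component_ge_single:
  assumes m: "m = 1" and n: "n \<ge> 5"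
  shows "\<exists>c\<in>V. n - 1 \<le> card (D.component c) \<and> (n \<ge> 7 \<longrightarrow> n \<le> card (D.component c))"
proof -
  define t where "t = 2 * pi / n"
  have t: "0 < t" "t < pi" using n by (auto simp: t_def field_simps)
  have "multiplicity_ge V E (real w + (2 - 2 * cos t)) 1"
    using F.cos_eigenvalue by (simp add: multiplicity_iff t_def)
  moreover have "real w + (2 - 2 * cos t) \<noteq> 0"
  proof -
    have "real w \<ge> 1" using w_m_n(1) by simp
    thus ?thesis using cos_le_one[of t] by linarith
  qed
  ultimately obtain c where c: "c \<in> V" "real (w + m * n) - (real w + (2 - 2 * cos t)) \<le> real (card (D.component c))"
    using D_component_ge by blast
  hence le: "real n - 2 + 2 * cos t \<le> real (card (D.component c))" using m by simp
  have "cos (pi / 2) < cos t"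
    using n t by (intro cos_monotone_0_pi) (auto simp: t_def field_simps)
  hence "real n - 2 < real (card (D.component c))" using le by simp
  hence 1: "n - 1 \<le> card (D.component c)" by linarith
  have 2: "n \<le> card (D.component c)" if "n \<ge> 7"
  proof -
    have "cos (pi / 3) < cos t"
      using that t by (intro cos_monotone_0_pi) (auto simp: t_def field_simps)
    hence "real n - 1 < real (card (D.component c))" using le by (simp add: cos_60)
    thus ?thesis by linarith
  qed
  show ?thesis using c(1) 1 2 by blast
qed

text \<open>
  For \<open>n = 3\<close> the complement has no edge, for \<open>n = 4\<close> it has two.
\<close>

lemma biperfect_small_complement:
  assumes "m = 1" "n \<le> 4"
  shows "biperfect E V"
proof -
  have "n = 3 \<or> n = 4" using w_m_n(3) assms(2) by auto
  hence "card D \<le> 4" using card_D assms(1) by auto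
  hence few: "card (D \<inter> V \<times> V) \<le> 4" using D.E_sub by (simp add: Int_absorb2)
  have irr: "irrefl D" using D.E_irrefl by (simp add: irrefl_def)
  have "biperfect D V" by (rule biperfect_few_arcs[OF finite_V irr D.E_sym few])
  hence "biperfect (non_arcs D) V" by (simp only: biperfect_non_arcs[OF irr])
  moreover have "biperfect (non_arcs D) V \<longleftrightarrow> biperfect E V"
    using E_irrefl by (intro biperfect_cong) (auto simp: non_arcs_def compl_arcs_def)
  ultimately show ?thesis by simp
qed

end

section \<open>The pentagon and the hexagon\<close>

context cospectral
begin

text \<open>
  If the component of \<open>c\<close> is one vertex smaller than expected, then \<open>D\<close> has at most one edge outside
  of it: from two edges one could omit a vertex each, and the remaining \<open>w - 1\<close> vertices would still meet
  all components other than that of \<open>c\<close>.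
\<close>

lemma D_arcs_outside:
  assumes c: "c \<in> V" and w: "card (V - D.component c) = w + 1"
    and rs: "(r, s) \<in> D" "r \<notin> D.component c" and pq: "(p, q) \<in> D" "p \<notin> D.component c"
  shows "{r, s} = {p, q}"
proof (rule ccontr)
  assume ne: "{r, s} \<noteq> {p, q}"
  let ?W = "V - D.component c"
  have out: "a \<in> ?W \<and> b \<in> ?W \<and> a \<noteq> b" if "(a, b) \<in> D" "a \<notin> D.component c" for a b
  proof -
    have "D.component b = D.component a" by (rule D.component_arc[OF that(1)])
    hence "b \<notin> D.component c"
      using D.component_eq[of b c] D.component_self[of a] that(2) by auto
    thus ?thesis using that D.E_in[OF that(1)] D.E_irrefl by auto
  qed
  have sr: "(s, r) \<in> D" "s \<notin> D.component c" and qp: "(q, p) \<in> D" "q \<notin> D.component c"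
    using out[OF rs] out[OF pq] D.E_sym[OF rs(1)] D.E_sym[OF pq(1)] by auto
  (* Choose the vertices \<open>a\<close>, \<open>b\<close> to be omitted so that their neighbours \<open>a'\<close>, \<open>b'\<close> are kept. *)
  have "r \<notin> {p, q} \<or> s \<notin> {p, q}" using ne out[OF rs] by auto
  then obtain a a' where a: "(a, a') \<in> D" "a \<notin> D.component c" "a \<noteq> p" "a \<noteq> q"
    using rs sr by blast
  obtain b b' where b: "(b, b') \<in> D" "b \<notin> D.component c" "b \<noteq> a'" "b \<noteq> a" "b' \<noteq> a"
  proof (cases "p = a'")
    case True
    have "q \<noteq> a'" using True out[OF pq] by auto
    from that[OF qp this] show ?thesis using a(3,4) by simp
  next
    case False
    from that[OF pq False] show ?thesis using a(3,4) by simp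
  qed
  let ?R = "?W - {a, b}"
  have "w \<le> card ?R"
  proof (rule D_component_count[OF c])
    fix x assume x: "x \<in> ?W"
    consider "x = a" | "x = b" | "x \<in> ?R" using x by blast
    thus "\<exists>r\<in>?R. x \<in> D.component r"
    proof cases
      case 1
      have "a' \<in> ?R" using out[OF a(1,2)] b(3) by auto
      moreover have "a \<in> D.component a'" using D.component_arc[OF a(1)] D.component_self[of a] by simp
      ultimately show ?thesis using 1 by blast
    next
      case 2
      have "b' \<in> ?R" using out[OF b(1,2)] b(5) by auto
      moreover have "b \<in> D.component b'" using D.component_arc[OF b(1)] D.component_self[of b] by simp
      ultimately show ?thesis using 2 by blast
    next
      case 3
      thus ?thesis using D.component_self[of x] by blast
    qed
  qed (use finite_V in simp)
  moreover have "card ?R = card ?W - card {a, b}"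
    using out[OF a(1,2)] out[OF b(1,2)] by (intro card_Diff_subset) auto
  ultimately show False using w b(4) w_m_n(1) by auto
qed

text \<open>
  Otherwise the large component has four vertices. If \<open>D\<close> has no further edge, then its degrees on this
  component have sum \<open>10\<close> and square sum \<open>20\<close>, against the Cauchy-Schwarz inequality. If \<open>D\<close> has a
  further edge \<open>rs\<close>, this edge is a component, so \<open>2\<close> is an eigenvalue of \<open>D\<close> and \<open>w + 3\<close> one of \<open>G\<close>.
\<close>

lemma pentagon_component:
  assumes "m = 1" "n = 5"
  shows "\<exists>c\<in>V. 5 \<le> card (D.component c)"
proof (rule ccontr)
  assume small: "\<not> ?thesis"
  obtain c where c: "c \<in> V" "4 \<le> card (D.component c)"
    using D_component_ge_single assms by auto
  let ?C = "D.component c" and ?W = "V - D.component c"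
  have C4: "card ?C = 4" using c small by force
  hence W: "card ?W = w + 1" using card_D_component[OF c(1)] assms by simp
  have CV: "?C \<subseteq> V" by (rule D.component_sub[OF c(1)])
  show False
  proof (cases "\<exists>r s. (r, s) \<in> D \<and> r \<notin> ?C")
    case False
    hence 0: "deg D u = 0" if "u \<in> V - ?C" for u
      using that by (auto simp: deg_def)
    have split: "(\<Sum>u\<in>?C. f u) = (\<Sum>u\<in>V. f u)" if "\<And>u. u \<in> V - ?C \<Longrightarrow> f u = 0" for f :: "'a \<Rightarrow> real"
      using that by (intro sum.mono_neutral_left finite_V CV) auto
    have s1: "(\<Sum>u\<in>?C. real (deg D u)) = 10" and s2: "(\<Sum>u\<in>?C. (real (deg D u))\<^sup>2) = 20"
      using split[of "\<lambda>u. real (deg D u)"] split[of "\<lambda>u. (real (deg D u))\<^sup>2"] 0 sum_deg_D assms by simp_all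
    (* The mean degree on the four vertices is \<open>5 / 2\<close>. *)
    have "0 \<le> (\<Sum>u\<in>?C. (real (deg D u) - 5 / 2)\<^sup>2)" by (rule sum_nonneg) simp
    also have "\<dots> = (\<Sum>u\<in>?C. (real (deg D u))\<^sup>2 - 5 * real (deg D u) + 25 / 4)"
      by (rule sum.cong) (simp_all add: power2_eq_square field_simps)
    also have "\<dots> = 20 - 5 * 10 + 4 * (25 / 4)"
      by (simp add: sum.distrib sum_subtractf sum_distrib_left[symmetric] s1 s2 C4)
    finally show False by simp
  next
    case True
    then obtain r s where rs: "(r, s) \<in> D" "r \<notin> ?C" by blast
    have ne: "r \<noteq> s" using rs D.E_irrefl by auto
    have "D.component s = D.component r" by (rule D.component_arc[OF rs(1)])
    hence sC: "s \<notin> ?C" using D.component_eq[of s c] D.component_self[of r] rs(2) by auto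
    note only = D_arcs_outside[OF c(1) W rs]
    have Dr: "D `` {r} = {s}"
    proof -
      have "v = s" if v: "(r, v) \<in> D" for v
        using only[OF v rs(2)] ne by (simp add: doubleton_eq_iff)
      thus ?thesis using rs(1) by blast
    qed
    have Ds: "D `` {s} = {r}"
    proof -
      have "v = r" if v: "(s, v) \<in> D" for v
        using only[OF v sC] ne by (simp add: doubleton_eq_iff)
      thus ?thesis using D.E_sym[OF rs(1)] by blast
    qed
    let ?x = "\<lambda>u. if u = r then 1 else if u = s then -1 else (0::real)"
    have "eigenfunction V D 2 ?x"
      unfolding eigenfunction_def
    proof
      fix u assume "u \<in> V"
      consider "u = r" | "u = s" | "u \<noteq> r" "u \<noteq> s" by blast
      thus "lap D ?x u = 2 * ?x u"
      proof cases
        case 1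
        show ?thesis unfolding 1 lap_def Dr using ne by simp
      next
        case 2
        show ?thesis unfolding 2 lap_def Ds using ne by simp
      next
        case 3
        have "v \<noteq> r \<and> v \<noteq> s" if "(u, v) \<in> D" for v
          using D.E_sym[OF that] Dr Ds 3 by auto
        thus ?thesis using 3 by (auto simp: lap_def intro!: sum.neutral)
      qed
    qed
    hence "eigenfunction V E (real (card V) - 2) ?x"
      using D.eigenfunction_compl[of 2 ?x] by (simp add: compl_compl)
    moreover have "real (card V) - 2 = real w + 3" using assms by (simp add: card_V)
    moreover have "r \<in> V" "?x r \<noteq> 0" using D.E_in[OF rs(1)] by simp_all
    ultimately have "multiplicity_ge V E (real w + 3) 1"
      unfolding multiplicity_ge_1_iff by (intro exI[of _ ?x] conjI bexI[of _ r]) simp_all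
    hence "multiplicity_ge (pverts F.F) (parcs F.F) (real w + 3) 1" by (simp only: multiplicity_iff)
    then obtain y u where "eigenfunction (pverts F.F) (parcs F.F) (real w + 3) y" "u \<in> pverts F.F" "y u \<noteq> 0"
      unfolding multiplicity_ge_1_iff by blast
    thus False using F.pentagon_no_eigenvalue[OF assms, of y u] by simp
  qed
qed

text \<open>
  Outside the component \<open>C\<close> of order five \<open>D\<close> has at most one edge. Since \<open>D\<close> has nine edges in total,
  it misses at most two of the ten pairs within \<open>C\<close>. So \<open>G\<close> is the join of a graph on \<open>C\<close> with at most
  two edges and the complement of a graph with at most one edge.
\<close>

lemma hexagon_biperfect:
  assumes "m = 1" "n = 6" and c: "c \<in> V" and C5: "card (D.component c) = 5"
  shows "biperfect E V"
proof -
  let ?C = "D.component c" and ?W = "V - D.component c"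
  have CV: "?C \<subseteq> V" by (rule D.component_sub[OF c])
  have finC: "finite ?C" by (rule finite_subset[OF CV finite_V])
  have W: "card ?W = w + 1" using card_D_component[OF c] assms by simp
  have irr: "irrefl E" "irrefl D" using E_irrefl D.E_irrefl by (simp_all add: irrefl_def)
  have closed: "v \<in> ?C \<longleftrightarrow> u \<in> ?C" if "(u, v) \<in> D" for u v
    using ImageI[OF that, of ?C] ImageI[OF D.E_sym[OF that], of ?C] D.component_closed[of c] by blast
  have cW: "card (D \<inter> ?W \<times> ?W) \<le> 2"
  proof (cases "D \<inter> ?W \<times> ?W = {}")
    case False
    then obtain r s where rs: "(r, s) \<in> D" "r \<notin> ?C" by auto
    have "D \<inter> ?W \<times> ?W \<subseteq> {(r, s), (s, r)}"
    proof
      fix e assume "e \<in> D \<inter> ?W \<times> ?W"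
      then obtain p q where e: "e = (p, q)" "(p, q) \<in> D" "p \<notin> ?C" by auto
      show "e \<in> {(r, s), (s, r)}"
        using D_arcs_outside[OF c W rs e(2,3)] e(1) by (auto simp: doubleton_eq_iff)
    qed
    hence "card (D \<inter> ?W \<times> ?W) \<le> card {(r, s), (s, r)}" by (intro card_mono) auto
    thus ?thesis by (simp add: card_insert_if split: if_splits)
  qed simp
  have "biperfect D ?W"
  proof (rule biperfect_few_arcs[OF finite_Diff[OF finite_V] irr(2) D.E_sym])
    show "card (D \<inter> ?W \<times> ?W) \<le> 4" using cW by simp
  qed
  hence "biperfect (non_arcs D) ?W" by (simp only: biperfect_non_arcs[OF irr(2)])
  moreover have "biperfect (non_arcs D) ?W \<longleftrightarrow> biperfect E ?W"
    using E_irrefl by (intro biperfect_cong) (auto simp: non_arcs_def compl_arcs_def)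
  ultimately have bW: "biperfect E ?W" by simp
  have "card D = 18" using card_D assms by simp
  moreover have whole: "(D \<inter> ?C \<times> ?C) \<union> (D \<inter> ?W \<times> ?W) = D"
  proof
    show "D \<subseteq> (D \<inter> ?C \<times> ?C) \<union> (D \<inter> ?W \<times> ?W)"
    proof
      fix e assume e: "e \<in> D"
      obtain u v where uv: "e = (u, v)" by (cases e)
      show "e \<in> (D \<inter> ?C \<times> ?C) \<union> (D \<inter> ?W \<times> ?W)"
        using e closed[of u v] D.E_in[of u v] unfolding uv by auto
    qed
  qed auto
  have disj: "(D \<inter> ?C \<times> ?C) \<inter> (D \<inter> ?W \<times> ?W) = {}" by auto
  have "card D = card (D \<inter> ?C \<times> ?C) + card (D \<inter> ?W \<times> ?W)"
    using card_Un_disjoint[of "D \<inter> ?C \<times> ?C" "D \<inter> ?W \<times> ?W"] disj whole by simp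
  ultimately have DC: "16 \<le> card (D \<inter> ?C \<times> ?C)" using cW by linarith
  have "card (E \<inter> ?C \<times> ?C) + card (D \<inter> ?C \<times> ?C) = card ((E \<inter> ?C \<times> ?C) \<union> (D \<inter> ?C \<times> ?C))"
  proof (rule card_Un_disjoint[symmetric])
    show "(E \<inter> ?C \<times> ?C) \<inter> (D \<inter> ?C \<times> ?C) = {}" by (auto simp: compl_arcs_def)
  qed simp_all
  also have "(E \<inter> ?C \<times> ?C) \<union> (D \<inter> ?C \<times> ?C) = ?C \<times> ?C - (\<lambda>u. (u, u)) ` ?C"
    using CV E_irrefl by (auto simp: compl_arcs_def)
  also have "card \<dots> = 20"
    using finC C5 by (subst card_Diff_subset) (auto simp: card_cartesian_product card_image inj_on_def)
  finally have few: "card (E \<inter> ?C \<times> ?C) \<le> 4" using DC by linarith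
  have bC: "biperfect E ?C" by (rule biperfect_few_arcs[OF finC irr(1) E_sym few])
  have "biperfect E (?W \<union> ?C)"
  proof (rule biperfect_join[OF bW bC _ finC])
    show "(a, b) \<in> E \<and> (b, a) \<in> E" if "a \<in> ?W" "b \<in> ?C" for a b
    proof -
      have "(a, b) \<notin> D" using closed[of a b] that by blast
      hence "(a, b) \<in> E" using that CV by (auto simp: compl_arcs_def)
      thus ?thesis using E_sym by simp
    qed
  qed (use finite_V in auto)
  moreover have "?W \<union> ?C = V" using CV by auto
  ultimately show ?thesis by simp
qed

end

section \<open>Joins of a complete graph and a 2-regular graph\<close>

text \<open>
  The generic structure: the vertices \<open>W\<close> are adjacent to all others and \<open>H\<close> is the graph induced on the
  remaining vertices \<open>C\<close>.
\<close>

locale cospectral_cone = cospectral V E w m n + cone V E W C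
  for V :: "'a set" and E w m n W C +
  assumes card_W: "card W = w" and card_C: "card C = m * n"
begin

lemma irrefl_E: "irrefl E"
  using E_irrefl by (simp add: irrefl_def)

text \<open>
  The degree sums show that the degrees of \<open>H\<close> have mean two and variance zero.
\<close>

lemma deg_H: "u \<in> C \<Longrightarrow> deg H u = 2"
proof -
  assume u: "u \<in> C"
  have s1: "(\<Sum>u\<in>C. real (deg H u)) = 2 * real (m * n)" and s2: "(\<Sum>u\<in>C. (real (deg H u))\<^sup>2) = 4 * real (m * n)"
  proof -
    have "(\<Sum>u\<in>W. deg E u) + (\<Sum>u\<in>C. deg E u) = w * (w + m * n - 1) + m * n * (w + 2)"
      using sum_deg_V(1) unfolding V_eq sum.union_disjoint[OF finite_W H.finite_V WC] .
    moreover have "(\<Sum>u\<in>W. deg E u) = w * (w + m * n - 1)" using deg_W by (simp add: card_V card_W)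
    ultimately have "(\<Sum>u\<in>C. deg E u) = m * n * (w + 2)" by simp
    moreover have "(\<Sum>u\<in>C. deg E u) = (\<Sum>u\<in>C. deg H u) + m * n * w"
      using deg_C by (simp add: sum.distrib card_W card_C)
    ultimately have 1: "(\<Sum>u\<in>C. deg H u) = 2 * (m * n)" by (simp add: algebra_simps)
    thus "(\<Sum>u\<in>C. real (deg H u)) = 2 * real (m * n)" using arg_cong[OF 1, of real] by simp
    have "(\<Sum>u\<in>W. (deg E u)\<^sup>2) + (\<Sum>u\<in>C. (deg E u)\<^sup>2) = w * (w + m * n - 1)\<^sup>2 + m * n * (w + 2)\<^sup>2"
      using sum_deg_V(2) unfolding V_eq sum.union_disjoint[OF finite_W H.finite_V WC] .
    moreover have "(\<Sum>u\<in>W. (deg E u)\<^sup>2) = w * (w + m * n - 1)\<^sup>2" using deg_W by (simp add: card_V card_W)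
    ultimately have "(\<Sum>u\<in>C. (deg E u)\<^sup>2) = m * n * (w + 2)\<^sup>2" by simp
    moreover have "(\<Sum>u\<in>C. (deg E u)\<^sup>2) = (\<Sum>u\<in>C. (deg H u)\<^sup>2 + 2 * w * deg H u + w\<^sup>2)"
      by (rule sum.cong) (simp_all add: deg_C card_W power2_sum mult_ac)
    moreover have "\<dots> = (\<Sum>u\<in>C. (deg H u)\<^sup>2) + 2 * w * (\<Sum>u\<in>C. deg H u) + m * n * w\<^sup>2"
      by (simp add: sum.distrib sum_distrib_left card_C)
    ultimately have "(\<Sum>u\<in>C. (deg H u)\<^sup>2) + 2 * w * (2 * (m * n)) + m * n * w\<^sup>2 = m * n * (w + 2)\<^sup>2"
      unfolding 1 by simp
    hence "(\<Sum>u\<in>C. (deg H u)\<^sup>2) = 4 * (m * n)"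
      by (simp add: power2_eq_square algebra_simps)
    from arg_cong[OF this, of real] show "(\<Sum>u\<in>C. (real (deg H u))\<^sup>2) = 4 * real (m * n)" by simp
  qed
  have "(\<Sum>u\<in>C. (real (deg H u) - 2)\<^sup>2) = (\<Sum>u\<in>C. (real (deg H u))\<^sup>2 - 4 * real (deg H u) + 4)"
    by (rule sum.cong) (simp_all add: power2_diff)
  also have "\<dots> = 4 * real (m * n) - 4 * (2 * real (m * n)) + 4 * real (m * n)"
    by (simp only: sum.distrib sum_subtractf sum_distrib_left[symmetric] s1 s2) (simp add: card_C)
  finally have "(\<Sum>u\<in>C. (real (deg H u) - 2)\<^sup>2) = 0" by simp
  hence "\<forall>u\<in>C. (real (deg H u) - 2)\<^sup>2 = 0"
    by (subst (asm) sum_nonneg_eq_0_iff) (use H.finite_V in auto)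
  thus "deg H u = 2" using u by simp
qed

lemma eigenfunction_V:
  assumes "eigenfunction C H l x" "(\<Sum>u\<in>C. x u) = 0"
  shows "eigenfunction V E (real w + l) (\<lambda>u. if u \<in> C then x u else 0)"
proof -
  let ?y = "\<lambda>u. if u \<in> C then x u else 0"
  have "eigenfunction C H l ?y"
    unfolding eigenfunction_def
  proof
    fix u assume u: "u \<in> C"
    have "lap H ?y u = lap H x u"
      unfolding lap_def using u by (intro sum.cong) auto
    thus "lap H ?y u = l * ?y u" using assms(1) u by (simp add: eigenfunction_def)
  qed
  moreover have "(\<Sum>u\<in>C. ?y u) = 0" using assms(2) by simp
  moreover have "?y u = 0" if "u \<in> W" for u using that WC by auto
  ultimately show ?thesis using eigenfunction_coneI[of l ?y] unfolding card_W by blast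
qed

lemma eigenfunction_C:
  assumes x: "eigenfunction V E (real w + l) x" and l: "0 \<le> l" "l \<noteq> real (m * n)"
  shows "\<And>u. u \<in> W \<Longrightarrow> x u = 0" "(\<Sum>u\<in>C. x u) = 0" "eigenfunction C H l x"
proof -
  have l': "real w + l \<noteq> 0" "real w + l \<noteq> real (card V)"
    using l w_m_n(1) by (auto simp: card_V)
  show "\<And>u. u \<in> W \<Longrightarrow> x u = 0" "(\<Sum>u\<in>C. x u) = 0"
    using eigenfunction_cone[OF x l'] by blast+
  show "eigenfunction C H l x" using eigenfunction_cone(3)[OF x l'] by (simp add: card_W)
qed

lemma sum_card_components: "(\<Sum>p\<in>H.reps. card (H.component p)) = m * n"
  using H.sum_card_component card_C by simp

lemma card_component_ge_3:
  assumes "p \<in> H.reps"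
  shows "3 \<le> card (H.component p)"
proof -
  have p: "p \<in> C" using assms H.reps_sub by blast
  have "insert p (H `` {p}) \<subseteq> H.component p"
    using H.component_self[of p] H.component_closed[of p] by blast
  moreover have "card (insert p (H `` {p})) = 3"
    using deg_H[OF p] H.E_irrefl[of p] by (simp add: deg_def)
  ultimately show ?thesis using card_mono[OF H.finite_component[OF assms]] by metis
qed

text \<open>
  With \<open>m + 1\<close> components the functions that are constant on the components and have sum zero would
  give \<open>m\<close> independent eigenfunctions for \<open>w\<close>; component \<open>m\<close> compensates for component \<open>i\<close>.
\<close>

lemma card_reps_le: "card H.reps \<le> m"
proof (rule ccontr)
  assume gt: "\<not> card H.reps \<le> m"
  obtain p where p: "bij_betw p {0..<card H.reps} H.reps" using ex_bij_betw_nat_finite[OF H.finite_reps] by blast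
  have pr: "p i \<in> H.reps" if "i \<le> m" for i
    using bij_betwE[OF p] that gt by auto
  have inj: "p i = p j \<longleftrightarrow> i = j" if "i \<le> m" "j \<le> m" for i j
    using bij_betw_imp_inj_on[OF p] that gt by (auto simp: inj_on_def)
  let ?K = "\<lambda>i. H.component (p i)"
  have disj: "u \<notin> ?K j" if "u \<in> ?K i" "i \<noteq> j" "i \<le> m" "j \<le> m" for u i j
    using H.rep_unique[OF pr[OF that(3)] pr[OF that(4)] that(1)] inj[OF that(3,4)] that(2) by blast
  have sub: "?K i \<subseteq> C" if "i \<le> m" for i
    by (rule H.component_reps[OF pr[OF that]])
  define x where "x i u = (if u \<in> ?K i then real (card (?K m)) else if u \<in> ?K m then - real (card (?K i)) else 0)" for i u
  have "multiplicity_ge V E (real w + 0) m"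
  proof (rule multiplicity_geI[where x = "\<lambda>i u. if u \<in> C then x i u else 0" and p = p])
    fix i assume i: "i < m"
    show "eigenfunction V E (real w + 0) (\<lambda>u. if u \<in> C then x i u else 0)"
    proof (rule eigenfunction_V)
      have "u \<in> ?K j \<longleftrightarrow> v \<in> ?K j" if "(u, v) \<in> H" for u v j
        using ImageI[OF that, of "?K j"] ImageI[OF H.E_sym[OF that], of "?K j"] H.component_closed[of "p j"] by blast
      thus "eigenfunction C H 0 (x i)"
        unfolding H.eigenfunction_0_iff x_def by auto
      have "(\<Sum>u\<in>C. x i u) = (\<Sum>u\<in>C. (if u \<in> ?K i then real (card (?K m)) else 0) - (if u \<in> ?K m then real (card (?K i)) else 0))"
        using disj[of _ i m] i by (intro sum.cong) (auto simp: x_def)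
      also have "\<dots> = (\<Sum>u\<in>?K i. real (card (?K m))) - (\<Sum>u\<in>?K m. real (card (?K i)))"
        unfolding sum_subtractf using sub[of i] sub[of m] i H.finite_V
        by (simp add: sum.inter_restrict[symmetric] Int_absorb1)
      also have "\<dots> = 0" by simp
      finally show "(\<Sum>u\<in>C. x i u) = 0" .
    qed
    have pC: "p i \<in> C" using pr[of i] i H.reps_sub by auto
    show "p i \<in> V" using pC V_eq by auto
    have "card (?K m) \<noteq> 0" using card_component_ge_3[OF pr[of m]] by simp
    thus "(if p i \<in> C then x i (p i) else 0) \<noteq> 0"
      using pC H.component_self[of "p i"] by (simp add: x_def)
    show "(if p j \<in> C then x i (p j) else 0) = 0" if "j < m" "i \<noteq> j" for j
      using disj[OF H.component_self[of "p j"], of i] disj[OF H.component_self[of "p j"], of m] that i by (simp add: x_def)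
  qed
  hence "m \<le> m - 1" using F.mult_components_le by (simp add: multiplicity_iff)
  thus False using w_m_n(2) by simp
qed

text \<open>
  The eigenfunctions for \<open>w\<close> are determined by their values on all components but one.
\<close>

lemma card_reps_ge: "m \<le> card H.reps"
proof -
  obtain c where "c \<in> C" using card_C w_m_n(4) by (metis all_not_in_conv card.empty not_numeral_le_zero)
  then obtain q where q: "q \<in> H.reps" using H.rep_of by blast
  have "m - 1 \<le> card (H.reps - {q})"
  proof (rule multiplicity_le)
    show "multiplicity_ge V E (real w + 0) (m - 1)" using F.mult_components by (simp add: multiplicity_iff)
    fix x assume x: "eigenfunction V E (real w + 0) x" and 0: "\<forall>r\<in>H.reps - {q}. x r = 0"
    have l: "(0::real) \<le> 0" "(0::real) \<noteq> real (m * n)" using w_m_n by auto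
    note xC = eigenfunction_C[OF x l]
    have step: "x v = x u" if uv: "(u, v) \<in> H" for u v
      using bspec[OF xC(3)[unfolded H.eigenfunction_0_iff] uv] by simp
    have const: "x v = x u" if v: "v \<in> H.component u" for u v
      using H.constant_on_component[of x, OF step v] .
    have other: "x u = 0" if u: "u \<in> C" "u \<notin> H.component q" for u
    proof -
      obtain p where p: "p \<in> H.reps" "u \<in> H.component p" by (rule H.rep_of[OF u(1)])
      have "p \<in> H.reps - {q}" using p u(2) by auto
      thus ?thesis using const[OF p(2)] 0 by simp
    qed
    have qC: "H.component q \<subseteq> C" by (rule H.component_reps[OF q])
    have "(\<Sum>u\<in>C. x u) = (\<Sum>u\<in>H.component q. x u)"
      using other qC H.finite_V by (intro sum.mono_neutral_right) auto
    also have "\<dots> = (\<Sum>u\<in>H.component q. x q)" using const[of _ q] by (intro sum.cong) auto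
    finally have "real (card (H.component q)) * x q = 0" using xC(2) by simp
    hence "x q = 0" using card_component_ge_3[OF q] by auto
    hence "x u = 0" if "u \<in> C" for u
      using that other[of u] const[of u q] by (cases "u \<in> H.component q") auto
    thus "\<forall>u\<in>V. x u = 0" using xC(1) V_eq by auto
  qed (use H.finite_reps in simp)
  moreover have "card (H.reps - {q}) = card H.reps - 1" using q by (simp add: card_Diff_singleton)
  moreover have "card H.reps > 0" using q H.finite_reps by (auto simp: card_gt_0_iff)
  ultimately show ?thesis by linarith
qed

lemma biperfect_if_biperfect_H:
  assumes "biperfect E C"
  shows "biperfect E V"
  unfolding V_eq
proof (rule biperfect_join[OF _ assms finite_W H.finite_V WC])
  show "biperfect E W"
    using universal V_eq by (intro biperfect_complete finite_W irrefl_E) auto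
  show "(a, b) \<in> E \<and> (b, a) \<in> E" if "a \<in> W" "b \<in> C" for a b
  proof -
    have "(a, b) \<in> E" using universal[of a b] that WC V_eq by auto
    thus ?thesis using E_sym by simp
  qed
qed

text \<open>
  There are \<open>m\<close> components with at least three vertices each and \<open>3 m\<close> vertices in total.
\<close>

lemma biperfect_triangles:
  assumes "n = 3"
  shows "biperfect E V"
proof (rule biperfect_if_biperfect_H, rule biperfect_disjoint_cliques[OF H.finite_V irrefl_E E_sym])
  have "card H.reps = m" using card_reps_le card_reps_ge by simp
  hence "(\<Sum>p\<in>H.reps. card (H.component p) - 3) = 0"
    using sum_card_components card_component_ge_3 assms by (simp add: sum_subtractf_nat)
  hence three: "card (H.component p) = 3" if "p \<in> H.reps" for p
  proof -
    have "card (H.component p) - 3 = 0"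
      using \<open>(\<Sum>p\<in>H.reps. card (H.component p) - 3) = 0\<close> H.finite_reps that by simp
    thus ?thesis using card_component_ge_3[OF that] by simp
  qed
  show "(u, x) \<in> E" if "u \<in> C" "v \<in> C" "x \<in> C" "(u, v) \<in> E" "(v, x) \<in> E" "u \<noteq> x" for u v x
  proof -
    have uv: "(u, v) \<in> H" and vx: "(v, x) \<in> H" using that by auto
    obtain p where p: "p \<in> H.reps" "u \<in> H.component p" by (rule H.rep_of[OF \<open>u \<in> C\<close>])
    have v: "v \<in> H.component p" and x: "x \<in> H.component p"
      using p(2) uv vx H.component_closed[of p] by blast+
    have ne: "u \<noteq> v" "v \<noteq> x" using uv vx H.E_irrefl by auto
    have "{u, v, x} = H.component p"
      using p v x ne \<open>u \<noteq> x\<close> three[OF p(1)] H.finite_component[OF p(1)] by (intro card_seteq) auto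
    moreover have "H `` {u} \<subseteq> H.component p - {u}"
      using p(2) H.component_closed[of p] H.E_irrefl by blast
    ultimately have "H `` {u} \<subseteq> {v, x}" by blast
    hence "H `` {u} = {v, x}"
      using deg_H[OF \<open>u \<in> C\<close>] ne by (intro card_seteq) (auto simp: deg_def)
    thus ?thesis by auto
  qed
qed

lemma alternating_abs:
  assumes x: "eigenfunction C H 4 x" and v: "v \<in> H.component u"
  shows "\<bar>x v\<bar> = \<bar>x u\<bar>"
proof (rule H.constant_on_component[where x = "\<lambda>u. \<bar>x u\<bar>", OF _ v])
  show "\<bar>x b\<bar> = \<bar>x a\<bar>" if "(a, b) \<in> H" for a b
    using H.eigenfunction_4_alternates[OF deg_H x that] by simp
qed

text \<open>
  The eigenspace of \<open>H\<close> for \<open>4\<close> has dimension at least \<open>m\<close>, and an eigenfunction vanishes as soon as it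
  vanishes at one vertex of each of the at most \<open>m\<close> components. So for each component there is an
  eigenfunction that does not vanish on it, and its signs are a 2-colouring of the component.
\<close>

lemma biperfect_even_cycles:
  assumes "even n" "m * n \<noteq> 4"
  shows "biperfect E V"
proof (rule biperfect_if_biperfect_H)
  have l: "(0::real) \<le> 4" "(4::real) \<noteq> real (m * n)" using assms(2) by (auto simp flip: of_nat_mult)
  have "\<exists>x. eigenfunction C H 4 x \<and> x p \<noteq> 0" if p: "p \<in> H.reps" for p
  proof (rule ccontr)
    assume no: "\<not> ?thesis"
    have "m \<le> card (H.reps - {p})"
    proof (rule multiplicity_le)
      show "multiplicity_ge V E (real w + 4) m" using F.mult_even[OF assms(1)] by (simp add: multiplicity_iff)
      fix x assume x: "eigenfunction V E (real w + 4) x" and 0: "\<forall>r\<in>H.reps - {p}. x r = 0"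
      note xC = eigenfunction_C[OF x l]
      have "x r = 0" if "r \<in> H.reps" for r using 0 no xC(3) that by blast
      hence "x u = 0" if u: "u \<in> C" for u
      proof -
        obtain q where "q \<in> H.reps" "u \<in> H.component q" by (rule H.rep_of[OF u])
        thus ?thesis using alternating_abs[OF xC(3), of u q] \<open>\<And>r. r \<in> H.reps \<Longrightarrow> x r = 0\<close> by simp
      qed
      thus "\<forall>u\<in>V. x u = 0" using xC(1) V_eq by auto
    qed (use H.finite_reps in simp)
    moreover have "card (H.reps - {p}) < card H.reps"
      using p H.finite_reps by (intro psubset_card_mono) auto
    ultimately show False using card_reps_le by simp
  qed
  hence "\<forall>p\<in>H.reps. \<exists>x. eigenfunction C H 4 x \<and> x p \<noteq> 0" by blast
  from bchoice[OF this] obtain x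
    where x: "\<And>p. p \<in> H.reps \<Longrightarrow> eigenfunction C H 4 (x p)" "\<And>p. p \<in> H.reps \<Longrightarrow> x p p \<noteq> 0"
    by auto
  define r where "r u = (THE p. p \<in> H.reps \<and> u \<in> H.component p)" for u
  have r: "r u = p" if "p \<in> H.reps" "u \<in> H.component p" for u p
    unfolding r_def
  proof (rule the_equality)
    show "q = p" if "q \<in> H.reps \<and> u \<in> H.component q" for q
      using H.rep_unique[of q p u] that \<open>p \<in> H.reps\<close> \<open>u \<in> H.component p\<close> by simp
  qed (use that in simp)
  show "biperfect E C"
  proof (rule biperfect_bipartite_max_degree_2[where f = "\<lambda>u. x (r u) u > 0"])
    show "(x (r u) u > 0) \<noteq> (x (r v) v > 0)" if "u \<in> C" "v \<in> C" "(u, v) \<in> E" for u v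
    proof -
      obtain p where p: "p \<in> H.reps" "u \<in> H.component p" by (rule H.rep_of[OF \<open>u \<in> C\<close>])
      have uv: "(u, v) \<in> H" using that by simp
      have v: "v \<in> H.component p" using p(2) uv H.component_closed[of p] by blast
      have "x p v = - x p u" by (rule H.eigenfunction_4_alternates[OF deg_H x(1)[OF p(1)] uv])
      moreover have "x p u \<noteq> 0" using alternating_abs[OF x(1)[OF p(1)] p(2)] x(2)[OF p(1)] by auto
      ultimately show ?thesis unfolding r[OF p] r[OF p(1) v] by linarith
    qed
    show "card (E `` {u} \<inter> C) \<le> 2" if "u \<in> C" for u
    proof -
      have "H `` {u} = E `` {u} \<inter> C" using that by auto
      thus ?thesis using deg_H[OF that] by (simp add: deg_def)
    qed
    show "(v, u) \<in> E" if "(u, v) \<in> E" for u v by (rule E_sym[OF that])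
  qed (rule H.finite_V irrefl_E)+
qed

text \<open>
  The at most \<open>m\<close> components share \<open>m n > 3 m\<close> vertices, so one of them has at least four. Three pairwise
  adjacent vertices would form a component of their own by 2-regularity, so this component \<open>K\<close> has no
  triangle. If \<open>G\<close> were perfect, \<open>K\<close> would be 2-colourable, and the colouring would provide an
  eigenfunction for \<open>4\<close>.
\<close>

lemma not_biperfect_odd:
  assumes "odd n" "n \<ge> 5"
  shows "\<not> biperfect E V"
proof
  assume bp: "biperfect E V"
  have "\<exists>p\<in>H.reps. 4 \<le> card (H.component p)"
  proof (rule ccontr)
    assume "\<not> ?thesis"
    hence "(\<Sum>p\<in>H.reps. card (H.component p)) \<le> (\<Sum>p\<in>H.reps. 3)" by (intro sum_mono) force
    also have "\<dots> \<le> 3 * m" using card_reps_le by simp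
    also have "\<dots> < n * m" using assms(2) w_m_n(2) by (intro mult_strict_right_mono) auto
    finally show False using sum_card_components by (simp add: mult.commute)
  qed
  then obtain p where p: "p \<in> H.reps" "4 \<le> card (H.component p)" by blast
  let ?K = "H.component p"
  have KC: "?K \<subseteq> C" by (rule H.component_reps[OF p(1)])
  have KH: "(u, v) \<in> H" if "u \<in> ?K" "v \<in> ?K" "(u, v) \<in> E" for u v using that KC by auto
  have "chi_eq_omega E ?K" using bp KC V_eq by (auto simp: biperfect_def)
  then obtain Q c where Q: "Q \<subseteq> ?K" "\<forall>u\<in>Q. \<forall>v\<in>Q. u \<noteq> v \<longrightarrow> (u, v) \<in> E"
    and c: "\<forall>u\<in>?K. c u < card Q" "\<forall>u\<in>?K. \<forall>v\<in>?K. (u, v) \<in> E \<longrightarrow> c u \<noteq> (c v :: nat)"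
    unfolding chi_eq_omega_def by (elim exE conjE)
  have "card Q \<le> 2"
  proof (rule ccontr)
    assume "\<not> card Q \<le> 2"
    hence "3 \<le> card Q" by simp
    then obtain T where T: "T \<subseteq> Q" "card T = 3" by (rule obtain_subset_with_card_n)
    have finT: "finite T" using T(2) by (metis card.infinite zero_neq_numeral)
    have nbrs: "H `` {a} = T - {a}" if a: "a \<in> T" for a
    proof -
      have aK: "a \<in> Q" "a \<in> ?K" using subsetD[OF T(1) a] subsetD[OF Q(1)] by simp_all
      have "a \<in> C" by (rule subsetD[OF KC aK(2)])
      have "T - {a} \<subseteq> H `` {a}"
      proof
        fix b assume b: "b \<in> T - {a}"
        hence bK: "b \<in> Q" "b \<in> ?K" "a \<noteq> b" using subsetD[OF T(1), of b] subsetD[OF Q(1), of b] by auto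
        have "(a, b) \<in> E" using bspec[OF bspec[OF Q(2) aK(1)] bK(1)] bK(3) by simp
        hence "(a, b) \<in> H" by (rule KH[OF aK(2) bK(2)])
        thus "b \<in> H `` {a}" by (rule ImageI) simp
      qed
      thus ?thesis
        using deg_H[OF \<open>a \<in> C\<close>] T(2) a finT by (intro card_seteq[symmetric]) (auto simp: deg_def)
    qed
    have "T \<noteq> {}" using T(2) by auto
    then obtain a where a: "a \<in> T" by blast
    have aK: "a \<in> ?K" using subsetD[OF T(1) a] subsetD[OF Q(1)] by simp
    have "u \<in> T" if "(a, u) \<in> H\<^sup>*" for u
      using that by (induction rule: rtrancl_induct) (use a nbrs in blast)+
    hence "H.component a \<subseteq> T" by (auto simp: H.component_def)
    hence "?K \<subseteq> T" using H.component_eq[OF aK] by simp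
    hence "card ?K \<le> 3" using card_mono[OF finT] T(2) by metis
    thus False using p(2) by simp
  qed
  hence c2: "c u = 0 \<or> c u = 1" if "u \<in> ?K" for u using c(1) that by force
  define x where "x u = (if u \<in> ?K then if c u = 0 then 1 else -1 else (0::real))" for u
  have x: "eigenfunction C H 4 x"
  proof (rule H.alternating_eigenfunction[OF deg_H])
    show "x v = - x u" if uv: "(u, v) \<in> H" for u v
    proof -
      have "u \<in> ?K \<longleftrightarrow> v \<in> ?K"
        using ImageI[OF uv, of ?K] ImageI[OF H.E_sym[OF uv], of ?K] H.component_closed[of p] by blast
      moreover have "c u \<noteq> c v" if "u \<in> ?K" "v \<in> ?K" using c(2) that uv by blast
      ultimately show ?thesis using c2[of u] c2[of v] by (auto simp: x_def)
    qed
  qed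
  let ?y = "\<lambda>u. if u \<in> C then x u else 0"
  have y: "eigenfunction V E (real w + 4) ?y"
    using eigenfunction_V[OF x] H.eigenfunction_sum_0[OF x] by simp
  have "p \<in> C" "p \<in> ?K" using p(1) H.reps_sub H.component_self by blast+
  hence "p \<in> V" "?y p \<noteq> 0" using V_eq by (auto simp: x_def)
  with y have "multiplicity_ge V E (real w + 4) 1" unfolding multiplicity_ge_1_iff by blast
  hence "multiplicity_ge (pverts F.F) (parcs F.F) (real w + 4) 1" by (simp only: multiplicity_iff)
  then obtain z u where "eigenfunction (pverts F.F) (parcs F.F) (real w + 4) z" "u \<in> pverts F.F" "z u \<noteq> 0"
    unfolding multiplicity_ge_1_iff by blast
  thus False using F.odd_no_eigenvalue[OF assms(1), of z u] by simp
qed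

end

section \<open>Perfect cospectral graphs\<close>

text \<open>
  The case distinction is whether the complement has a component with \<open>m n\<close> vertices. If it has one, the
  graph has the generic structure, except that for \<open>m = 1\<close> and \<open>n = 4\<close> the eigenvalue \<open>w + 4\<close> coincides with
  \<open>N\<close> and says nothing about \<open>H\<close>.
\<close>

theorem (in cospectral) biperfect_iff: "biperfect E V \<longleftrightarrow> even n \<or> n = 3"
proof (cases "\<exists>c\<in>V. m * n \<le> card (D.component c)")
  case True
  then obtain c where c: "c \<in> V" "m * n \<le> card (D.component c)" by blast
  interpret G: cone V E "V - D.component c" "D.component c"
    by (rule cone_of_large_component[OF c])
  interpret cospectral_cone V E w m n "V - D.component c" "D.component c"
    by unfold_locales (use cone_of_large_component[OF c] in auto)
  show ?thesis
  proof (cases "m = 1 \<and> n = 4")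
    case True
    thus ?thesis using biperfect_small_complement by simp
  next
    case False
    have "m * n \<noteq> 4" if "even n"
    proof
      assume "m * n = 4"
      hence "n dvd 4" by (metis dvd_triv_right)
      hence "n \<le> 4" by (intro dvd_imp_le) auto
      hence "n = 4" using that w_m_n(3) by presburger
      thus False using \<open>m * n = 4\<close> False by simp
    qed
    moreover have "n \<ge> 5" if "odd n" "n \<noteq> 3" using that w_m_n(3) by presburger
    ultimately show ?thesis
      using biperfect_even_cycles biperfect_triangles not_biperfect_odd by blast
  qed
next
  case False
  hence m: "m = 1" using D_component_ge_multiple w_m_n(2) by fastforce
  consider "n \<le> 4" | "n = 5" | "n = 6" | "n \<ge> 7" by linarith
  thus ?thesis
  proof cases
    case 1
    thus ?thesis using biperfect_small_complement[OF m] w_m_n(3) by (cases "n = 3"; cases "n = 4") auto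
  next
    case 2
    thus ?thesis using pentagon_component[OF m] False m by simp
  next
    case 3
    then obtain c where c: "c \<in> V" "5 \<le> card (D.component c)"
      using D_component_ge_single[OF m] by auto
    hence "card (D.component c) = 5" using False m 3 by force
    thus ?thesis using hexagon_biperfect[OF m 3 c(1)] 3 by simp
  next
    case 4
    thus ?thesis using D_component_ge_single[OF m] False m by force
  qed
qed

theorem theorem7p2:
  fixes w m n :: nat and G :: "'a pair_pre_digraph"
  assumes "w \<ge> 1" and "m \<ge> 1" and "n \<ge> 3"
    and "pair_graph G"
    and "Digraph_Component.connected (with_proj G)"
    and "laplacian_spectrum G
       = laplacian_spectrum (graph_join (complete_graph w) (graph_copies m (cycle_graph n)))"
  shows "perfect_graph G \<and> perfect_graph (complement_graph G) \<longleftrightarrow> even n \<or> n = 3"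
proof -
  interpret F: cycle_cone w m n by unfold_locales (use assms in auto)
  have G: "simple_graph (pverts G) (parcs G)" by (rule pair_graph_simple_graph[OF assms(4)])
  have spec: "laplacian_spectrum G = laplacian_spectrum F.F"
    using assms(6) by (simp add: F.F_def)
  have F: "simple_graph (pverts F.F) (parcs F.F)" by (rule F.simple_graph_axioms)
  interpret simple_graph "pverts G" "parcs G" by (rule G)
  interpret cospectral "pverts G" "parcs G" w m n
  proof unfold_locales
    show "card (pverts G) = w + m * n"
      using cospectral_invariants(1)[OF G F spec] F.card_F by simp
    show "(\<Sum>u\<in>pverts G. deg (parcs G) u) = w * (w + m * n - 1) + m * n * (w + 2)"
      using cospectral_invariants(2)[OF G F spec] F.sum_deg_F(1) by simp
    show "(\<Sum>u\<in>pverts G. (deg (parcs G) u)\<^sup>2) = w * (w + m * n - 1)\<^sup>2 + m * n * (w + 2)\<^sup>2"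
      using cospectral_invariants(3)[OF G F spec] F.sum_deg_F(2) by simp
    show "multiplicity_ge (pverts G) (parcs G) l k \<longleftrightarrow> multiplicity_ge (pverts F.F) (parcs F.F) l k" for l k
      using cospectral_multiplicity_ge[OF G F spec] cospectral_multiplicity_ge[OF F G spec[symmetric]] by blast
  qed
  show ?thesis using perfect_complement_iff_biperfect[OF G] biperfect_iff by simp
qed

end
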